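(* Let $k,n,r$ be integers with $k\ge1$, $0\le r\le k$ and $2k\le r+n$. The entries of the matrix $PQ^T$ generate the prime ideal of the spinor-helicity variety $\mathrm{SH}(k,n,r)$ in the coordinate ring of $\mathrm{Gr}(k,n)\times\mathrm{Gr}(k,n)$. In symbols, $$I_{k,n,r}=J_{k,n}+\tilde J_{k,n}+\langle\text{entries of }PQ^T\rangle .$$
   Context: $\mathrm{Gr}(k,n)\subset\mathbb{P}^{\binom nk-1}$ is the Grassmannian of $k$-dimensional subspaces of $\mathbb{C}^n$ in its Plücker embedding, and $\mathrm{SH}(k,n,r)=\{(V,W)\in\mathrm{Gr}(k,n)\times\mathrm{Gr}(k,n):\dim(V\cap W^\perp)\ge k-r\}\subset\mathbb{P}^{\binom nk-1}\times\mathbb{P}^{\binom nk-1}$, where $W^\perp$ is the orthogonal complement for the standard bilinear form on $\mathbb{C}^n$. $R=\mathbb{C}[\langle i_1\cdots i_k\rangle,[j_1\cdots j_k]]$ is the polynomial ring in $2\binom nk$ variables, with $1\le i_1<\dots<i_k\le n$ and $1\le j_1<\dots<j_k\le n$; the $\langle I\rangle$ are Plücker coordinates of $V$ and the $[J]$ are Plücker coordinates of $W$. Brackets with arbitrary index sequences are defined by antisymmetry: permuting the indices multiplies the bracket by the sign of the permutation, and a bracket with a repeated index is $0$. $I_{k,n,r}\subset R$ is the bihomogeneous prime ideal of all polynomials vanishing on (the bi-affine cone over) $\mathrm{SH}(k,n,r)$. $J_{k,n}$ is the Plücker ideal of $\mathrm{Gr}(k,n)$ in the variables $\langle I\rangle$,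 and $\tilde J_{k,n}$ is the Plücker ideal of $\mathrm{Gr}(k,n)$ in the variables $[J]$ (both extended to $R$). $P$ and $Q$ are the matrices with rows indexed by $\binom{[n]}{k-r-1}$ and columns indexed by $\binom{[n]}{r+1}$, where $\binom{[n]}{s}$ denotes the set of $s$-element subsets of $[n]=\{1,\dots,n\}$, with entries $$P_{I,J}=\langle I\,J\rangle,\qquad Q_{I,J}=[I\,J],$$ where $I$ and $J$ are written as increasing sequences and concatenated. (For $r=k$ these matrices have no rows, and $PQ^T$ has no entries.) *)

theory Defs
  imports
    "HOL-Library.Poly_Mapping"
    "HOL-Combinatorics.List_Permutation"
    "HOL-Algebra.Ideal"
    "Jordan_Normal_Form.DL_Rank"
    "Jordan_Normal_Form.DL_Submatrix"
begin

text \<open>Polynomials in variables from \<open>'v\<close> are finitely supported maps from monomials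
  (finitely supported exponent vectors) to coefficients.\<close>

type_synonym 'v cpoly = "('v \<Rightarrow>\<^sub>0 nat) \<Rightarrow>\<^sub>0 complex"

definition var :: "'v \<Rightarrow> 'v cpoly" where
  "var x = Poly_Mapping.single (Poly_Mapping.single x 1) 1"

definition eval_cpoly :: "('v \<Rightarrow> complex) \<Rightarrow> 'v cpoly \<Rightarrow> complex" where
  "eval_cpoly a f = (\<Sum>m\<in>Poly_Mapping.keys f. Poly_Mapping.lookup f m *
      (\<Prod>x\<in>Poly_Mapping.keys m. a x ^ Poly_Mapping.lookup m x))"

definition cpoly_ring :: "'v set \<Rightarrow> 'v cpoly ring" where
  "cpoly_ring X =
     \<lparr>carrier = {f. \<forall>m\<in>Poly_Mapping.keys f. Poly_Mapping.keys m \<subseteq> X},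
      mult = (*), one = 1, zero = 0, add = (+)\<rparr>"

lemma cring_cpoly_ring: "cring (cpoly_ring X)"
proof -
  let ?C = "{f :: 'a cpoly. \<forall>m\<in>Poly_Mapping.keys f. Poly_Mapping.keys m \<subseteq> X}"
  have add: "f + g \<in> ?C" if "f \<in> ?C" "g \<in> ?C" for f g
    using that keys_add[of f g] by blast
  have keys_sum: "Poly_Mapping.keys (a + b) \<subseteq> X"
    if "Poly_Mapping.keys a \<subseteq> X" "Poly_Mapping.keys b \<subseteq> X" for a b :: "'a \<Rightarrow>\<^sub>0 nat"
    using that keys_add[of a b] by blast
  have mult: "f * g \<in> ?C" if f: "f \<in> ?C" and g: "g \<in> ?C" for f g
  proof -
    have "Poly_Mapping.keys m \<subseteq> X" if m: "m \<in> Poly_Mapping.keys (f * g)" for m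
    proof -
      obtain a b where "m = a + b" "a \<in> Poly_Mapping.keys f" "b \<in> Poly_Mapping.keys g"
        using m keys_mult[of f g] by blast
      with f g keys_sum show ?thesis by blast
    qed
    then show ?thesis by blast
  qed
  have uminus: "- f \<in> ?C" if "f \<in> ?C" for f
    using that by simp
  have zero: "(0 :: 'a cpoly) \<in> ?C" by simp
  have one: "(1 :: 'a cpoly) \<in> ?C"
    unfolding single_one[symmetric] by simp
  have simps: "carrier (cpoly_ring X) = ?C" "mult (cpoly_ring X) = (*)" "one (cpoly_ring X) = 1"
    "zero (cpoly_ring X) = 0" "add (cpoly_ring X) = (+)"
    by (simp_all add: cpoly_ring_def)
  have "abelian_group (cpoly_ring X)"
  proof (rule abelian_groupI, unfold simps)
    show "\<exists>g\<in>?C. g + f = 0" if "f \<in> ?C" for f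
      using uminus[OF that] by (rule bexI[rotated]) (rule left_minus)
  qed (rule add zero add.assoc add.commute add_0_left; assumption?)+
  moreover have "comm_monoid (cpoly_ring X)"
    by (rule comm_monoidI; unfold simps) (rule mult one mult.assoc mult.commute mult_1_left; assumption?)+
  ultimately show "cring (cpoly_ring X)"
    by (rule cringI; unfold simps) (rule distrib_right)
qed

text \<open>The index set \<open>[n]\<close> is \<open>{..<n}\<close>, so that it matches the 0-based indexing of vectors and
  matrices.\<close>

definition subsets :: "nat \<Rightarrow> nat \<Rightarrow> nat set set" where
  "subsets n s = {I. I \<subseteq> {..<n} \<and> card I = s}"

text \<open>\<open>Angle I\<close> and \<open>Square J\<close> are the variables \<open>\<langle>i\<^sub>1\<cdots>i\<^sub>k\<rangle>\<close> and \<open>[j\<^sub>1\<cdots>j\<^sub>k]\<close>, where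
  the increasing sequence is recorded by the set of its entries.\<close>

datatype bracket_var = Angle "nat set" | Square "nat set"

definition SH_ring :: "nat \<Rightarrow> nat \<Rightarrow> bracket_var cpoly ring" where
  "SH_ring k n = cpoly_ring (Angle ` subsets n k \<union> Square ` subsets n k)"

definition sorting_sign :: "nat list \<Rightarrow> int" where
  "sorting_sign xs =
     sign (THE p. p permutes {..<length xs} \<and> permute_list p (sort xs) = xs)"

text \<open>The bracket of an arbitrary index sequence; \<open>b\<close> is \<^const>\<open>Angle\<close> or \<^const>\<open>Square\<close>.\<close>

definition bracket :: "(nat set \<Rightarrow> bracket_var) \<Rightarrow> nat list \<Rightarrow> bracket_var cpoly" where
  "bracket b xs = (if distinct xs then of_int (sorting_sign xs) * var (b (set xs)) else 0)"

lemma sorting_sign_eq: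
  assumes "distinct xs" "p permutes {..<length xs}" "permute_list p (sort xs) = xs"
  shows "sorting_sign xs = sign p"
proof -
  have "q = p" if q: "q permutes {..<length xs}" "permute_list q (sort xs) = xs" for q
  proof
    fix i
    show "q i = p i"
    proof (cases "i < length xs")
      case True
      then have lt: "q i < length xs" "p i < length xs"
        using permutes_in_image[OF q(1), of i] permutes_in_image[OF assms(2), of i] by auto
      have "sort xs ! q i = sort xs ! p i"
        using permute_list_nth[of q "sort xs" i] permute_list_nth[of p "sort xs" i]
          q assms True by simp
      then show ?thesis
        using lt assms(1) nth_eq_iff_index_eq[of "sort xs" "q i" "p i"] by simp
    next
      case False
      then show ?thesis using q(1) assms(2) by (simp add: permutes_def)
    qed
  qed
  then have "(THE p. p permutes {..<length xs} \<and> permute_list p (sort xs) = xs) = p"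
    using assms by blast
  then show ?thesis by (simp add: sorting_sign_def)
qed

lemma bracket_increasing:
  assumes "finite I"
  shows "bracket b (sorted_list_of_set I) = var (b I)"
proof -
  have "sorting_sign (sorted_list_of_set I) = sign (id :: nat \<Rightarrow> nat)"
    by (rule sorting_sign_eq) (auto simp: permutes_id sorted_sort_id)
  then show ?thesis using assms by (simp add: bracket_def)
qed

lemma bracket_repeated: "\<not> distinct xs \<Longrightarrow> bracket b xs = 0"
  by (simp add: bracket_def)

lemma bracket_permute:
  assumes p: "p permutes {..<length xs}"
  shows "bracket b (permute_list p xs) = of_int (sign p) * bracket b xs"
proof (cases "distinct xs")
  case True
  have "mset xs = mset (sort xs)" by simp
  then obtain q where q: "q permutes {..<length xs}" "permute_list q (sort xs) = xs"
    using mset_eq_permutation[of xs "sort xs"] by auto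
  have "permute_list (q \<circ> p) (sort xs) = permute_list p xs"
    using permute_list_compose[of p "sort xs" q] p q by simp
  moreover have "sort (permute_list p xs) = sort xs"
    by (rule properties_for_sort) (simp_all add: p)
  ultimately have "sorting_sign (permute_list p xs) = sign (q \<circ> p)"
    using True p q(1) by (intro sorting_sign_eq) (auto intro: permutes_compose)
  also have "\<dots> = sign q * sign p"
    using p q(1) by (intro sign_compose) (auto simp: permutation_permutes)
  also have "sign q = sorting_sign xs"
    using sorting_sign_eq[OF True q] by simp
  finally show ?thesis using True p by (simp add: bracket_def)
next
  case False
  then show ?thesis using p by (simp add: bracket_def)
qed

abbreviation subspace_dim :: "nat \<Rightarrow> complex vec set \<Rightarrow> nat" where
  "subspace_dim n U \<equiv> vectorspace.dim (class_ring :: complex ring)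
     (module_vec TYPE(complex) n\<lparr>carrier := U\<rparr>)"

text \<open>The complement is taken for the bilinear form \<open>\<Sum>i. x i * y i\<close>; no conjugation.\<close>

abbreviation perp :: "nat \<Rightarrow> complex vec set \<Rightarrow> complex vec set" where
  "perp n W \<equiv> vec_module.orthogonal_complement n W"

definition Gr :: "nat \<Rightarrow> nat \<Rightarrow> complex vec set set" where
  "Gr k n = {V. VectorSpace.subspace (class_ring :: complex ring) V (module_vec TYPE(complex) n)
      \<and> subspace_dim n V = k}"

definition SH :: "nat \<Rightarrow> nat \<Rightarrow> nat \<Rightarrow> (complex vec set \<times> complex vec set) set" where
  "SH k n r = {(V, W). V \<in> Gr k n \<and> W \<in> Gr k n \<and> subspace_dim n (V \<inter> perp n W) \<ge> k - r}"

text \<open>The line in the affine cone over the Grassmannian spanned by the Pluecker vector of \<open>V\<close>;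
  values outside \<^term>\<open>subsets n k\<close> are irrelevant.\<close>

definition pluecker_line :: "nat \<Rightarrow> nat \<Rightarrow> complex vec set \<Rightarrow> (nat set \<Rightarrow> complex) set" where
  "pluecker_line k n V = {p. \<exists>A\<in>carrier_mat k n. vec_space.row_space n A = V \<and>
      (\<exists>c. \<forall>I\<in>subsets n k. p I = c * det (submatrix A UNIV I))}"

definition SH_ideal :: "nat \<Rightarrow> nat \<Rightarrow> nat \<Rightarrow> bracket_var cpoly set" where
  "SH_ideal k n r = {f \<in> carrier (SH_ring k n). \<forall>x. \<forall>(V, W)\<in>SH k n r.
      x \<circ> Angle \<in> pluecker_line k n V \<longrightarrow> x \<circ> Square \<in> pluecker_line k n W \<longrightarrow>
      eval_cpoly x f = 0}"

text \<open>The ideal of \<open>Gr(k,n)\<close> in the polynomial ring on the variables \<open>b I\<close> only.\<close>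

definition pluecker_ideal ::
  "(nat set \<Rightarrow> bracket_var) \<Rightarrow> nat \<Rightarrow> nat \<Rightarrow> bracket_var cpoly set" where
  "pluecker_ideal b k n = {f \<in> carrier (cpoly_ring (b ` subsets n k)). \<forall>x. \<forall>V\<in>Gr k n.
      x \<circ> b \<in> pluecker_line k n V \<longrightarrow> eval_cpoly x f = 0}"

definition bracket_matrix ::
  "(nat set \<Rightarrow> bracket_var) \<Rightarrow> nat set \<Rightarrow> nat set \<Rightarrow> bracket_var cpoly" where
  "bracket_matrix b I J = bracket b (sorted_list_of_set I @ sorted_list_of_set J)"

text \<open>The row index sets have size \<open>k - r - 1\<close>; for \<open>r = k\<close> there are none, which truncated
  subtraction would not express.\<close>

definition row_indices :: "nat \<Rightarrow> nat \<Rightarrow> nat \<Rightarrow> nat set set" where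
  "row_indices k n r = {I. I \<subseteq> {..<n} \<and> card I + r + 1 = k}"

definition PQT :: "nat \<Rightarrow> nat \<Rightarrow> nat set \<Rightarrow> nat set \<Rightarrow> bracket_var cpoly" where
  "PQT n r I I' =
     (\<Sum>J\<in>subsets n (r + 1). bracket_matrix Angle I J * bracket_matrix Square I' J)"

definition PQT_entries :: "nat \<Rightarrow> nat \<Rightarrow> nat \<Rightarrow> bracket_var cpoly set" where
  "PQT_entries k n r = {PQT n r I I' | I I'. I \<in> row_indices k n r \<and> I' \<in> row_indices k n r}"

end

theory Submission
  imports Defs "HOL-Combinatorics.Multiset_Permutations"
begin

text \<open>
  Let \<open>V\<close> and \<open>W\<close> be the row spaces of \<open>A\<close> and \<open>B\<close>. The pair lies on the variety if and only if
  \<open>W\<^sup>\<bottom>\<close> contains \<open>k - r\<close> independent vectors of \<open>V\<close>, and in a basis of \<open>V\<close> through such vectors the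
  entries of \<open>P Q\<^sup>T\<close> vanish term by term (\<open>contraction_vanishes\<close>, \<open>PQT_vanishes_on_SH\<close>). So the
  right-hand side of the theorem, called \<open>relations\<close> below, is contained in the ideal of the variety.

  The converse is a standard monomial argument. Attach to \<open>\<langle>I\<rangle>\<close> the column \<open>I\<close>, placed in the rows
  from \<open>0\<close> on, and to \<open>[K]\<close> the column \<open>{..<n} - K\<close>, placed in the rows from \<open>r\<close> on. A monomial is
  standard if its columns, those of the square brackets first, can be arranged into a semistandard
  skew tableau; this is a condition on pairs of variables (\<open>compatible\<close>). Two facts give the theorem.

  \<^item> Modulo the relations every polynomial is a combination of standard monomials
    (\<open>reducible_carrier\<close>). For two incomparable brackets of the same kind this is the classical exchange
    relation (\<open>straightens_same_kind\<close>). An incompatible mixed pair violates the tableau condition at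
    some \<open>x\<close>. Polarizing the entries of \<open>P Q\<^sup>T\<close> and applying inclusion-exclusion gives relations
    \<open>\<Sum>Y. \<langle>I\<^sub>0 Y\<rangle> [K\<^sub>0 Y]\<close> in which \<open>Y\<close> avoids a prescribed set \<open>F\<close> of indices
    (\<open>partial_contraction_in_H\<close>), as long as \<open>F\<close> is small; the violation at \<open>x\<close> says exactly that
    \<open>F = {..<x} - (I \<union> K)\<close> is small enough (\<open>straightens_mixed\<close>). Both kinds of steps strictly
    increase the sum of the squares of the index sums, so rewriting terminates.

  \<^item> Standard monomials are linearly independent as functions on the variety
    (\<open>standard_polynomial_vanishing_on_SH\<close>). Take an invertible matrix \<open>g\<close>, let \<open>V\<close> be spanned by its
    first \<open>k\<close> rows and \<open>W\<^sup>\<bottom>\<close> by the rows from \<open>r\<close> to \<open>r + n - k - 1\<close>. By Jacobi's theorem on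
    complementary minors (\<open>SH_point\<close>) the coordinates \<open>\<langle>I\<rangle>\<close> and \<open>[K]\<close> are, up to signs and a common
    factor, the minors of \<open>g\<close> on these rows and the columns \<open>I\<close> and \<open>{..<n} - K\<close>. If the entries of
    \<open>g\<close> are suitable powers of a large real \<open>t\<close>, each minor is dominated by its diagonal product, and
    the leading exponent of a monomial records the content of every row of its tableau
    (\<open>test_point_leading_term\<close>). The rows of a semistandard tableau are sorted, so the contents
    determine a standard monomial (\<open>standard_monomial_determined\<close>).
\<close>

section \<open>Evaluation of polynomials\<close>

abbreviation keys where "keys \<equiv> Poly_Mapping.keys"
abbreviation lookup where "lookup \<equiv> Poly_Mapping.lookup"
abbreviation single where "single \<equiv> Poly_Mapping.single"

definition monomial_value :: "('v \<Rightarrow> complex) \<Rightarrow> ('v \<Rightarrow>\<^sub>0 nat) \<Rightarrow> complex" where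
  "monomial_value a m = (\<Prod>x\<in>keys m. a x ^ lookup m x)"

lemma monomial_value_superset:
  assumes "finite S" "keys m \<subseteq> S"
  shows "monomial_value a m = (\<Prod>x\<in>S. a x ^ lookup m x)"
  unfolding monomial_value_def
  by (rule prod.mono_neutral_left) (use assms in \<open>auto simp: in_keys_iff\<close>)

lemma monomial_value_zero [simp]: "monomial_value a 0 = 1"
  by (simp add: monomial_value_def)

lemma monomial_value_single [simp]: "monomial_value a (single x e) = a x ^ e"
  by (cases "e = 0") (simp_all add: monomial_value_def)

lemma monomial_value_add: "monomial_value a (m + m') = monomial_value a m * monomial_value a m'"
proof -
  let ?S = "keys m \<union> keys m'"
  have "monomial_value a (m + m') = (\<Prod>x\<in>?S. a x ^ lookup (m + m') x)"
    by (rule monomial_value_superset) (simp_all add: keys_add)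
  also have "\<dots> = (\<Prod>x\<in>?S. a x ^ lookup m x) * (\<Prod>x\<in>?S. a x ^ lookup m' x)"
    by (simp add: lookup_add power_add prod.distrib)
  also have "\<dots> = monomial_value a m * monomial_value a m'"
    using monomial_value_superset[of ?S m a] monomial_value_superset[of ?S m' a] by simp
  finally show ?thesis .
qed

lemma eval_cpoly_superset:
  assumes "finite S" "keys f \<subseteq> S"
  shows "eval_cpoly a f = (\<Sum>m\<in>S. lookup f m * monomial_value a m)"
  unfolding eval_cpoly_def monomial_value_def
  by (rule sum.mono_neutral_left) (use assms in \<open>auto simp: in_keys_iff\<close>)

lemma eval_cpoly_zero [simp]: "eval_cpoly a 0 = 0"
  by (simp add: eval_cpoly_def)

lemma eval_cpoly_single [simp]: "eval_cpoly a (single m c) = c * monomial_value a m"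
  by (cases "c = 0") (simp_all add: eval_cpoly_def monomial_value_def)

lemma eval_cpoly_add: "eval_cpoly a (f + g) = eval_cpoly a f + eval_cpoly a g"
proof -
  let ?S = "keys f \<union> keys g"
  have "eval_cpoly a (f + g) = (\<Sum>m\<in>?S. lookup (f + g) m * monomial_value a m)"
    by (rule eval_cpoly_superset) (simp_all add: keys_add)
  also have "\<dots> = eval_cpoly a f + eval_cpoly a g"
    using eval_cpoly_superset[of ?S f a] eval_cpoly_superset[of ?S g a]
    by (simp add: lookup_add distrib_right sum.distrib)
  finally show ?thesis .
qed

lemma eval_cpoly_sum: "eval_cpoly a (sum F A) = (\<Sum>i\<in>A. eval_cpoly a (F i))"
  by (induction A rule: infinite_finite_induct) (simp_all add: eval_cpoly_add)

lemma poly_mapping_sum_single: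
  fixes f :: "'a \<Rightarrow>\<^sub>0 'b::comm_monoid_add"
  shows "f = (\<Sum>m\<in>keys f. single m (lookup f m))"
proof (rule poly_mapping_eqI)
  fix k
  show "lookup f k =
    lookup (\<Sum>m\<in>keys f. single m (lookup f m)) k"
    by (cases "k \<in> keys f")
      (auto simp: lookup_sum lookup_single when_def in_keys_iff sum.delta)
qed

lemma eval_cpoly_mult: "eval_cpoly a (f * g) = eval_cpoly a f * eval_cpoly a g"
proof -
  let ?t = "\<lambda>f m. single m (lookup f m)"
  have "f * g = (\<Sum>m\<in>keys f. ?t f m) * (\<Sum>m\<in>keys g. ?t g m)"
    using poly_mapping_sum_single[of f] poly_mapping_sum_single[of g] by simp
  also have "\<dots> = (\<Sum>m\<in>keys f. \<Sum>m'\<in>keys g.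
      single (m + m') (lookup f m * lookup g m'))"
    by (simp add: sum_product mult_single)
  also have "eval_cpoly a \<dots> = (\<Sum>m\<in>keys f. \<Sum>m'\<in>keys g.
      (lookup f m * monomial_value a m) * (lookup g m' * monomial_value a m'))"
    by (simp add: eval_cpoly_sum monomial_value_add mult_ac)
  also have "\<dots> = eval_cpoly a f * eval_cpoly a g"
    by (simp add: sum_product[symmetric] eval_cpoly_def monomial_value_def)
  finally show ?thesis .
qed

lemma eval_cpoly_var [simp]: "eval_cpoly a (var x) = a x"
  by (simp add: var_def)

lemma eval_cpoly_of_int [simp]: "eval_cpoly a (of_int c) = of_int c"
  by (simp del: single_of_int add: single_of_int[symmetric])

lemma eval_cpoly_uminus: "eval_cpoly a (- f) = - eval_cpoly a f"
  using eval_cpoly_add[of a f "- f"] by (simp add: eq_neg_iff_add_eq_0 add.commute)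

section \<open>Brackets and minors\<close>

text \<open>The columns of \<open>M\<close> become the rows of the matrix here, because permuting indices then
  permutes rows.\<close>

definition minor :: "(nat \<Rightarrow> nat \<Rightarrow> 'a::comm_ring_1) \<Rightarrow> nat list \<Rightarrow> 'a" where
  "minor M xs = det (mat (length xs) (length xs) (\<lambda>(j, i). M i (xs ! j)))"

lemma minor_expand:
  "minor M xs = (\<Sum>p | p permutes {..<length xs}. of_int (sign p) * (\<Prod>j<length xs. M (p j) (xs ! j)))"
proof -
  have "minor M xs = (\<Sum>p | p permutes {0..<length xs}. of_int (sign p) *
      (\<Prod>j = 0..<length xs. mat (length xs) (length xs) (\<lambda>(j, i). M i (xs ! j)) $$ (j, p j)))"
    unfolding minor_def by (rule det_def') simp
  also have "\<dots> = (\<Sum>p | p permutes {..<length xs}. of_int (sign p) * (\<Prod>j<length xs. M (p j) (xs ! j)))"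
    by (intro sum.cong prod.cong arg_cong2[where f = "(*)"])
      (auto simp: lessThan_atLeast0 dest: permutes_in_image)
  finally show ?thesis .
qed

lemma minor_permute:
  assumes p: "p permutes {..<length xs}"
  shows "minor M (permute_list p xs) = of_int (sign p) * minor M xs"
proof -
  let ?k = "length xs" and ?A = "mat (length xs) (length xs) (\<lambda>(j, i). M i (xs ! j))"
  have "mat ?k ?k (\<lambda>(j, i). M i (permute_list p xs ! j)) = mat ?k ?k (\<lambda>(j, i). ?A $$ (p j, i))"
    using p permutes_in_image[OF p] by (intro eq_matI) (auto simp: permute_list_nth)
  then show ?thesis
    using det_permute_rows[of ?A ?k p] p by (simp add: minor_def lessThan_atLeast0)
qed

lemma minor_not_distinct:
  assumes "\<not> distinct xs"
  shows "minor M xs = 0"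
proof -
  obtain i j where ij: "i < length xs" "j < length xs" "i \<noteq> j" "xs ! i = xs ! j"
    using assms by (auto simp: distinct_conv_nth)
  show ?thesis
    unfolding minor_def
    by (rule det_identical_rows[of _ "length xs" i j]) (use ij in auto)
qed

lemma distinct_obtain_permutation:
  assumes "distinct xs" "finite I" "set xs = I"
  obtains p where "p permutes {..<length xs}" "permute_list p (sorted_list_of_set I) = xs"
    "length (sorted_list_of_set I) = length xs"
proof -
  have eq: "mset xs = mset (sorted_list_of_set I)"
    using assms by (metis sorted_list_of_set_sort_remdups distinct_remdups_id mset_sort)
  then obtain p where "p permutes {..<length (sorted_list_of_set I)}"
    "permute_list p (sorted_list_of_set I) = xs"
    by (rule mset_eq_permutation)
  then show thesis using that mset_eq_length[OF eq] by simp
qed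

lemma card_below_nth_sorted:
  assumes "finite I" "j < card I"
  shows "card {a \<in> I. a < sorted_list_of_set I ! j} = j"
proof -
  let ?xs = "sorted_list_of_set I"
  have strict: "sorted_wrt (<) ?xs" by (rule strict_sorted_list_of_set)
  have len: "length ?xs = card I" by simp
  have "{a \<in> I. a < ?xs ! j} = (!) ?xs ` {..<j}"
  proof (intro equalityI subsetI)
    fix a assume a: "a \<in> {a \<in> I. a < ?xs ! j}"
    then obtain i where i: "i < length ?xs" "a = ?xs ! i"
      using assms(1) by (metis (mono_tags) in_set_conv_nth mem_Collect_eq set_sorted_list_of_set)
    have "i < j"
    proof (rule ccontr)
      assume "\<not> i < j"
      then have "?xs ! j \<le> ?xs ! i" using i(1) by (intro sorted_nth_mono) auto
      then show False using a i by auto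
    qed
    then show "a \<in> (!) ?xs ` {..<j}" using i by auto
  next
    fix a assume "a \<in> (!) ?xs ` {..<j}"
    then obtain i where i: "i < j" "a = ?xs ! i" by auto
    have "?xs ! i \<in> set ?xs" using i assms len by (intro nth_mem) simp
    moreover have "?xs ! i < ?xs ! j"
      using sorted_wrt_nth_less[OF strict i(1)] assms len by simp
    ultimately show "a \<in> {a \<in> I. a < ?xs ! j}" using i assms by simp
  qed
  moreover have "inj_on ((!) ?xs) {..<j}"
    using assms len by (intro inj_on_nth) auto
  ultimately show ?thesis by (simp add: card_image)
qed

lemma pick_eq_nth_sorted:
  assumes "finite I" "j < card I"
  shows "pick I j = sorted_list_of_set I ! j"
proof -
  have "sorted_list_of_set I ! j \<in> I"
    using nth_mem[of j "sorted_list_of_set I"] assms by simp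
  from pick_card_in_set[OF this] show ?thesis
    by (simp add: card_below_nth_sorted[OF assms])
qed

lemma nth_sorted_less_iff:
  assumes "finite I" "j < card I"
  shows "sorted_list_of_set I ! j < x \<longleftrightarrow> j < card (I \<inter> {..<x})"
proof
  let ?y = "sorted_list_of_set I ! j"
  have y: "?y \<in> I" using nth_mem[of j "sorted_list_of_set I"] assms by simp
  {
    assume "?y < x"
    then have "insert ?y {a \<in> I. a < ?y} \<subseteq> I \<inter> {..<x}" using y by auto
    then have "card (insert ?y {a \<in> I. a < ?y}) \<le> card (I \<inter> {..<x})"
      using assms by (intro card_mono) auto
    moreover have "card (insert ?y {a \<in> I. a < ?y}) = Suc j"
      using assms card_below_nth_sorted[OF assms] by (subst card_insert_disjoint) auto
    ultimately show "j < card (I \<inter> {..<x})" by simp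
  }
  {
    assume less: "j < card (I \<inter> {..<x})"
    show "?y < x"
    proof (rule ccontr)
      assume "\<not> ?y < x"
      then have "I \<inter> {..<x} \<subseteq> {a \<in> I. a < ?y}" by auto
      then have "card (I \<inter> {..<x}) \<le> card {a \<in> I. a < ?y}"
        using assms by (intro card_mono) auto
      then show False using less card_below_nth_sorted[OF assms] by simp
    qed
  }
qed

lemma det_submatrix_eq_minor:
  assumes A: "A \<in> carrier_mat k n" and I: "I \<in> subsets n k"
  shows "det (submatrix A UNIV I) = minor (\<lambda>i j. A $$ (i, j)) (sorted_list_of_set I)"
proof -
  have fin: "finite I" and c: "card I = k" and sub: "I \<subseteq> {..<n}"
    using I by (auto simp: subsets_def intro: finite_subset)
  have c2: "card {j. j < n \<and> j \<in> I} = k"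
  proof -
    have "{j. j < n \<and> j \<in> I} = I" using sub by auto
    then show ?thesis using c by simp
  qed
  have "submatrix A UNIV I = transpose_mat (mat k k (\<lambda>(j, i). A $$ (i, sorted_list_of_set I ! j)))"
    using A c c2 fin by (intro eq_matI) (auto simp: submatrix_def pick_UNIV pick_eq_nth_sorted)
  then show ?thesis
    using c by (simp add: minor_def det_transpose[of _ k])
qed

lemma eval_bracket:
  assumes x: "\<And>I. I \<in> subsets n k \<Longrightarrow> x (b I) = c * minor M (sorted_list_of_set I)"
    and xs: "length xs = k" "set xs \<subseteq> {..<n}"
  shows "eval_cpoly x (bracket b xs) = c * minor M xs"
proof (cases "distinct xs")
  case True
  let ?I = "set xs"
  obtain p where p: "p permutes {..<length xs}" "permute_list p (sorted_list_of_set ?I) = xs"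
    "length (sorted_list_of_set ?I) = length xs"
    using distinct_obtain_permutation[OF True] by auto
  have I: "?I \<in> subsets n k" using xs True by (simp add: subsets_def distinct_card)
  have "bracket b xs = of_int (sign p) * var (b ?I)"
    using bracket_permute[of p "sorted_list_of_set ?I" b] p by (simp add: bracket_increasing)
  then have "eval_cpoly x (bracket b xs) = of_int (sign p) * (c * minor M (sorted_list_of_set ?I))"
    by (simp add: eval_cpoly_mult x[OF I])
  also have "\<dots> = c * minor M xs"
    using minor_permute[of p "sorted_list_of_set ?I" M] p by simp
  finally show ?thesis .
qed (simp add: bracket_repeated minor_not_distinct)

lemma prod_lessThan_add:
  fixes f :: "nat \<Rightarrow> 'a::comm_monoid_mult"
  shows "(\<Prod>j<a + b. f j) = (\<Prod>j<a. f j) * (\<Prod>l<b. f (a + l))"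
  by (induction b) (simp_all add: mult.assoc)

text \<open>Stated for an arbitrary alternating function because it is applied to brackets and to minors.
  A transposition of two indices of the block is a transposition of the whole sequence, and
  transpositions generate the permutations of the block.\<close>

lemma alternating_permute_block:
  fixes F :: "nat list \<Rightarrow> 'a::comm_ring_1"
  assumes alt: "\<And>xs p. p permutes {..<length xs} \<Longrightarrow> F (permute_list p xs) = of_int (sign p) * F xs"
    and p: "p permutes {..<length xs}"
  shows "F (us @ permute_list p xs @ vs) = of_int (sign p) * F (us @ xs @ vs)"
proof -
  define m where "m = length xs"
  have "p permutes {..<m}" using p by (simp add: m_def)
  moreover have "finite {..<m}" by simp
  ultimately have "\<forall>xs. length xs = m \<longrightarrow>
      F (us @ permute_list p xs @ vs) = of_int (sign p) * F (us @ xs @ vs)"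
  proof (induction p rule: permutes_induct)
    case id
    show ?case by (simp add: id_def[symmetric])
  next
    case (swap a b p)
    let ?t = "transpose a b" and ?l = "length us"
    show ?case
    proof (intro allI impI)
      fix xs :: "nat list" assume len: "length xs = m"
      have t: "?t permutes {..<length xs}" using swap len by (intro permutes_swap_id) auto
      have perm: "permutation p" "permutation ?t"
        by (rule permutes_imp_permutation[OF _ swap(4)], simp) (rule permutation_swap_id)
      have T: "transpose (?l + a) (?l + b) permutes {..<length (us @ xs @ vs)}"
        using swap len by (intro permutes_swap_id) auto
      have "us @ permute_list ?t xs @ vs
          = permute_list (transpose (?l + a) (?l + b)) (us @ xs @ vs)"
      proof (rule nth_equalityI)
        fix i assume "i < length (us @ permute_list ?t xs @ vs)"
        then have i: "i < length us + length xs + length vs" by simp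
        have "permute_list (transpose (?l + a) (?l + b)) (us @ xs @ vs) ! i
            = (us @ xs @ vs) ! transpose (?l + a) (?l + b) i"
          by (rule permute_list_nth[OF T]) (use i in simp)
        moreover have "permute_list ?t xs ! (i - ?l) = xs ! ?t (i - ?l)" if "?l \<le> i" "i < ?l + m"
          by (rule permute_list_nth[OF t]) (use that len in auto)
        ultimately show "(us @ permute_list ?t xs @ vs) ! i
            = permute_list (transpose (?l + a) (?l + b)) (us @ xs @ vs) ! i"
          using swap(1,2) len i by (auto simp: nth_append transpose_def)
      qed simp
      then have *: "F (us @ permute_list ?t xs @ vs) = - F (us @ xs @ vs)"
        using alt[OF T] swap(3) by (simp add: sign_swap_id)
      have "permute_list (?t \<circ> p) xs = permute_list p (permute_list ?t xs)"
        using swap(4) len by (intro permute_list_compose) simp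
      then have "F (us @ permute_list (?t \<circ> p) xs @ vs)
          = of_int (sign p) * F (us @ permute_list ?t xs @ vs)"
        using swap(5) len by simp
      then show "F (us @ permute_list (?t \<circ> p) xs @ vs) = of_int (sign (?t \<circ> p)) * F (us @ xs @ vs)"
        using * perm swap(3) by (simp add: sign_compose sign_swap_id)
    qed
  qed
  then show ?thesis by (simp add: m_def)
qed

lemma bracket_permute_block:
  assumes "p permutes {..<length xs}"
  shows "bracket b (us @ permute_list p xs @ vs) = of_int (sign p) * bracket b (us @ xs @ vs)"
  by (rule alternating_permute_block[OF bracket_permute assms])

text \<open>The two signs cancel when the same block is reordered in both factors.\<close>

lemma alternating_mult_reorder:
  fixes F G :: "nat list \<Rightarrow> 'a::comm_ring_1"
  assumes F: "\<And>xs p. p permutes {..<length xs} \<Longrightarrow> F (permute_list p xs) = of_int (sign p) * F xs"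
    and G: "\<And>xs p. p permutes {..<length xs} \<Longrightarrow> G (permute_list p xs) = of_int (sign p) * G xs"
    and eq: "mset ys = mset zs"
  shows "F (us @ ys) * G (vs @ ys) = F (us @ zs) * G (vs @ zs)"
proof -
  obtain p where p: "p permutes {..<length zs}" "permute_list p zs = ys"
    using mset_eq_permutation[OF eq] by blast
  have one: "of_int (sign p) * of_int (sign p) = (1 :: 'a)"
    by (metis of_int_1 of_int_mult sign_idempotent)
  have "F (us @ ys) = of_int (sign p) * F (us @ zs)" "G (vs @ ys) = of_int (sign p) * G (vs @ zs)"
    using alternating_permute_block[of F p zs us "[]", OF F p(1)]
      alternating_permute_block[of G p zs vs "[]", OF G p(1)] p(2) by simp_all
  then have "F (us @ ys) * G (vs @ ys)
      = (of_int (sign p) * of_int (sign p)) * (F (us @ zs) * G (vs @ zs))"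
    by (simp only: mult_ac)
  then show ?thesis by (simp add: one)
qed

section \<open>Relations between minors\<close>

lemma sum_permutations_eq_0:
  fixes N :: "nat \<Rightarrow> nat \<Rightarrow> 'a::comm_ring_1"
  assumes "l < m" "l' < m" "l \<noteq> l'" "N l = N l'"
  shows "(\<Sum>p | p permutes {..<m}. of_int (sign p) * (\<Prod>i<m. N i (p i))) = 0"
proof -
  let ?A = "mat m m (\<lambda>(i, j). N i j)"
  have "det ?A = (\<Sum>p | p permutes {0..<m}. of_int (sign p) * (\<Prod>i = 0..<m. ?A $$ (i, p i)))"
    by (rule det_def') simp
  also have "\<dots> = (\<Sum>p | p permutes {..<m}. of_int (sign p) * (\<Prod>i<m. N i (p i)))"
    by (intro sum.cong prod.cong arg_cong2[where f = "(*)"])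
      (auto simp: lessThan_atLeast0 dest: permutes_in_image)
  finally show ?thesis
    using det_identical_rows[of ?A m l l'] assms by auto
qed

text \<open>Expanding both minors turns the sum over \<open>p\<close> into determinants of size \<open>m > k\<close> whose rows
  are taken from only \<open>k\<close> rows, so that two of them agree.\<close>

lemma exchange_sum_vanishes:
  fixes M :: "nat \<Rightarrow> nat \<Rightarrow> 'a::comm_ring_1"
  assumes S: "length S = m" "k < m" and u: "length u + q = k" and v: "length v + (m - q) = k"
  shows "(\<Sum>p | p permutes {..<m}. of_int (sign p) *
      (minor M (u @ take q (permute_list p S)) * minor M (drop q (permute_list p S) @ v))) = 0"
proof -
  let ?P = "\<lambda>m. {p. p permutes {..<m::nat}}"
  define C where "C = (\<lambda>\<alpha> \<beta>. of_int (sign \<alpha>) * of_int (sign \<beta>) *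
    ((\<Prod>j<length u. M (\<alpha> j) (u ! j)) * (\<Prod>j<length v. M (\<beta> (m - q + j)) (v ! j))))"
  \<comment> \<open>the row used at position \<open>l\<close> of \<open>S\<close>: it belongs to the first minor for \<open>l < q\<close> and to the second
    one otherwise\<close>
  define \<rho> where "\<rho> = (\<lambda>(\<alpha>::nat \<Rightarrow> nat) \<beta> l. if l < q then \<alpha> (length u + l) else \<beta> (l - q))"
  have q: "q \<le> k" "q < m" using u S(2) by simp_all
  have expand: "minor M (u @ take q (permute_list p S)) * minor M (drop q (permute_list p S) @ v)
      = (\<Sum>\<alpha>\<in>?P k. \<Sum>\<beta>\<in>?P k. C \<alpha> \<beta> * (\<Prod>l<m. M (\<rho> \<alpha> \<beta> l) (S ! p l)))"
    if p: "p \<in> ?P m" for p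
  proof -
    let ?S = "permute_list p S"
    have nth: "?S ! l = S ! p l" if "l < m" for l
      using permute_list_nth[of p S l] p that S by simp
    have 1: "(\<Prod>j<k. M (\<alpha> j) ((u @ take q ?S) ! j))
        = (\<Prod>j<length u. M (\<alpha> j) (u ! j)) * (\<Prod>l<q. M (\<alpha> (length u + l)) (S ! p l))" for \<alpha>
      using prod_lessThan_add[of "\<lambda>j. M (\<alpha> j) ((u @ take q ?S) ! j)" "length u" q] u q
      by (simp add: nth_append nth)
    have 2: "(\<Prod>j<k. M (\<beta> j) ((drop q ?S @ v) ! j))
        = (\<Prod>l<m - q. M (\<beta> l) (S ! p (q + l))) * (\<Prod>j<length v. M (\<beta> (m - q + j)) (v ! j))" for \<beta>
    proof -
      define d where "d = m - q"
      have d: "d + length v = k" "length (drop q ?S) = d" "q + d = m" using v q S by (simp_all add: d_def)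
      have "(\<Prod>j<k. M (\<beta> j) ((drop q ?S @ v) ! j))
          = (\<Prod>l<d. M (\<beta> l) (S ! p (q + l))) * (\<Prod>j<length v. M (\<beta> (d + j)) (v ! j))"
        using prod_lessThan_add[of "\<lambda>j. M (\<beta> j) ((drop q ?S @ v) ! j)" d "length v"] d q S
        by (simp add: nth_append nth)
      then show ?thesis by (simp add: d_def)
    qed
    have 3: "(\<Prod>l<m. M (\<rho> \<alpha> \<beta> l) (S ! p l)) = (\<Prod>l<q. M (\<alpha> (length u + l)) (S ! p l)) *
        (\<Prod>l<m - q. M (\<beta> l) (S ! p (q + l)))" for \<alpha> \<beta>
      using prod_lessThan_add[of "\<lambda>l. M (\<rho> \<alpha> \<beta> l) (S ! p l)" q "m - q"] q by (simp add: \<rho>_def)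
    have len: "length (u @ take q ?S) = k" "length (drop q ?S @ v) = k" using S u v q by simp_all
    show ?thesis
      unfolding minor_expand len sum_product
      by (intro sum.cong refl) (simp only: 1 2 3 C_def mult_ac)
  qed
  have inner: "(\<Sum>p\<in>?P m. of_int (sign p) * (\<Prod>l<m. M (\<rho> \<alpha> \<beta> l) (S ! p l))) = 0"
    if ab: "\<alpha> \<in> ?P k" "\<beta> \<in> ?P k" for \<alpha> \<beta>
  proof -
    have "\<rho> \<alpha> \<beta> ` {..<m} \<subseteq> {..<k}"
    proof
      fix y assume "y \<in> \<rho> \<alpha> \<beta> ` {..<m}"
      then obtain l where "l < m" "y = \<rho> \<alpha> \<beta> l" by auto
      then show "y \<in> {..<k}"
        using permutes_in_image[of \<alpha> "{..<k}" "length u + l"] permutes_in_image[of \<beta> "{..<k}" "l - q"] ab u v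
        by (auto simp: \<rho>_def)
    qed
    then have "card (\<rho> \<alpha> \<beta> ` {..<m}) \<le> k"
      using card_mono[of "{..<k}" "\<rho> \<alpha> \<beta> ` {..<m}"] by simp
    then have "\<not> inj_on (\<rho> \<alpha> \<beta>) {..<m}"
      using card_image[of "\<rho> \<alpha> \<beta>" "{..<m}"] S(2) by auto
    then obtain l l' where "l < m" "l' < m" "l \<noteq> l'" "\<rho> \<alpha> \<beta> l = \<rho> \<alpha> \<beta> l'"
      by (auto simp: inj_on_def)
    then show ?thesis
      by (intro sum_permutations_eq_0[of l _ l' "\<lambda>l j. M (\<rho> \<alpha> \<beta> l) (S ! j)"]) auto
  qed
  have "(\<Sum>p\<in>?P m. of_int (sign p) *
      (minor M (u @ take q (permute_list p S)) * minor M (drop q (permute_list p S) @ v)))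
    = (\<Sum>p\<in>?P m. \<Sum>\<alpha>\<in>?P k. \<Sum>\<beta>\<in>?P k.
        C \<alpha> \<beta> * (of_int (sign p) * (\<Prod>l<m. M (\<rho> \<alpha> \<beta> l) (S ! p l))))"
    by (intro sum.cong refl) (simp only: expand sum_distrib_left mult.left_commute)
  also have "\<dots> = (\<Sum>\<alpha>\<in>?P k. \<Sum>p\<in>?P m. \<Sum>\<beta>\<in>?P k.
        C \<alpha> \<beta> * (of_int (sign p) * (\<Prod>l<m. M (\<rho> \<alpha> \<beta> l) (S ! p l))))"
    by (rule sum.swap)
  also have "\<dots> = (\<Sum>\<alpha>\<in>?P k. \<Sum>\<beta>\<in>?P k. \<Sum>p\<in>?P m.
        C \<alpha> \<beta> * (of_int (sign p) * (\<Prod>l<m. M (\<rho> \<alpha> \<beta> l) (S ! p l))))"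
    by (intro sum.cong refl sum.swap)
  also have "\<dots> = 0"
    by (rule sum.neutral, rule ballI, rule sum.neutral, rule ballI) (simp only: sum_distrib_left[symmetric] inner mult_zero_right)
  finally show ?thesis .
qed

lemma sum_lists_prod:
  fixes N :: "nat \<Rightarrow> nat \<Rightarrow> 'a::comm_ring_1"
  shows "(\<Sum>ys | set ys \<subseteq> X \<and> length ys = s. \<Prod>l<s. N l (ys ! l)) = (\<Prod>l<s. \<Sum>j\<in>X. N l j)"
proof (induction s arbitrary: N)
  case 0
  have "{ys. set ys \<subseteq> X \<and> length ys = 0} = {[]}" by auto
  then show ?case by simp
next
  case (Suc s)
  let ?L = "\<lambda>s. {ys. set ys \<subseteq> X \<and> length ys = s}"
  have eq: "?L (Suc s) = (\<lambda>(y, ys). y # ys) ` (X \<times> ?L s)"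
    by (auto simp: length_Suc_conv image_iff)
  have inj: "inj_on (\<lambda>(y, ys). y # ys) (X \<times> ?L s)" by (auto simp: inj_on_def)
  have "(\<Sum>ys\<in>?L (Suc s). \<Prod>l<Suc s. N l (ys ! l)) = (\<Sum>y\<in>X. \<Sum>ys\<in>?L s. N 0 y * (\<Prod>l<s. N (Suc l) (ys ! l)))"
    unfolding eq
    by (subst sum.reindex[OF inj], subst sum.cartesian_product)
      (auto simp: prod.lessThan_Suc_shift intro!: sum.cong simp del: prod.lessThan_Suc)
  also have "\<dots> = (\<Sum>y\<in>X. N 0 y) * (\<Sum>ys\<in>?L s. \<Prod>l<s. N (Suc l) (ys ! l))"
    by (simp add: sum_product)
  also have "\<dots> = (\<Prod>l<Suc s. \<Sum>j\<in>X. N l j)"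
    by (simp only: Suc.IH[of "\<lambda>l. N (Suc l)"] prod.lessThan_Suc_shift)
  finally show ?case .
qed

text \<open>Summing over sequences instead of sets only multiplies by \<open>s!\<close>. The expanded sum over
  sequences is a product of \<open>s > r\<close> row products, and at most \<open>r\<close> of the rows involved lie outside
  the first \<open>k - r\<close>.\<close>

lemma contraction_vanishes:
  fixes A B :: "nat \<Rightarrow> nat \<Rightarrow> complex"
  assumes orth: "\<And>i t. i < k - r \<Longrightarrow> t < k \<Longrightarrow> (\<Sum>j<n. A i j * B t j) = 0"
    and len: "length us + s = k" "length vs + s = k" and rs: "r < s"
  shows "(\<Sum>Y\<in>subsets n s. minor A (us @ sorted_list_of_set Y) * minor B (vs @ sorted_list_of_set Y)) = 0"
proof -
  let ?P = "{p. p permutes {..<k}}" and ?L = "{ys. set ys \<subseteq> {..<n} \<and> length ys = s}"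
  define f where "f = (\<lambda>ys. minor A (us @ ys) * minor B (vs @ ys))"
  define C where "C = (\<lambda>\<alpha> \<beta>. of_int (sign \<alpha>) * of_int (sign \<beta>) *
    ((\<Prod>j<length us. A (\<alpha> j) (us ! j)) * (\<Prod>j<length vs. B (\<beta> j) (vs ! j))))"
  define N where "N = (\<lambda>\<alpha> \<beta> l j. A (\<alpha> (length us + l)) j * B (\<beta> (length vs + l)) j)"
  have finL: "finite ?L" using finite_lists_length_eq[of "{..<n}" s] by simp
  have expand: "f ys = (\<Sum>\<alpha>\<in>?P. \<Sum>\<beta>\<in>?P. C \<alpha> \<beta> * (\<Prod>l<s. N \<alpha> \<beta> l (ys ! l)))" if ys: "ys \<in> ?L" for ys
  proof -
    have 1: "(\<Prod>j<k. M (\<alpha> j) ((ws @ ys) ! j))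
        = (\<Prod>j<length ws. M (\<alpha> j) (ws ! j)) * (\<Prod>l<s. M (\<alpha> (length ws + l)) (ys ! l))"
      if "length ws + s = k" for M :: "nat \<Rightarrow> nat \<Rightarrow> complex" and \<alpha> ws
      using prod_lessThan_add[of "\<lambda>j. M (\<alpha> j) ((ws @ ys) ! j)" "length ws" s] that ys
      by (simp add: nth_append)
    have l: "length (us @ ys) = k" "length (vs @ ys) = k" using ys len by simp_all
    show ?thesis
      unfolding f_def minor_expand l sum_product
      by (intro sum.cong refl) (simp only: 1[OF len(1)] 1[OF len(2)] C_def N_def prod.distrib mult_ac)
  qed
  have zero: "(\<Sum>ys\<in>?L. \<Prod>l<s. N \<alpha> \<beta> l (ys ! l)) = 0" if ab: "\<alpha> \<in> ?P" "\<beta> \<in> ?P" for \<alpha> \<beta>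
  proof -
    \<comment> \<open>the \<open>s > r\<close> rows \<open>\<alpha> (length us + l)\<close> do not fit into the last \<open>r\<close> rows\<close>
    have "\<exists>l<s. \<alpha> (length us + l) < k - r"
    proof (rule ccontr)
      assume neg: "\<not> ?thesis"
      have "(\<lambda>l. \<alpha> (length us + l)) ` {..<s} \<subseteq> {k - r..<k}"
      proof
        fix y assume "y \<in> (\<lambda>l. \<alpha> (length us + l)) ` {..<s}"
        then obtain l where "l < s" "y = \<alpha> (length us + l)" by auto
        then show "y \<in> {k - r..<k}"
          using neg permutes_in_image[of \<alpha> "{..<k}" "length us + l"] ab len by auto
      qed
      then have "card ((\<lambda>l. \<alpha> (length us + l)) ` {..<s}) \<le> card {k - r..<k}"
        by (intro card_mono) auto
      moreover have "inj_on (\<lambda>l. \<alpha> (length us + l)) {..<s}"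
        
        using injD[OF permutes_inj[of \<alpha> "{..<k}"]] ab(1) by (intro inj_onI) fastforce
      ultimately show False using rs by (simp add: card_image)
    qed
    then obtain l where l: "l < s" "\<alpha> (length us + l) < k - r" by blast
    have "\<beta> (length vs + l) < k"
      using permutes_in_image[of \<beta> "{..<k}" "length vs + l"] ab l len by auto
    then have "(\<Sum>j<n. N \<alpha> \<beta> l j) = 0" unfolding N_def using l by (intro orth)
    then have "(\<Prod>l<s. \<Sum>j<n. N \<alpha> \<beta> l j) = 0" using l by (intro prod_zero) auto
    then show ?thesis by (simp only: sum_lists_prod)
  qed
  have "(\<Sum>ys\<in>?L. f ys) = (\<Sum>ys\<in>?L. \<Sum>\<alpha>\<in>?P. \<Sum>\<beta>\<in>?P. C \<alpha> \<beta> * (\<Prod>l<s. N \<alpha> \<beta> l (ys ! l)))"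
    by (rule sum.cong) (simp_all only: expand)
  also have "\<dots> = (\<Sum>\<alpha>\<in>?P. \<Sum>ys\<in>?L. \<Sum>\<beta>\<in>?P. C \<alpha> \<beta> * (\<Prod>l<s. N \<alpha> \<beta> l (ys ! l)))"
    by (rule sum.swap)
  also have "\<dots> = (\<Sum>\<alpha>\<in>?P. \<Sum>\<beta>\<in>?P. \<Sum>ys\<in>?L. C \<alpha> \<beta> * (\<Prod>l<s. N \<alpha> \<beta> l (ys ! l)))"
    by (intro sum.cong refl sum.swap)
  also have "\<dots> = 0"
    by (rule sum.neutral, rule ballI, rule sum.neutral, rule ballI) (simp only: sum_distrib_left[symmetric] zero mult_zero_right)
  finally have "(\<Sum>ys\<in>?L. f ys) = 0" .
  moreover have "(\<Sum>ys\<in>?L. f ys) = (\<Sum>ys | ys \<in> ?L \<and> distinct ys. f ys)"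
    using finL by (intro sum.mono_neutral_right) (auto simp: f_def minor_not_distinct)
  moreover have "(\<Sum>ys | ys \<in> ?L \<and> distinct ys. f ys)
      = (\<Sum>Y\<in>subsets n s. \<Sum>ys | ys \<in> ?L \<and> distinct ys \<and> set ys = Y. f ys)"
  proof (subst sum.group[symmetric, of _ "subsets n s" set])
    show "finite {ys. ys \<in> ?L \<and> distinct ys}" by (rule finite_subset[OF _ finL]) auto
    show "finite (subsets n s)" by (simp add: subsets_def)
    show "set ` {ys. ys \<in> ?L \<and> distinct ys} \<subseteq> subsets n s" by (auto simp: subsets_def distinct_card)
  qed (auto intro!: sum.cong)
  moreover have "(\<Sum>ys | ys \<in> ?L \<and> distinct ys \<and> set ys = Y. f ys) = fact s * f (sorted_list_of_set Y)"
    if Y: "Y \<in> subsets n s" for Y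
  proof -
    have fin: "finite Y" and c: "card Y = s" and sub: "Y \<subseteq> {..<n}"
      using Y by (auto simp: subsets_def intro: finite_subset)
    have const: "f ys = f (sorted_list_of_set Y)" if "ys \<in> ?L \<and> distinct ys \<and> set ys = Y" for ys
    proof -
      have "mset ys = mset (sorted_list_of_set Y)"
        using that by (metis sorted_list_of_set_sort_remdups distinct_remdups_id mset_sort)
      then show ?thesis
        unfolding f_def by (intro alternating_mult_reorder minor_permute)
    qed
    have eq: "{ys. ys \<in> ?L \<and> distinct ys \<and> set ys = Y} = {ys. set ys = Y \<and> distinct ys}"
      using c sub by (auto dest: distinct_card)
    have "(\<Sum>ys | ys \<in> ?L \<and> distinct ys \<and> set ys = Y. f ys)
        = (\<Sum>ys | ys \<in> ?L \<and> distinct ys \<and> set ys = Y. f (sorted_list_of_set Y))"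
      by (rule sum.cong[OF refl]) (rule const, erule CollectD)
    also have "\<dots> = (\<Sum>ys | set ys = Y \<and> distinct ys. f (sorted_list_of_set Y))"
      by (simp only: eq)
    finally have "(\<Sum>ys | ys \<in> ?L \<and> distinct ys \<and> set ys = Y. f ys)
        = (\<Sum>ys | set ys = Y \<and> distinct ys. f (sorted_list_of_set Y))" .
    then show ?thesis
      using card_permutations_of_set[OF fin] c by (simp add: permutations_of_set_def)
  qed
  ultimately have "fact s * (\<Sum>Y\<in>subsets n s. f (sorted_list_of_set Y)) = 0"
    by (simp add: sum_distrib_left)
  then show ?thesis by (simp add: f_def)
qed

section \<open>Monomials and their weights\<close>

definition weight :: "('v \<Rightarrow> nat) \<Rightarrow> ('v \<Rightarrow>\<^sub>0 nat) \<Rightarrow> nat" where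
  "weight w m = (\<Sum>v\<in>keys m. lookup m v * w v)"

lemma weight_superset:
  assumes "finite S" "keys m \<subseteq> S"
  shows "weight w m = (\<Sum>v\<in>S. lookup m v * w v)"
  unfolding weight_def
  by (rule sum.mono_neutral_left) (use assms in \<open>auto simp: in_keys_iff\<close>)

lemma weight_add: "weight w (m + m') = weight w m + weight w m'"
proof -
  let ?S = "keys m \<union> keys m'"
  have "weight w (m + m') = (\<Sum>v\<in>?S. lookup (m + m') v * w v)"
    by (rule weight_superset) (simp_all add: keys_add)
  then show ?thesis
    using weight_superset[of ?S m w] weight_superset[of ?S m' w]
    by (simp add: lookup_add distrib_right sum.distrib)
qed

lemma weight_single [simp]: "weight w (single v e) = e * w v"
  by (cases "e = 0") (simp_all add: weight_def)

definition monomials_in :: "('v \<Rightarrow>\<^sub>0 nat) set \<Rightarrow> 'v cpoly set" where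
  "monomials_in S = {f. keys f \<subseteq> S}"

lemma monomials_in_add: "f \<in> monomials_in S \<Longrightarrow> g \<in> monomials_in S \<Longrightarrow> f + g \<in> monomials_in S"
  using keys_add[of f g] by (auto simp: monomials_in_def)

lemma monomials_in_zero [simp]: "0 \<in> monomials_in S"
  by (simp add: monomials_in_def)

lemma monomials_in_sum: "(\<And>i. i \<in> A \<Longrightarrow> F i \<in> monomials_in S) \<Longrightarrow> sum F A \<in> monomials_in S"
  by (induction A rule: infinite_finite_induct) (auto intro: monomials_in_add)

lemma monomials_in_mult:
  assumes "f \<in> monomials_in S" "g \<in> monomials_in T" "\<And>m m'. m \<in> S \<Longrightarrow> m' \<in> T \<Longrightarrow> m + m' \<in> U"
  shows "f * g \<in> monomials_in U"
  using keys_mult[of f g] assms by (fastforce simp: monomials_in_def)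

lemma monomials_in_single: "m \<in> S \<Longrightarrow> single m c \<in> monomials_in S"
  by (simp add: monomials_in_def)

abbreviation const :: "complex \<Rightarrow> 'v cpoly" where
  "const c \<equiv> single 0 c"

lemma const_mult_single: "const c * single m d = single m (c * d)"
  by (simp add: mult_single)

lemma of_int_eq_const: "of_int c = (const (of_int c) :: 'v cpoly)"
  by simp

lemma monomials_in_const_mult: "f \<in> monomials_in S \<Longrightarrow> const c * f \<in> monomials_in S"
  by (rule monomials_in_mult[of _ "{0}"]) (auto simp: monomials_in_def)

lemma monomials_in_of_int_mult: "f \<in> monomials_in S \<Longrightarrow> of_int c * f \<in> monomials_in S"
  unfolding of_int_eq_const by (rule monomials_in_const_mult)

lemma sorting_sign_cases:
  assumes "distinct xs"
  shows "sorting_sign xs = 1 \<or> sorting_sign xs = - 1"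
proof -
  obtain p where "p permutes {..<length xs}" "permute_list p (sort xs) = xs"
    using mset_eq_permutation[of xs "sort xs"] by auto
  then show ?thesis using sorting_sign_eq[OF assms] by (auto simp: sign_def)
qed

lemma bracket_monomials:
  assumes "distinct xs \<Longrightarrow> single (b (set xs)) 1 \<in> S"
  shows "bracket b xs \<in> monomials_in S"
  using assms by (auto simp: bracket_def var_def intro!: monomials_in_of_int_mult monomials_in_single)

lemma bracket_mult_monomials:
  assumes "distinct xs \<Longrightarrow> distinct ys \<Longrightarrow>
    single (b (set xs)) 1 + single (b' (set ys)) 1 \<in> S"
  shows "bracket b xs * bracket b' ys \<in> monomials_in S"
proof (cases "distinct xs \<and> distinct ys")
  case True
  then show ?thesis
    using assms
    by (intro monomials_in_mult[OF bracket_monomials[of _ _ "{single (b (set xs)) 1}"]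
          bracket_monomials[of _ _ "{single (b' (set ys)) 1}"]]) auto
qed (auto simp: bracket_def)

text \<open>The measure for termination of straightening. As squaring is convex and monotone, it grows in
  both kinds of steps: straightening a product of two brackets of the same kind
  spreads the two
  index sums apart, and straightening a mixed product increases both.\<close>

fun index_weight :: "bracket_var \<Rightarrow> nat" where
  "index_weight (Angle I) = (\<Sum>I)\<^sup>2"
| "index_weight (Square I) = (\<Sum>I)\<^sup>2"

definition bracket_vars :: "nat \<Rightarrow> nat \<Rightarrow> bracket_var set" where
  "bracket_vars k n = Angle ` subsets n k \<union> Square ` subsets n k"

text \<open>The monomials allowed in the remainder when a product of two brackets of total weight \<open>t\<close> is
  straightened.\<close>

definition heavier :: "nat \<Rightarrow> nat \<Rightarrow> nat \<Rightarrow> (bracket_var \<Rightarrow>\<^sub>0 nat) set" where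
  "heavier k n t = {m. keys m \<subseteq> bracket_vars k n \<and> weight (\<lambda>_. 1) m = 2 \<and>
     t < weight index_weight m}"

lemma pair_heavier:
  assumes "v \<in> bracket_vars k n" "w \<in> bracket_vars k n" "t < index_weight v + index_weight w"
  shows "single v 1 + single w 1 \<in> heavier k n t"
  using assms keys_add[of "single v 1" "single w (1::nat)"]
  by (auto simp: heavier_def weight_add)

lemma sum_less_of_exchange:
  fixes A B :: "nat set"
  assumes fin: "finite A" "finite B" and card: "card A = card B" and ne: "A \<noteq> B"
    and A: "\<And>a. a \<in> A - B \<Longrightarrow> x \<le> a" and B: "\<And>b. b \<in> B - A \<Longrightarrow> b < x"
  shows "\<Sum>B < \<Sum>A"
proof -
  have c: "card (A - B) = card (B - A)"
    using card_Diff_subset_Int[of A B] card_Diff_subset_Int[of B A] fin card by (simp add: Int_commute)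
  have "B - A \<noteq> {}"
  proof
    assume "B - A = {}"
    then have "card (A - B) = 0" using c by (simp only: card.empty)
    then have "A - B = {}" using fin by simp
    then show False using ne \<open>B - A = {}\<close> by auto
  qed
  then have "\<Sum>(B - A) < (\<Sum>i\<in>B - A. x)"
    using fin B by (intro sum_strict_mono) auto
  also have "\<dots> = (\<Sum>i\<in>A - B. x)" using c by simp
  also have "\<dots> \<le> \<Sum>(A - B)" using A by (intro sum_mono) auto
  finally have "\<Sum>(B - A) < \<Sum>(A - B)" .
  moreover have "\<Sum>B = \<Sum>(B - A) + \<Sum>(A \<inter> B)" "\<Sum>A = \<Sum>(A - B) + \<Sum>(A \<inter> B)"
    using sum.Int_Diff[of B "\<lambda>i. i" A] sum.Int_Diff[of A "\<lambda>i. i" B] fin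
    by (simp_all add: Int_commute add.commute)
  ultimately show ?thesis by simp
qed

section \<open>Ideals containing the bracket relations\<close>

text \<open>What straightening needs from an ideal; the right-hand side of the theorem is the smallest
  instance.\<close>

locale relation_ideal =
  fixes k n r :: nat and H :: "bracket_var cpoly set"
  assumes ideal: "ideal H (SH_ring k n)"
    and pluecker: "\<And>b. b \<in> {Angle, Square} \<Longrightarrow> pluecker_ideal b k n \<subseteq> H"
    and pqt: "PQT_entries k n r \<subseteq> H"
begin

lemma ring_simps: "mult (SH_ring k n) = (*)" "zero (SH_ring k n) = 0" "add (SH_ring k n) = (+)"
  "f \<in> carrier (SH_ring k n) \<longleftrightarrow> (\<forall>m\<in>keys f. keys m \<subseteq> bracket_vars k n)"
  by (simp_all add: SH_ring_def cpoly_ring_def bracket_vars_def)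

lemma H_zero: "0 \<in> H"
  using additive_subgroup.zero_closed[OF ideal.axioms(1)[OF ideal]] by (simp add: ring_simps)

lemma H_add: "f \<in> H \<Longrightarrow> g \<in> H \<Longrightarrow> f + g \<in> H"
  using additive_subgroup.a_closed[OF ideal.axioms(1)[OF ideal], of f g] by (simp add: ring_simps)

lemma H_mult: "f \<in> H \<Longrightarrow> c \<in> carrier (SH_ring k n) \<Longrightarrow> c * f \<in> H"
  using ideal.I_l_closed[OF ideal, of f c] by (simp add: ring_simps(1))

lemma H_const_mult: "f \<in> H \<Longrightarrow> const c * f \<in> H"
  by (rule H_mult) (auto simp: ring_simps)

lemma H_of_int_mult: "f \<in> H \<Longrightarrow> of_int c * f \<in> H"
  unfolding of_int_eq_const by (rule H_const_mult)

lemma H_diff: "f \<in> H \<Longrightarrow> g \<in> H \<Longrightarrow> f - g \<in> H"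
  using H_add[of f "of_int (- 1) * g"] H_of_int_mult[of g "- 1"] by simp

lemma H_sum: "(\<And>i. i \<in> A \<Longrightarrow> F i \<in> H) \<Longrightarrow> sum F A \<in> H"
  by (induction A rule: infinite_finite_induct) (auto intro: H_zero H_add)

text \<open>The contractions and exchange relations obtained below come with integer multiples; this is where
  characteristic zero enters.\<close>

lemma H_cancel_of_nat:
  assumes "of_nat N * f \<in> H" "N \<noteq> 0"
  shows "f \<in> H"
proof -
  have "const (1 / of_nat N) * (of_nat N * f) = f"
    using assms(2) by (simp add: mult.assoc[symmetric] single_of_nat[symmetric] mult_single del: single_of_nat)
  then show ?thesis using H_const_mult[OF assms(1), of "1 / of_nat N"] by simp
qed

text \<open>\<open>contraction us vs E s\<close> is a polarization of an entry of \<open>P Q\<^sup>T\<close>: the set \<open>Y\<close> of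
  contracted indices has arbitrary size \<open>s\<close> and is confined to \<open>E\<close>.\<close>

definition contraction_term :: "nat list \<Rightarrow> nat list \<Rightarrow> nat set \<Rightarrow> bracket_var cpoly" where
  "contraction_term us vs Y =
     bracket Angle (us @ sorted_list_of_set Y) * bracket Square (vs @ sorted_list_of_set Y)"

definition contraction :: "nat list \<Rightarrow> nat list \<Rightarrow> nat set \<Rightarrow> nat \<Rightarrow> bracket_var cpoly" where
  "contraction us vs E s = (\<Sum>Y | Y \<subseteq> E \<and> card Y = s. contraction_term us vs Y)"

lemma contraction_term_reorder:
  assumes "finite Y" "mset ys = mset (sorted_list_of_set Y)"
  shows "bracket Angle (us @ ys) * bracket Square (vs @ ys) = contraction_term us vs Y"
  unfolding contraction_term_def
  by (rule alternating_mult_reorder[OF bracket_permute bracket_permute assms(2)])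

lemma contraction_term_insert:
  assumes "finite Y" "z \<notin> Y"
  shows "contraction_term (us @ [z]) (vs @ [z]) Y = contraction_term us vs (insert z Y)"
proof -
  have "mset (z # sorted_list_of_set Y) = mset (sorted_list_of_set (insert z Y))"
    using assms by simp
  from contraction_term_reorder[OF _ this] assms show ?thesis
    by (simp add: contraction_term_def)
qed

lemma contraction_term_0:
  assumes "finite Y" "set us \<inter> Y \<noteq> {} \<or> set vs \<inter> Y \<noteq> {} \<or> \<not> distinct us \<or> \<not> distinct vs"
  shows "contraction_term us vs Y = 0"
  using assms by (auto simp: contraction_term_def bracket_def)

text \<open>For \<open>s = r + 1\<close> this is zero or an entry of \<open>P Q\<^sup>T\<close> up to sign. Contracting one index \<open>z\<close> explicitly
  and \<open>s\<close> further ones counts every set of size \<open>s + 1\<close> once for each of its elements, so the case of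
  \<open>s + 1\<close> contractions follows from that of \<open>s\<close>.\<close>

lemma full_contraction_in_H:
  assumes "length us + s = k" "length vs + s = k" "set us \<subseteq> {..<n}" "set vs \<subseteq> {..<n}" "r < s"
  shows "contraction us vs {..<n} s \<in> H"
proof -
  have "\<forall>us vs. length us + (Suc r + d) = k \<longrightarrow> length vs + (Suc r + d) = k \<longrightarrow>
      set us \<subseteq> {..<n} \<longrightarrow> set vs \<subseteq> {..<n} \<longrightarrow> contraction us vs {..<n} (Suc r + d) \<in> H" for d
  proof (induction d)
    case 0
    show ?case
    proof (intro allI impI)
      fix us vs assume us: "length us + (Suc r + 0) = k" "set us \<subseteq> {..<n}"
        and vs: "length vs + (Suc r + 0) = k" "set vs \<subseteq> {..<n}"
      show "contraction us vs {..<n} (Suc r + 0) \<in> H"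
      proof (cases "distinct us \<and> distinct vs")
        case False
        then show ?thesis
          by (auto simp: contraction_def contraction_term_def bracket_def intro: H_zero)
      next
        case True
        obtain p where p: "p permutes {..<length us}" "permute_list p (sorted_list_of_set (set us)) = us"
          "length (sorted_list_of_set (set us)) = length us"
          using distinct_obtain_permutation[of us "set us"] True by auto
        obtain q where q: "q permutes {..<length vs}" "permute_list q (sorted_list_of_set (set vs)) = vs"
          "length (sorted_list_of_set (set vs)) = length vs"
          using distinct_obtain_permutation[of vs "set vs"] True by auto
        have rows: "set us \<in> row_indices k n r" "set vs \<in> row_indices k n r"
          using True us vs by (auto simp: row_indices_def distinct_card)
        have t: "contraction_term us vs Y = of_int (sign p * sign q) *
            (bracket_matrix Angle (set us) Y * bracket_matrix Square (set vs) Y)" for Y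
          using bracket_permute_block[of p "sorted_list_of_set (set us)" Angle "[]" "sorted_list_of_set Y"]
            bracket_permute_block[of q "sorted_list_of_set (set vs)" Square "[]" "sorted_list_of_set Y"] p q
          by (simp add: contraction_term_def bracket_matrix_def mult_ac)
        have eq: "contraction us vs {..<n} (Suc r + 0) = of_int (sign p * sign q) * PQT n r (set us) (set vs)"
          unfolding contraction_def t PQT_def sum_distrib_left by (simp add: subsets_def)
        have "PQT n r (set us) (set vs) \<in> H"
          using pqt rows by (auto simp: PQT_entries_def)
        then show ?thesis unfolding eq by (rule H_of_int_mult)
      qed
    qed
  next
    case (Suc d)
    show ?case
    proof (intro allI impI)
      fix us vs assume us: "length us + (Suc r + Suc d) = k" "set us \<subseteq> {..<n}"
        and vs: "length vs + (Suc r + Suc d) = k" "set vs \<subseteq> {..<n}"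
      let ?s = "Suc r + d" and ?g = "contraction_term us vs"
      let ?A = "SIGMA z:{..<n}. {Y. Y \<subseteq> {..<n} \<and> card Y = ?s \<and> z \<notin> Y}"
      let ?B = "SIGMA Y:{Y. Y \<subseteq> {..<n} \<and> card Y = Suc ?s}. Y"
      have fin: "finite Y" if "Y \<subseteq> {..<n}" for Y using that finite_subset by blast
      have "contraction (us @ [z]) (vs @ [z]) {..<n} ?s
          = (\<Sum>Y | Y \<subseteq> {..<n} \<and> card Y = ?s \<and> z \<notin> Y. ?g (insert z Y))" for z
      proof -
        have "contraction (us @ [z]) (vs @ [z]) {..<n} ?s
          = (\<Sum>Y | Y \<subseteq> {..<n} \<and> card Y = ?s \<and> z \<notin> Y. contraction_term (us @ [z]) (vs @ [z]) Y)"
          unfolding contraction_def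
          by (rule sum.mono_neutral_right) (auto intro!: contraction_term_0 fin)
        also have "\<dots> = (\<Sum>Y | Y \<subseteq> {..<n} \<and> card Y = ?s \<and> z \<notin> Y. ?g (insert z Y))"
          by (rule sum.cong) (auto intro!: contraction_term_insert fin)
        finally show ?thesis .
      qed
      then have "(\<Sum>z<n. contraction (us @ [z]) (vs @ [z]) {..<n} ?s) = (\<Sum>(z, Y)\<in>?A. ?g (insert z Y))"
        by (simp add: sum.Sigma)
      also have "\<dots> = (\<Sum>(Y, z)\<in>?B. ?g Y)"
        by (rule sum.reindex_bij_witness[of _ "\<lambda>(Y, z). (z, Y - {z})" "\<lambda>(z, Y). (insert z Y, z)"])
          (auto simp: insert_absorb card_insert_disjoint fin)
      also have "\<dots> = (\<Sum>Y | Y \<subseteq> {..<n} \<and> card Y = Suc ?s. \<Sum>z\<in>Y. ?g Y)"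
        by (subst sum.Sigma) (auto intro: fin)
      also have "\<dots> = of_nat (Suc ?s) * contraction us vs {..<n} (Suc ?s)"
        unfolding contraction_def sum_distrib_left by (rule sum.cong) auto
      finally have "of_nat (Suc ?s) * contraction us vs {..<n} (Suc ?s)
          = (\<Sum>z<n. contraction (us @ [z]) (vs @ [z]) {..<n} ?s)" by simp
      also have "\<dots> \<in> H"
        using us vs Suc.IH by (intro H_sum) auto
      finally show "contraction us vs {..<n} (Suc r + Suc d) \<in> H"
        by (simp only: add_Suc_right H_cancel_of_nat[of "Suc ?s"] nat.distinct simp_thms)
    qed
  qed
  from this[of "s - Suc r"] assms show ?thesis by simp
qed

text \<open>Inclusion-exclusion over the excluded set \<open>F\<close>: each excluded index that does get contracted
  costs one of the remaining \<open>s\<close> contractions, and more than \<open>r\<close> of them are left at the end.\<close>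

lemma partial_contraction_in_H:
  assumes "finite F" "F \<subseteq> {..<n}" "card F + r < s"
    "length us + s = k" "length vs + s = k" "set us \<subseteq> {..<n}" "set vs \<subseteq> {..<n}"
  shows "contraction us vs ({..<n} - F) s \<in> H"
  using assms
proof (induction F arbitrary: us vs s rule: finite_induct)
  case empty
  then show ?case by (auto intro: full_contraction_in_H)
next
  case (insert f F)
  let ?E = "{..<n} - insert f F"
  obtain t where s: "s = Suc t" using insert.prems by (cases s) auto
  have E: "{..<n} - F = insert f ?E" using insert by auto
  have fin: "finite Y" if "Y \<subseteq> {..<n} - F" for Y using that finite_subset by blast
  have split: "{Y. Y \<subseteq> insert f ?E \<and> card Y = Suc t}
      = {Y. Y \<subseteq> ?E \<and> card Y = Suc t} \<union> insert f ` {Y. Y \<subseteq> ?E \<and> card Y = t}" (is "?L = ?R")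
  proof (intro equalityI subsetI)
    fix Y assume Y: "Y \<in> ?L"
    show "Y \<in> ?R"
    proof (cases "f \<in> Y")
      case True
      then have "Y = insert f (Y - {f})" by blast
      moreover have "Y - {f} \<in> {Y. Y \<subseteq> ?E \<and> card Y = t}"
        using Y True by (auto simp: card_Diff_singleton)
      ultimately show ?thesis by blast
    qed (use Y in auto)
  next
    fix Y assume "Y \<in> ?R"
    then consider "Y \<subseteq> ?E" "card Y = Suc t"
      | Z where "Y = insert f Z" "Z \<subseteq> ?E" "card Z = t" by auto
    then show "Y \<in> ?L"
    proof cases
      case 2
      then have "finite Z" "f \<notin> Z" using finite_subset[of Z ?E] by auto
      then show ?thesis using 2 by auto
    qed auto
  qed
  have "contraction us vs ({..<n} - F) s = contraction us vs ?E s +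
      (\<Sum>Y\<in>insert f ` {Y. Y \<subseteq> ?E \<and> card Y = t}. contraction_term us vs Y)"
    unfolding contraction_def E s split
    by (rule sum.union_disjoint) auto
  also have "(\<Sum>Y\<in>insert f ` {Y. Y \<subseteq> ?E \<and> card Y = t}. contraction_term us vs Y)
      = (\<Sum>Y | Y \<subseteq> ?E \<and> card Y = t. contraction_term us vs (insert f Y))"
  proof (rule sum.reindex_cong)
    show "inj_on (insert f) {Y. Y \<subseteq> ?E \<and> card Y = t}"
    proof (rule inj_onI)
      fix Y Z assume "Y \<in> {Y. Y \<subseteq> ?E \<and> card Y = t}" "Z \<in> {Y. Y \<subseteq> ?E \<and> card Y = t}"
        and eq: "insert f Y = insert f Z"
      then have "f \<notin> Y" "f \<notin> Z" by auto
      then show "Y = Z" using eq by (simp add: insert_ident)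
    qed
  qed auto
  also have "\<dots> = (\<Sum>Y | Y \<subseteq> ?E \<and> card Y = t. contraction_term (us @ [f]) (vs @ [f]) Y)"
  proof (rule sum.cong[OF refl])
    fix Y assume "Y \<in> {Y. Y \<subseteq> ?E \<and> card Y = t}"
    then have "finite Y" "f \<notin> Y" using finite_subset[of Y ?E] by auto
    then show "contraction_term us vs (insert f Y) = contraction_term (us @ [f]) (vs @ [f]) Y"
      by (simp add: contraction_term_insert)
  qed
  also have "\<dots> = contraction (us @ [f]) (vs @ [f]) ({..<n} - F) t"
    unfolding contraction_def
    by (rule sum.mono_neutral_left) (auto intro!: contraction_term_0 fin)
  finally have "contraction us vs ?E s
      = contraction us vs ({..<n} - F) s - contraction (us @ [f]) (vs @ [f]) ({..<n} - F) t"
    by simp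
  moreover have "contraction us vs ({..<n} - F) s \<in> H"
    using insert by (intro insert.IH) auto
  moreover have "contraction (us @ [f]) (vs @ [f]) ({..<n} - F) t \<in> H"
    using insert s by (intro insert.IH) auto
  ultimately show ?case by (simp add: H_diff)
qed

end

section \<open>Straightening\<close>

definition count_below :: "nat set \<Rightarrow> nat \<Rightarrow> nat" where
  "count_below I x = card (I \<inter> {..<x})"

text \<open>The componentwise order on increasing sequences, expressed by counting.\<close>

definition seq_le :: "nat \<Rightarrow> nat set \<Rightarrow> nat set \<Rightarrow> bool" where
  "seq_le n I I' \<longleftrightarrow> (\<forall>x\<le>n. count_below I' x \<le> count_below I x)"

text \<open>Two brackets of the same kind are compatible if they form a chain in Young's lattice. The
  condition on mixed pairs says that the complement of \<open>K\<close> and the set \<open>I\<close> are the left and right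
  column of a semistandard skew tableau in which the right column starts \<open>r\<close> rows above the left
  one: the complement has \<open>x - count_below K x\<close> elements below \<open>x\<close>, and \<open>I\<close> may have at most \<open>r\<close>
  more.\<close>

fun compatible :: "nat \<Rightarrow> nat \<Rightarrow> bracket_var \<Rightarrow> bracket_var \<Rightarrow> bool" where
  "compatible n r (Angle I) (Angle I') \<longleftrightarrow> seq_le n I I' \<or> seq_le n I' I"
| "compatible n r (Square I) (Square I') \<longleftrightarrow> seq_le n I I' \<or> seq_le n I' I"
| "compatible n r (Angle I) (Square K) \<longleftrightarrow> (\<forall>x\<le>n. count_below I x + count_below K x \<le> x + r)"
| "compatible n r (Square K) (Angle I) \<longleftrightarrow> (\<forall>x\<le>n. count_below I x + count_below K x \<le> x + r)"

definition standard :: "nat \<Rightarrow> nat \<Rightarrow> nat \<Rightarrow> (bracket_var \<Rightarrow>\<^sub>0 nat) set" where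
  "standard k n r = {m. keys m \<subseteq> bracket_vars k n \<and>
     (\<forall>v\<in>keys m. \<forall>w\<in>keys m. compatible n r v w)}"

lemma keys_pair: "keys (single v 1 + single w (1::nat)) \<subseteq> {v, w}"
  using keys_add[of "single v (1::nat)" "single w 1"] by auto

lemma subsetsD:
  assumes "I \<in> subsets n k"
  shows "finite I" "card I = k" "I \<subseteq> {..<n}"
  using assms by (auto simp: subsets_def intro: finite_subset)

lemma bracket_distinct_sign:
  assumes "distinct xs"
  obtains e :: int where "e * e = 1" "bracket b xs = of_int e * var (b (set xs))"
  using sorting_sign_cases[OF assms] assms by (intro that[of "sorting_sign xs"]) (auto simp: bracket_def)

context relation_ideal
begin

definition straightens :: "bracket_var \<Rightarrow> bracket_var \<Rightarrow> bool" where
  "straightens v w \<longleftrightarrow>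
     (\<exists>q\<in>monomials_in (heavier k n (index_weight v + index_weight w)). var v * var w - q \<in> H)"

lemma straightens_sym: "straightens v w \<Longrightarrow> straightens w v"
  by (simp add: straightens_def mult.commute add.commute)

lemma straightensI:
  assumes "of_int e * (var v * var w) + q \<in> H" "e * e = 1"
    "q \<in> monomials_in (heavier k n (index_weight v + index_weight w))"
  shows "straightens v w"
proof -
  have ee: "of_int e * of_int e = (1 :: bracket_var cpoly)"
    using assms(2) by (metis of_int_1 of_int_mult)
  have "of_int e * (of_int e * (var v * var w) + q) = var v * var w - of_int (- e) * q"
    by (simp add: distrib_left mult.assoc[symmetric] ee)
  then have "var v * var w - of_int (- e) * q \<in> H"
    using H_of_int_mult[OF assms(1), of e] by (simp only:)
  then show ?thesis
    unfolding straightens_def using monomials_in_of_int_mult[OF assms(3)] by blast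
qed

text \<open>Contract the common indices \<open>Y0\<close> below \<open>x\<close>, excluding the indices below \<open>x\<close> that occur in neither
  bracket. A surviving \<open>Y\<close> cannot use the other indices below \<open>x\<close>, since they occur already in one of
  the brackets. Hence every term except the original one trades common indices below \<open>x\<close> for
  indices from \<open>x\<close> on, in both brackets.\<close>

lemma straightens_mixed:
  assumes I: "I \<in> subsets n k" and K: "K \<in> subsets n k" and x: "x \<le> n"
    and bad: "x + r < count_below I x + count_below K x"
  shows "straightens (Angle I) (Square K)"
proof -
  define Y0 where "Y0 = I \<inter> K \<inter> {..<x}"
  define s where "s = card Y0"
  define us where "us = sorted_list_of_set (I - Y0)"
  define vs where "vs = sorted_list_of_set (K - Y0)"
  define F where "F = {..<x} - (I \<union> K)"
  define \<Y> where "\<Y> = {Y. Y \<subseteq> {..<n} - F \<and> card Y = s}"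
  define t where "t = index_weight (Angle I) + index_weight (Square K)"
  note I' = subsetsD[OF I] and K' = subsetsD[OF K]
  have fin: "finite Y0" and sub: "Y0 \<subseteq> I" "Y0 \<subseteq> K" using I' by (auto simp: Y0_def)
  have "card (I \<inter> {..<x}) + card (K \<inter> {..<x})
      = card ((I \<inter> {..<x}) \<union> (K \<inter> {..<x})) + card ((I \<inter> {..<x}) \<inter> (K \<inter> {..<x}))"
    using I' K' by (intro card_Un_Int) auto
  also have "(I \<inter> {..<x}) \<inter> (K \<inter> {..<x}) = Y0" by (auto simp: Y0_def)
  also have "(I \<inter> {..<x}) \<union> (K \<inter> {..<x}) = {..<x} - F" by (auto simp: F_def)
  also have "card ({..<x} - F) = x - card F" by (subst card_Diff_subset) (auto simp: F_def)
  \<comment> \<open>incompatibility at \<open>x\<close> is the size condition of \<open>partial_contraction_in_H\<close>\<close>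
  finally have F: "card F + r < s"
    using bad card_mono[of "{..<x}" F] by (simp add: count_below_def s_def F_def)
  have lens: "length us + s = k" "length vs + s = k"
    using card_Diff_subset[OF fin sub(1)] card_Diff_subset[OF fin sub(2)] card_mono[OF I'(1) sub(1)]
      card_mono[OF K'(1) sub(2)] I' K' by (simp_all add: us_def vs_def s_def)
  have sets: "set us = I - Y0" "set vs = K - Y0" using I' K' by (simp_all add: us_def vs_def)
  have "contraction us vs ({..<n} - F) s \<in> H"
    using I' K' x F lens sets by (intro partial_contraction_in_H) (auto simp: F_def)
  also have "contraction us vs ({..<n} - F) s
      = contraction_term us vs Y0 + (\<Sum>Y\<in>\<Y> - {Y0}. contraction_term us vs Y)"
    unfolding contraction_def \<Y>_def[symmetric]
    by (rule sum.remove) (use I' in \<open>auto simp: \<Y>_def Y0_def F_def s_def\<close>)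
  finally have mem: "contraction_term us vs Y0 + (\<Sum>Y\<in>\<Y> - {Y0}. contraction_term us vs Y) \<in> H" .
  have d: "distinct (us @ sorted_list_of_set Y0)" "set (us @ sorted_list_of_set Y0) = I"
    "distinct (vs @ sorted_list_of_set Y0)" "set (vs @ sorted_list_of_set Y0) = K"
    using fin sub sets by (auto simp: us_def vs_def)
  obtain e1 :: int where e1: "e1 * e1 = 1" "bracket Angle (us @ sorted_list_of_set Y0) = of_int e1 * var (Angle I)"
    using bracket_distinct_sign[OF d(1)] d(2) by metis
  obtain e2 :: int where e2: "e2 * e2 = 1" "bracket Square (vs @ sorted_list_of_set Y0) = of_int e2 * var (Square K)"
    using bracket_distinct_sign[OF d(3)] d(4) by metis
  have lead: "contraction_term us vs Y0 = of_int (e1 * e2) * (var (Angle I) * var (Square K))"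
    by (simp add: contraction_term_def e1(2) e2(2) mult_ac)
  have "contraction_term us vs Y \<in> monomials_in (heavier k n t)" if Y: "Y \<in> \<Y> - {Y0}" for Y
    unfolding contraction_term_def
  proof (rule bracket_mult_monomials)
    assume dis: "distinct (us @ sorted_list_of_set Y)" "distinct (vs @ sorted_list_of_set Y)"
    have finY: "finite Y" and Yn: "Y \<subseteq> {..<n} - F" "card Y = s" "Y \<noteq> Y0"
      using Y by (auto simp: \<Y>_def intro: finite_subset)
    have disj: "(I - Y0) \<inter> Y = {}" "(K - Y0) \<inter> Y = {}" using dis sets finY by auto
    have less: "\<Sum>Y0 < \<Sum>Y"
    proof (rule sum_less_of_exchange)
      fix a assume "a \<in> Y - Y0"
      then show "x \<le> a" using disj Yn(1) by (auto simp: F_def Y0_def not_less[symmetric])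
    qed (use finY fin Yn in \<open>auto simp: s_def Y0_def\<close>)
    have "\<Sum>I = \<Sum>(I - Y0) + \<Sum>Y0" "\<Sum>K = \<Sum>(K - Y0) + \<Sum>Y0"
      using sum.subset_diff[OF sub(1) I'(1), of "\<lambda>i. i"] sum.subset_diff[OF sub(2) K'(1), of "\<lambda>i. i"]
      by simp_all
    moreover have "\<Sum>((I - Y0) \<union> Y) = \<Sum>(I - Y0) + \<Sum>Y" "\<Sum>((K - Y0) \<union> Y) = \<Sum>(K - Y0) + \<Sum>Y"
      using I' K' finY disj by (auto intro!: sum.union_disjoint)
    ultimately have "\<Sum>I < \<Sum>((I - Y0) \<union> Y)" "\<Sum>K < \<Sum>((K - Y0) \<union> Y)" using less by simp_all
    then have "t < index_weight (Angle ((I - Y0) \<union> Y)) + index_weight (Square ((K - Y0) \<union> Y))"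
      unfolding t_def by (auto intro!: add_strict_mono power_strict_mono)
    moreover have "(I - Y0) \<union> Y \<in> subsets n k" "(K - Y0) \<union> Y \<in> subsets n k"
      using I' K' Yn(1) lens sets dis Yn(2) finY distinct_card[OF dis(1)] distinct_card[OF dis(2)]
      by (auto simp: subsets_def)
    ultimately show "single (Angle (set (us @ sorted_list_of_set Y))) 1 +
        single (Square (set (vs @ sorted_list_of_set Y))) 1 \<in> heavier k n t"
      using sets finY by (intro pair_heavier) (simp_all add: bracket_vars_def)
  qed
  then have "(\<Sum>Y\<in>\<Y> - {Y0}. contraction_term us vs Y) \<in> monomials_in (heavier k n t)"
    by (rule monomials_in_sum)
  moreover have "(e1 * e2) * (e1 * e2) = 1" using e1(1) e2(1) by (metis mult.assoc mult.commute mult_1)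
  ultimately show ?thesis
    using mem unfolding lead t_def by (intro straightensI)
qed

lemma exchange_in_H:
  assumes b: "b \<in> {Angle, Square}" and S: "length S = m" "k < m"
    and u: "length u + q = k" and v: "length v + (m - q) = k"
    and sub: "set u \<subseteq> {..<n}" "set S \<subseteq> {..<n}" "set v \<subseteq> {..<n}"
  shows "(\<Sum>p | p permutes {..<m}. of_int (sign p) *
    (bracket b (u @ take q (permute_list p S)) * bracket b (drop q (permute_list p S) @ v))) \<in> H"
    (is "?E \<in> H")
proof -
  have lens: "length (u @ take q (permute_list p S)) = k" "length (drop q (permute_list p S) @ v) = k" for p
    using S u v by simp_all
  have sets: "set (u @ take q (permute_list p S)) \<subseteq> {..<n}" "set (drop q (permute_list p S) @ v) \<subseteq> {..<n}"
    if "p permutes {..<m}" for p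
    using that sub set_take_subset[of q "permute_list p S"] set_drop_subset[of q "permute_list p S"] S
    by auto
  have "?E \<in> carrier (cpoly_ring (b ` subsets n k))"
  proof -
    let ?M = "{m. keys m \<subseteq> b ` subsets n k}"
    have "?E \<in> monomials_in ?M"
    proof (intro monomials_in_sum monomials_in_of_int_mult bracket_mult_monomials)
      fix p assume p: "p \<in> {p. p permutes {..<m}}"
        and d: "distinct (u @ take q (permute_list p S))" "distinct (drop q (permute_list p S) @ v)"
      have "set (u @ take q (permute_list p S)) \<in> subsets n k" "set (drop q (permute_list p S) @ v) \<in> subsets n k"
        unfolding subsets_def mem_Collect_eq
        using p sets[of p] lens[of p] distinct_card[OF d(1)] distinct_card[OF d(2)] by (auto simp del: set_append)
      then have "{b (set (u @ take q (permute_list p S))), b (set (drop q (permute_list p S) @ v))}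
          \<subseteq> b ` subsets n k" by blast
      from order_trans[OF keys_pair this]
      show "single (b (set (u @ take q (permute_list p S)))) (1::nat) +
          single (b (set (drop q (permute_list p S) @ v))) 1 \<in> ?M"
        by (rule CollectI)
    qed
    then show ?thesis by (auto simp: monomials_in_def cpoly_ring_def)
  qed
  moreover have "eval_cpoly x ?E = 0" if x: "x \<circ> b \<in> pluecker_line k n V" for x V
  proof -
    obtain A c where A: "A \<in> carrier_mat k n" and xb: "\<And>I. I \<in> subsets n k \<Longrightarrow> x (b I) = c * det (submatrix A UNIV I)"
      using x by (auto simp: pluecker_line_def)
    define M where "M = (\<lambda>i j. A $$ (i, j))"
    have xM: "x (b I) = c * minor M (sorted_list_of_set I)" if "I \<in> subsets n k" for I
      using xb[OF that] det_submatrix_eq_minor[OF A that] by (simp add: M_def)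
    have ev: "eval_cpoly x (bracket b xs) = c * minor M xs" if "length xs = k" "set xs \<subseteq> {..<n}" for xs
      using xM that by (rule eval_bracket)
    have "eval_cpoly x ?E = (\<Sum>p | p permutes {..<m}. (c * c) * (of_int (sign p) *
        (minor M (u @ take q (permute_list p S)) * minor M (drop q (permute_list p S) @ v))))"
      unfolding eval_cpoly_sum
      by (rule sum.cong[OF refl])
        (simp only: mem_Collect_eq eval_cpoly_mult eval_cpoly_of_int ev[OF lens(1) sets(1)] ev[OF lens(2) sets(2)] mult_ac)
    also have "\<dots> = 0"
      by (simp only: sum_distrib_left[symmetric] exchange_sum_vanishes[OF S u v] mult_zero_right)
    finally show ?thesis .
  qed
  ultimately have "?E \<in> pluecker_ideal b k n" by (auto simp: pluecker_ideal_def)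
  then show ?thesis using pluecker[OF b] by blast
qed

text \<open>A permutation preserving the block \<open>X\<close> is a pair of permutations of \<open>X\<close> and \<open>Y\<close>. Their signs
  come out of the two brackets, and their product is the sign of \<open>p\<close>, so that all such permutations
  contribute the same term.\<close>

lemma exchange_term_block:
  assumes S: "S = X @ Y" and dis: "distinct S" and q: "q = length X"
    and p: "p permutes {..<length S}" and same: "set (take q (permute_list p S)) = set X"
  shows "of_int (sign p) * (bracket b (u @ take q (permute_list p S)) * bracket b (drop q (permute_list p S) @ v))
    = bracket b (u @ X) * bracket b (Y @ v)"
proof -
  let ?P = "permute_list p S"
  have msP: "mset ?P = mset S" using p by simp
  then have dP: "distinct ?P" using dis by (metis mset_eq_imp_distinct_iff)
  then have "distinct (take q ?P)" by simp
  then have ms1: "mset (take q ?P) = mset X"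
    using same dis S by (simp add: set_eq_iff_mset_eq_distinct)
  moreover have "mset (take q ?P) + mset (drop q ?P) = mset X + mset Y"
    using msP S by (metis append_take_drop_id mset_append)
  ultimately have ms2: "mset (drop q ?P) = mset Y" by simp
  obtain \<alpha> where \<alpha>: "\<alpha> permutes {..<length X}" "permute_list \<alpha> X = take q ?P"
    using mset_eq_permutation[OF ms1] by blast
  obtain \<beta> where \<beta>: "\<beta> permutes {..<length Y}" "permute_list \<beta> Y = drop q ?P"
    using mset_eq_permutation[OF ms2] by blast
  obtain e :: int where e: "e * e = 1" "bracket Angle S = of_int e * var (Angle (set S))"
    using bracket_distinct_sign[OF dis] .
  \<comment> \<open>\<open>sign p = sign \<alpha> * sign \<beta>\<close>, read off from a bracket that is not zero\<close>
  have "of_int (sign p) * bracket Angle S = bracket Angle ?P"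
    using bracket_permute[OF p, of Angle] by simp
  also have "\<dots> = bracket Angle (permute_list \<alpha> X @ permute_list \<beta> Y)"
    by (simp add: \<alpha> \<beta>)
  also have "\<dots> = of_int (sign \<alpha>) * (of_int (sign \<beta>) * bracket Angle S)"
    using bracket_permute_block[OF \<alpha>(1), of Angle "[]" "permute_list \<beta> Y"]
      bracket_permute_block[OF \<beta>(1), of Angle X "[]"] S by simp
  finally have "eval_cpoly (\<lambda>_. 1) (of_int (sign p) * bracket Angle S)
      = eval_cpoly (\<lambda>_. 1) (of_int (sign \<alpha>) * (of_int (sign \<beta>) * bracket Angle S))" by simp
  then have "(of_int (sign p * e) :: complex) = of_int (sign \<alpha> * sign \<beta> * e)"
    by (simp add: e(2) eval_cpoly_mult)
  then have "sign p * e = sign \<alpha> * sign \<beta> * e" by (simp only: of_int_eq_iff)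
  then have sgn: "sign p = sign \<alpha> * sign \<beta>" using e(1) by auto
  have "bracket b (u @ take q ?P) = of_int (sign \<alpha>) * bracket b (u @ X)"
    "bracket b (drop q ?P @ v) = of_int (sign \<beta>) * bracket b (Y @ v)"
    using bracket_permute_block[OF \<alpha>(1), of b u "[]"] bracket_permute_block[OF \<beta>(1), of b "[]" v]
    by (simp_all add: \<alpha> \<beta>)
  then have "of_int (sign p) * (bracket b (u @ take q ?P) * bracket b (drop q ?P @ v))
      = of_int (sign p * (sign \<alpha> * sign \<beta>)) * (bracket b (u @ X) * bracket b (Y @ v))"
    by (simp add: mult_ac)
  moreover have "sign p * (sign \<alpha> * sign \<beta>) = 1" using sgn by (simp add: sign_def)
  ultimately show ?thesis by simp
qed

text \<open>At a violation of the order, the upper part \<open>X\<close> of \<open>I\<close> and the lower part \<open>Y\<close> of \<open>J\<close> have more than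
  \<open>k\<close> elements together, so that an exchange relation applies. All elements of \<open>Y\<close> are smaller than
  those of \<open>X\<close>: every other term of the relation lowers the smaller index sum further and raises the
  larger one by the same amount.\<close>

lemma straightens_same_kind:
  assumes b: "b \<in> {Angle, Square}" and I: "I \<in> subsets n k" and J: "J \<in> subsets n k"
    and le: "\<Sum>I \<le> \<Sum>J" and bad: "count_below I x < count_below J x"
  shows "straightens (b I) (b J)"
proof -
  define u where "u = sorted_list_of_set (I \<inter> {..<x})"
  define X where "X = sorted_list_of_set (I - {..<x})"
  define Y where "Y = sorted_list_of_set (J \<inter> {..<x})"
  define v where "v = sorted_list_of_set (J - {..<x})"
  define S where "S = X @ Y"
  define m where "m = length S"
  define q where "q = length X"
  define t where "t = index_weight (b I) + index_weight (b J)"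
  define P where "P = {p. p permutes {..<m}}"
  define G where "G = {p \<in> P. set (take q (permute_list p S)) = set X}"
  define tm where "tm = (\<lambda>p. of_int (sign p) *
    (bracket b (u @ take q (permute_list p S)) * bracket b (drop q (permute_list p S) @ v)))"
  have iw: "index_weight (b I) = (\<Sum>I)\<^sup>2" for I using b by auto
  note I' = subsetsD[OF I] and J' = subsetsD[OF J]
  have sets: "set u = I \<inter> {..<x}" "set X = I - {..<x}" "set Y = J \<inter> {..<x}" "set v = J - {..<x}"
    using I' J' by (simp_all add: u_def X_def Y_def v_def)
  have dis: "distinct u" "distinct X" "distinct Y" "distinct v" "distinct S"
    using sets by (auto simp: u_def X_def Y_def v_def S_def)
  have cards: "length u + length X = k" "length Y + length v = k"
    using card_Int_Diff[of I "{..<x}"] card_Int_Diff[of J "{..<x}"] I' J'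
    by (simp_all add: u_def X_def Y_def v_def)
  have lens: "length u + q = k" "length v + (m - q) = k" "k < m"
    using cards bad by (simp_all add: q_def m_def S_def u_def Y_def count_below_def)
  have finP: "finite P" using finite_permutations[of "{..<m}"] by (simp add: P_def)
  have "(\<Sum>p\<in>P. tm p) \<in> H"
    unfolding P_def tm_def
    using b lens sets I' J' by (intro exchange_in_H) (auto simp: m_def S_def)
  moreover have "(\<Sum>p\<in>P. tm p) = (\<Sum>p\<in>P - G. tm p) + (\<Sum>p\<in>G. tm p)"
    using finP by (intro sum.subset_diff) (auto simp: G_def)
  moreover have "(\<Sum>p\<in>G. tm p) = (\<Sum>p\<in>G. bracket b (u @ X) * bracket b (Y @ v))"
    unfolding tm_def
    by (rule sum.cong[OF refl], rule exchange_term_block)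
      (use dis in \<open>auto simp: S_def q_def G_def P_def m_def\<close>)
  ultimately have mem: "of_nat (card G) * (bracket b (u @ X) * bracket b (Y @ v)) + (\<Sum>p\<in>P - G. tm p) \<in> H"
    by (simp add: add.commute)
  have "id \<in> G" by (simp add: G_def P_def permutes_id S_def q_def)
  then have G0: "card G \<noteq> 0" using finP by (auto simp: G_def)
  define c where "c = (const (1 / of_nat (card G)) :: bracket_var cpoly)"
  have Gc: "of_nat (card G) * (c * f) = f" for f
    using G0 by (simp add: c_def mult.assoc[symmetric] single_of_nat[symmetric] mult_single del: single_of_nat)
  have "of_nat (card G) * (bracket b (u @ X) * bracket b (Y @ v) + c * (\<Sum>p\<in>P - G. tm p)) \<in> H"
    using mem by (simp only: distrib_left Gc)
  then have mem': "bracket b (u @ X) * bracket b (Y @ v) + c * (\<Sum>p\<in>P - G. tm p) \<in> H"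
    using G0 by (rule H_cancel_of_nat)
  have d: "distinct (u @ X)" "set (u @ X) = I" "distinct (Y @ v)" "set (Y @ v) = J"
    using dis sets by auto
  obtain e1 :: int where e1: "e1 * e1 = 1" "bracket b (u @ X) = of_int e1 * var (b I)"
    using bracket_distinct_sign[OF d(1)] d(2) by metis
  obtain e2 :: int where e2: "e2 * e2 = 1" "bracket b (Y @ v) = of_int e2 * var (b J)"
    using bracket_distinct_sign[OF d(3)] d(4) by metis
  have lead: "bracket b (u @ X) * bracket b (Y @ v) = of_int (e1 * e2) * (var (b I) * var (b J))"
    by (simp add: e1(2) e2(2) mult_ac)
  have "tm p \<in> monomials_in (heavier k n t)" if p: "p \<in> P - G" for p
    unfolding tm_def
  proof (intro monomials_in_of_int_mult bracket_mult_monomials)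
    let ?X = "take q (permute_list p S)" and ?Y = "drop q (permute_list p S)"
    assume dd: "distinct (u @ ?X)" "distinct (?Y @ v)"
    have perm: "p permutes {..<length S}" using p by (simp add: P_def m_def)
    have msS: "mset (?X @ ?Y) = mset S" using perm by simp
    have setS: "set ?X \<union> set ?Y = set X \<union> set Y"
      using msS by (metis S_def set_append set_mset_mset)
    have lenX: "length ?X = length X" using lens by (simp add: m_def q_def)
    have less: "\<Sum>(set ?X) < \<Sum>(set X)"
    proof (rule sum_less_of_exchange)
      show "card (set X) = card (set ?X)" using dd(1) dis(2) lenX by (simp add: distinct_card)
      show "set X \<noteq> set ?X" using p by (auto simp: G_def)
      show "x \<le> a" if "a \<in> set X - set ?X" for a using that sets by auto
      show "a < x" if "a \<in> set ?X - set X" for a using that sets setS by auto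
    qed auto
    have "sum_list ?X + sum_list ?Y = sum_list X + sum_list Y"
      using arg_cong[OF msS, of sum_mset] by (simp only: sum_mset_sum_list S_def sum_list_append)
    then have tot: "\<Sum>(set ?X) + \<Sum>(set ?Y) = \<Sum>(set X) + \<Sum>(set Y)"
      using dd dis by (simp add: sum_list_distinct_conv_sum_set[of _ "\<lambda>i. i", simplified])
    define s1 where "s1 = \<Sum>(set (u @ ?X))"
    define s2 where "s2 = \<Sum>(set (?Y @ v))"
    have "s1 = \<Sum>(set u) + \<Sum>(set ?X)" "s2 = \<Sum>(set ?Y) + \<Sum>(set v)"
      "\<Sum>I = \<Sum>(set u) + \<Sum>(set X)" "\<Sum>J = \<Sum>(set Y) + \<Sum>(set v)"
      using dd d unfolding s1_def s2_def d(2)[symmetric] d(4)[symmetric] set_append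
      by (auto intro!: sum.union_disjoint)
    then have s: "s1 < \<Sum>I" "s1 + s2 = \<Sum>I + \<Sum>J" using less tot by simp_all
    have "(\<Sum>I)\<^sup>2 + (\<Sum>J)\<^sup>2 < s1\<^sup>2 + s2\<^sup>2"
    proof -
      define z where "z = \<Sum>I - s1"
      have z: "\<Sum>I = s1 + z" "s2 = \<Sum>J + z" "0 < z" using s by (simp_all add: z_def)
      have "s1 * z < \<Sum>J * z" using le z by simp
      moreover have "z * s1 = s1 * z" "z * \<Sum>J = \<Sum>J * z" by simp_all
      ultimately show ?thesis
        unfolding z(1,2) power2_eq_square distrib_left distrib_right by linarith
    qed
    then have "t < index_weight (b (set (u @ ?X))) + index_weight (b (set (?Y @ v)))"
      unfolding t_def iw s1_def s2_def .
    moreover have "b (set (u @ ?X)) \<in> bracket_vars k n" "b (set (?Y @ v)) \<in> bracket_vars k n"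
    proof -
      have "set X \<union> set Y \<subseteq> {..<n}" "set u \<subseteq> {..<n}" "set v \<subseteq> {..<n}"
        using sets I'(3) J'(3) by auto
      then have "set ?X \<subseteq> {..<n}" "set ?Y \<subseteq> {..<n}" "set u \<subseteq> {..<n}" "set v \<subseteq> {..<n}"
        unfolding setS[symmetric] by (simp_all only: Un_subset_iff)
      moreover have "length (u @ ?X) = k" "length (?Y @ v) = k" using lens by (simp_all add: m_def)
      ultimately have "set (u @ ?X) \<in> subsets n k" "set (?Y @ v) \<in> subsets n k"
        using distinct_card[OF dd(1)] distinct_card[OF dd(2)]
        unfolding subsets_def mem_Collect_eq set_append by simp_all
      then show "b (set (u @ ?X)) \<in> bracket_vars k n" "b (set (?Y @ v)) \<in> bracket_vars k n"
        using b by (auto simp: bracket_vars_def simp del: set_append)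
    qed
    ultimately show "single (b (set (u @ ?X))) 1 + single (b (set (?Y @ v))) 1
        \<in> heavier k n t"
      by (intro pair_heavier)
  qed
  then have "c * (\<Sum>p\<in>P - G. tm p) \<in> monomials_in (heavier k n t)"
    unfolding c_def by (intro monomials_in_const_mult monomials_in_sum)
  moreover have "(e1 * e2) * (e1 * e2) = 1" using e1(1) e2(1) by (metis mult.assoc mult.commute mult_1)
  ultimately show ?thesis
    using mem' unfolding lead t_def by (intro straightensI)
qed

end

lemma compatible_refl: "compatible n r v v"
  by (cases v) (simp_all add: seq_le_def)

lemma monomials_in_mono: "f \<in> monomials_in S \<Longrightarrow> S \<subseteq> T \<Longrightarrow> f \<in> monomials_in T"
  by (auto simp: monomials_in_def)

context relation_ideal
begin

lemma straightens_incompatible: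
  assumes v: "v \<in> bracket_vars k n" and w: "w \<in> bracket_vars k n" and bad: "\<not> compatible n r v w"
  shows "straightens v w"
proof -
  have same: "straightens (b I) (b J)"
    if b: "b \<in> {Angle, Square}" and IJ: "I \<in> subsets n k" "J \<in> subsets n k"
      and nle: "\<not> seq_le n I J" "\<not> seq_le n J I" for b I J
  proof (cases "\<Sum>I \<le> \<Sum>J")
    case True
    obtain x where "count_below I x < count_below J x" using nle(1) by (auto simp: seq_le_def not_le)
    then show ?thesis using straightens_same_kind[OF b IJ True] by blast
  next
    case False
    obtain x where "count_below J x < count_below I x" using nle(2) by (auto simp: seq_le_def not_le)
    then show ?thesis using straightens_same_kind[OF b IJ(2,1)] False straightens_sym by simp
  qed
  have mixed: "straightens (Angle I) (Square K)"
    if "I \<in> subsets n k" "K \<in> subsets n k"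
      "\<not> (\<forall>x\<le>n. count_below I x + count_below K x \<le> x + r)" for I K
    using that straightens_mixed[of I K] by (auto simp: not_le)
  show ?thesis
  proof (cases v)
    case vA: (Angle I)
    show ?thesis
    proof (cases w)
      case (Angle J)
      then show ?thesis using vA v w bad same[of Angle I J] by (auto simp: bracket_vars_def)
    next
      case (Square K)
      then show ?thesis using vA v w bad mixed[of I K] by (auto simp: bracket_vars_def)
    qed
  next
    case vS: (Square K)
    show ?thesis
    proof (cases w)
      case (Angle I)
      then show ?thesis using vS v w bad mixed[of I K] straightens_sym by (auto simp: bracket_vars_def)
    next
      case (Square J)
      then show ?thesis using vS v w bad same[of Square K J] by (auto simp: bracket_vars_def)
    qed
  qed
qed

definition reducible :: "bracket_var cpoly \<Rightarrow> bool" where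
  "reducible f \<longleftrightarrow> (\<exists>g\<in>monomials_in (standard k n r). f - g \<in> H)"

lemma reducible_add: "reducible f \<Longrightarrow> reducible g \<Longrightarrow> reducible (f + g)"
proof -
  assume "reducible f" "reducible g"
  then obtain f' g' where "f' \<in> monomials_in (standard k n r)" "f - f' \<in> H"
    "g' \<in> monomials_in (standard k n r)" "g - g' \<in> H" by (auto simp: reducible_def)
  moreover from this have "(f + g) - (f' + g') \<in> H" using H_add[of "f - f'" "g - g'"] by (simp add: algebra_simps)
  ultimately show ?thesis unfolding reducible_def using monomials_in_add by blast
qed

lemma reducible_const_mult: "reducible f \<Longrightarrow> reducible (const c * f)"
proof -
  assume "reducible f"
  then obtain g where "g \<in> monomials_in (standard k n r)" "f - g \<in> H" by (auto simp: reducible_def)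
  moreover from this have "const c * f - const c * g \<in> H"
    using H_const_mult[of "f - g" c] by (simp add: right_diff_distrib)
  ultimately show ?thesis unfolding reducible_def using monomials_in_const_mult by blast
qed

lemma reducible_zero: "reducible 0"
  unfolding reducible_def by (rule bexI[of _ 0]) (simp_all add: H_zero)

lemma reducible_monomials_in:
  assumes "f \<in> monomials_in S" "\<And>m. m \<in> S \<Longrightarrow> reducible (single m 1)"
  shows "reducible f"
proof -
  have "reducible (\<Sum>m\<in>A. single m (lookup f m))" if "A \<subseteq> keys f" "finite A" for A
    using that(2,1)
  proof (induction A)
    case empty
    then show ?case by (simp add: reducible_zero)
  next
    case (insert m A)
    have "reducible (const (lookup f m) * single m 1)"
      using assms insert by (intro reducible_const_mult) (auto simp: monomials_in_def)
    then show ?case using insert by (auto simp: const_mult_single intro: reducible_add)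
  qed
  from this[of "keys f"] show ?thesis
    using poly_mapping_sum_single[of f] by simp
qed

lemma reducible_cong:
  assumes "f - g \<in> H" "reducible g"
  shows "reducible f"
proof -
  obtain g' where "g' \<in> monomials_in (standard k n r)" "g - g' \<in> H" using assms(2) by (auto simp: reducible_def)
  moreover from this have "f - g' \<in> H" using H_add[OF assms(1), of "g - g'"] by simp
  ultimately show ?thesis unfolding reducible_def by blast
qed

lemma weight_le_degree:
  assumes "keys m \<subseteq> bracket_vars k n"
  shows "weight index_weight m \<le> weight (\<lambda>_. 1) m * (\<Sum>{..<n})\<^sup>2"
proof -
  have "\<Sum>I \<le> \<Sum>{..<n}" if "I \<in> subsets n k" for I
    using that by (intro sum_mono2) (auto simp: subsets_def)
  then have "index_weight v \<le> (\<Sum>{..<n})\<^sup>2" if "v \<in> bracket_vars k n" for v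
    using that by (auto simp: bracket_vars_def intro!: power_mono)
  then show ?thesis
    unfolding weight_def sum_distrib_right using assms by (intro sum_mono) auto
qed

text \<open>Each straightening step raises the weight and keeps the degree, which bounds the weight.\<close>

lemma reducible_monomial:
  "keys m \<subseteq> bracket_vars k n \<Longrightarrow> reducible (single m 1)"
proof (induction "weight (\<lambda>_. 1) m * (\<Sum>{..<n})\<^sup>2 - weight index_weight m" arbitrary: m rule: less_induct)
  case less
  let ?B = "(\<Sum>{..<n})\<^sup>2"
  show ?case
  proof (cases "m \<in> standard k n r")
    case True
    then show ?thesis
      unfolding reducible_def
      by (intro bexI[of _ "single m 1"] monomials_in_single) (simp_all add: H_zero)
  next
    case False
    then obtain v w where vw: "v \<in> keys m" "w \<in> keys m" "\<not> compatible n r v w"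
      using less.prems by (auto simp: standard_def)
    then have ne: "v \<noteq> w" using compatible_refl by auto
    define m2 where "m2 = single v 1 + single w (1::nat)"
    define m1 where "m1 = m - m2"
    have m: "m = m1 + m2"
      by (rule poly_mapping_eqI)
        (use vw ne in \<open>auto simp: m1_def m2_def lookup_add lookup_minus lookup_single when_def in_keys_iff\<close>)
    have m1: "keys m1 \<subseteq> bracket_vars k n"
      using less.prems unfolding m
      by (auto simp: in_keys_iff lookup_add)
    have "straightens v w"
      using vw less.prems by (intro straightens_incompatible) auto
    then obtain q where q: "q \<in> monomials_in (heavier k n (index_weight v + index_weight w))"
      "var v * var w - q \<in> H"
      by (auto simp: straightens_def)
    let ?s = "single m1 1 :: bracket_var cpoly"
    have "?s * (var v * var w - q) \<in> H"
      by (rule H_mult[OF q(2)]) (use m1 in \<open>auto simp: ring_simps\<close>)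
    moreover have "?s * (var v * var w - q) = single m 1 - ?s * q"
      by (simp add: right_diff_distrib var_def mult_single m m2_def)
    ultimately have "single m 1 - ?s * q \<in> H" by simp
    moreover have "reducible (?s * q)"
    proof (rule reducible_monomials_in)
      show "?s * q \<in> monomials_in {m1 + m' | m'. m' \<in> heavier k n (index_weight v + index_weight w)}"
        by (rule monomials_in_mult[OF monomials_in_single[OF singletonI] q(1)]) auto
      fix m'' assume "m'' \<in> {m1 + m' | m'. m' \<in> heavier k n (index_weight v + index_weight w)}"
      then obtain m' where m': "m'' = m1 + m'" "keys m' \<subseteq> bracket_vars k n"
        "weight (\<lambda>_. 1) m' = 2" "index_weight v + index_weight w < weight index_weight m'"
        by (auto simp: heavier_def)
      have keys: "keys m'' \<subseteq> bracket_vars k n" using m1 m' keys_add[of m1 m'] by auto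
      have deg: "weight (\<lambda>_. 1) m'' = weight (\<lambda>_. 1) m"
        unfolding m m' m2_def weight_add m'(3) by simp
      have "weight index_weight m < weight index_weight m''"
        unfolding m m'(1) m2_def weight_add using m'(4) by simp
      then show "reducible (single m'' 1)"
        using weight_le_degree[OF keys] keys deg by (intro less.hyps) simp_all
    qed
    ultimately show ?thesis by (rule reducible_cong)
  qed
qed

lemma reducible_carrier:
  assumes "f \<in> carrier (SH_ring k n)"
  shows "reducible f"
  by (rule reducible_monomials_in[of _ "{m. keys m \<subseteq> bracket_vars k n}"])
    (use assms reducible_monomial in \<open>auto simp: ring_simps monomials_in_def\<close>)

end

section \<open>Subspaces given by the rows of a matrix\<close>

lemma (in vectorspace) subspace_basis:
  assumes fd: "fin_dim" and U: "VectorSpace.subspace K U V"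
  obtains S where "finite S" "S \<subseteq> U" "lin_indpt S" "span S = U" "card S = vectorspace.dim K (vs U)"
proof -
  have sm: "submodule K U V" using U by (simp add: VectorSpace.subspace_def)
  interpret u: vectorspace K "vs U" by (rule subspace_is_vs[OF U])
  have UV: "U \<subseteq> carrier V" using sm by (rule submodule.subset)
  have bound: "finite S \<and> card S \<le> dim" if "S \<subseteq> U \<and> lin_indpt S" for S
    using that li_le_dim[OF fd, of S] UV by blast
  have empty: "{} \<subseteq> U \<and> lin_indpt {}" unfolding lin_dep_def by blast
  obtain S where S: "finite S" "maximal S (\<lambda>S. S \<subseteq> U \<and> lin_indpt S)"
    using maximal_exists[of "\<lambda>S. S \<subseteq> U \<and> lin_indpt S", OF bound empty] by blast
  have SU: "S \<subseteq> U" "lin_indpt S" using S(2) unfolding maximal_def by blast+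
  have "maximal S (\<lambda>S. S \<subseteq> carrier (vs U) \<and> u.lin_indpt S)"
    using S(2) span_li_not_depend(2)[OF _ sm] unfolding maximal_def carrier_vs_is_self by blast
  then have b: "u.basis S" by (rule u.max_li_is_basis)
  then have "span S = U" using span_li_not_depend(1)[OF SU(1) sm] by (simp add: u.basis_def)
  moreover have "card S = u.dim" using u.dim_basis[OF S(1) b] by simp
  ultimately show thesis using that[OF S(1) SU] by simp
qed

lemma (in vectorspace) card_le_subspace_dim:
  assumes fd: "fin_dim" and U: "VectorSpace.subspace K U V" and S: "S \<subseteq> U" "lin_indpt S"
  shows "card S \<le> vectorspace.dim K (vs U)"
proof -
  obtain B where B: "finite B" "B \<subseteq> U" "lin_indpt B" "span B = U" "card B = vectorspace.dim K (vs U)"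
    using subspace_basis[OF fd U] .
  have "submodule K U V" using U by (simp add: VectorSpace.subspace_def)
  then have UV: "U \<subseteq> carrier V" by (rule submodule.subset)
  have "finite S" using li_le_dim[OF fd] S UV by blast
  moreover have "B \<subseteq> carrier V" "S \<subseteq> span B" using B S UV by auto
  ultimately obtain C where "C \<subseteq> carrier V" "int (card C) \<le> int (card B) - int (card S)"
    using replacement[of S B] B(1) S(2) by blast
  then have "card S \<le> card B" by linarith
  then show ?thesis by (simp only: B(5))
qed

context vec_space
begin

lemma subspace_Int_orthogonal_complement:
  assumes "VectorSpace.subspace class_ring U V" "W \<subseteq> carrier_vec n"
  shows "VectorSpace.subspace class_ring (U \<inter> orthogonal_complement W) V"
proof -
  have sm: "submodule class_ring U V" using assms(1) by (simp add: VectorSpace.subspace_def)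
  have UV: "U \<subseteq> carrier_vec n" using submodule.subset[OF sm] by simp
  have "submodule class_ring (U \<inter> orthogonal_complement W) V"
  proof (rule submodule.intro)
    show "Module.module class_ring V" by (rule submodule.module[OF sm])
    show "U \<inter> orthogonal_complement W \<subseteq> carrier V" using UV by auto
    show "\<zero>\<^bsub>V\<^esub> \<in> U \<inter> orthogonal_complement W"
      using submodule.zero_closed[OF sm] assms(2) by (auto simp: orthogonal_complement_def)
    fix v w assume vw: "v \<in> U \<inter> orthogonal_complement W" "w \<in> U \<inter> orthogonal_complement W"
    then have "v + w \<in> U" using submodule.m_closed[OF sm, of v w] by simp
    moreover have "(v + w) \<bullet> y = 0" if "y \<in> W" for y
    proof -
      have "v \<in> carrier_vec n" "w \<in> carrier_vec n" "y \<in> carrier_vec n" "v \<bullet> y = 0" "w \<bullet> y = 0"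
        using vw that assms(2) by (auto simp: orthogonal_complement_def)
      then show ?thesis using add_scalar_prod_distrib[of v n w y] by simp
    qed
    ultimately show "v \<oplus>\<^bsub>V\<^esub> w \<in> U \<inter> orthogonal_complement W"
      using UV by (auto simp: orthogonal_complement_def)
  next
    fix c v assume c: "c \<in> carrier (class_ring :: 'a ring)" and v: "v \<in> U \<inter> orthogonal_complement W"
    then have "c \<cdot>\<^sub>v v \<in> U" using submodule.smult_closed[OF sm, of c v] by simp
    moreover have "(c \<cdot>\<^sub>v v) \<bullet> y = 0" if "y \<in> W" for y
    proof -
      have "v \<in> carrier_vec n" "y \<in> carrier_vec n" "v \<bullet> y = 0"
        using v that assms(2) by (auto simp: orthogonal_complement_def)
      then show ?thesis using smult_scalar_prod_distrib[of v n y c] by simp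
    qed
    ultimately show "c \<odot>\<^bsub>V\<^esub> v \<in> U \<inter> orthogonal_complement W"
      using UV by (auto simp: orthogonal_complement_def)
  qed
  then show ?thesis using assms(1) by (simp add: VectorSpace.subspace_def)
qed

text \<open>By the replacement theorem a basis of \<open>U\<close> extends to at most \<open>k\<close> vectors spanning the row space;
  zero vectors fill up the remaining rows of \<open>A'\<close>, so that \<open>F\<close> may be singular.\<close>

lemma adapted_rows:
  assumes A: "A \<in> carrier_mat k n" and U: "VectorSpace.subspace class_ring U V" "U \<subseteq> row_space A"
    and l: "l \<le> vectorspace.dim class_ring (vs U)"
  obtains A' F where "A' \<in> carrier_mat k n" "F \<in> carrier_mat k k" "A = F * A'"
    "\<And>i. i < l \<Longrightarrow> i < k \<Longrightarrow> row A' i \<in> U"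
proof -
  obtain S where S: "finite S" "S \<subseteq> U" "lin_indpt S" "span S = U" "card S = vectorspace.dim class_ring (vs U)"
    using subspace_basis[OF fin_dim U(1)] .
  have rows: "set (rows A) \<subseteq> carrier_vec n" using rows_carrier[of A] A by auto
  have "S \<subseteq> span (set (rows A))" using S(2) U(2) unfolding row_space_def by blast
  from replacement[OF S(1) _ _ S(3) this] rows
  obtain C where C: "finite C" "C \<subseteq> carrier_vec n" "int (card C) \<le> int (card (set (rows A))) - int (card S)"
    "span (S \<union> C) = span (set (rows A))"
    by auto
  have "submodule class_ring U V" using U(1) by (simp add: VectorSpace.subspace_def)
  then have Sn: "S \<subseteq> carrier_vec n" using S(2) submodule.subset by fastforce
  obtain xs where xs: "set xs = S" "distinct xs" using finite_distinct_list[OF S(1)] by blast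
  obtain ys where ys: "set ys = C" "distinct ys" using finite_distinct_list[OF C(1)] by blast
  have "card (set (rows A)) \<le> k" using card_length[of "rows A"] A by simp
  then have len: "length xs + length ys \<le> k"
    using C(3) distinct_card[OF xs(2)] distinct_card[OF ys(2)] xs ys by simp
  define zs where "zs = xs @ ys @ replicate (k - (length xs + length ys)) (0\<^sub>v n)"
  have zs: "length zs = k" "set zs \<subseteq> carrier_vec n" "S \<union> C \<subseteq> set zs"
    using len Sn C(2) xs ys by (auto simp: zs_def)
  define A' where "A' = mat_of_rows n zs"
  have A': "A' \<in> carrier_mat k n" unfolding A'_def zs(1)[symmetric] by (rule mat_of_rows_carrier)
  have rowsA': "rows A' = zs" using zs(2) by (simp add: A'_def)
  have "span (set (rows A)) \<subseteq> span (set zs)" using span_is_monotone[OF zs(3)] C(4) by simp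
  then have sub: "row_space A \<subseteq> row_space A'" by (simp add: row_space_def rowsA')
  have "\<exists>y\<in>carrier_vec k. A'\<^sup>T *\<^sub>v y = row A i" if i: "i < k" for i
  proof -
    have "row A i \<in> set (rows A)" using i A by (auto simp: rows_def)
    then have "row A i \<in> row_space A" using in_own_span[of "set (rows A)"] rows by (auto simp: row_space_def)
    then have "row A i \<in> row_space A'" using sub by blast
    then show ?thesis using row_space_eq[OF A'] A' by auto
  qed
  then obtain Y where Y: "\<And>i. i < k \<Longrightarrow> Y i \<in> carrier_vec k \<and> A'\<^sup>T *\<^sub>v Y i = row A i" by metis
  define F where "F = mat k k (\<lambda>(i, j). Y i $ j)"
  have rowF: "row F i = Y i" if "i < k" for i
    using Y[OF that] that by (intro eq_vecI) (auto simp: F_def)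
  have "A = F * A'"
  proof (rule eq_matI)
    fix i j assume "i < dim_row (F * A')" "j < dim_col (F * A')"
    then have ij: "i < k" "j < n" using A' by (simp_all add: F_def)
    have "A $$ (i, j) = row A i $ j" using ij A by simp
    also have "\<dots> = (A'\<^sup>T *\<^sub>v Y i) $ j" using Y[OF ij(1)] by simp
    also have "\<dots> = col A' j \<bullet> Y i" using ij A' by simp
    also have "\<dots> = Y i \<bullet> col A' j"
      using Y[OF ij(1)] A' by (intro comm_scalar_prod[of _ k]) auto
    also have "\<dots> = (F * A') $$ (i, j)" using ij A' rowF by (simp add: F_def)
    finally show "A $$ (i, j) = (F * A') $$ (i, j)" .
  qed (use A A' in \<open>simp_all add: F_def\<close>)
  moreover have "row A' i \<in> U" if "i < l" "i < k" for i
  proof -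
    have "i < length xs" using that l S(5) distinct_card[OF xs(2)] xs(1) by simp
    then have "zs ! i \<in> S" using xs(1) nth_mem[of i xs] by (simp add: zs_def nth_append)
    moreover have "row A' i = zs ! i"
      unfolding A'_def using that zs nth_mem[of i zs] by (intro mat_of_rows_row) auto
    ultimately show ?thesis using S(2) by auto
  qed
  ultimately show thesis using that[OF A', of F] by (simp add: F_def)
qed

lemma rows_lin_indpt:
  assumes A: "A \<in> carrier_mat k n" and R: "R \<in> carrier_mat n k" and inv: "A * R = 1\<^sub>m k"
  shows "distinct (rows A)" "lin_indpt (set (rows A))"
proof -
  have RA: "R\<^sup>T * A\<^sup>T = 1\<^sub>m k" using transpose_mult[OF A R] inv by simp
  have AT: "A\<^sup>T \<in> carrier_mat n k" using A by simp
  have inj: "v = w" if "v \<in> carrier_vec k" "w \<in> carrier_vec k" "A\<^sup>T *\<^sub>v v = A\<^sup>T *\<^sub>v w" for v w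
  proof -
    have *: "R\<^sup>T *\<^sub>v (A\<^sup>T *\<^sub>v u) = u" if "u \<in> carrier_vec k" for u
      using assoc_mult_mat_vec[of "R\<^sup>T" k n "A\<^sup>T" k u] R AT RA that by simp
    have "v = R\<^sup>T *\<^sub>v (A\<^sup>T *\<^sub>v v)" using *[OF that(1)] by (rule sym)
    also have "\<dots> = R\<^sup>T *\<^sub>v (A\<^sup>T *\<^sub>v w)" by (simp only: that(3))
    also have "\<dots> = w" by (rule *[OF that(2)])
    finally show ?thesis .
  qed
  have col: "A\<^sup>T *\<^sub>v unit_vec k i = rows A ! i" if "i < k" for i
  proof (rule eq_vecI)
    fix j assume "j < dim_vec (rows A ! i)"
    then have j: "j < n" using that A by simp
    have "(A\<^sup>T *\<^sub>v unit_vec k i) $ j = col A j \<bullet> unit_vec k i" using j A by simp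
    also have "\<dots> = A $$ (i, j)" using that j A by (subst scalar_prod_right_unit) auto
    finally show "(A\<^sup>T *\<^sub>v unit_vec k i) $ j = rows A ! i $ j" using that j A by simp
  qed (use that A in simp)
  show dist: "distinct (rows A)"
  proof (rule distinct_conv_nth[THEN iffD2], intro allI impI)
    fix i j assume ij: "i < length (rows A)" "j < length (rows A)" "i \<noteq> j"
    then have k: "i < k" "j < k" using A by simp_all
    have "(unit_vec k i :: 'a vec) $ i \<noteq> unit_vec k j $ i" using k ij(3) by simp
    then have "(unit_vec k i :: 'a vec) \<noteq> unit_vec k j" by metis
    then show "rows A ! i \<noteq> rows A ! j"
      using inj[of "unit_vec k i" "unit_vec k j"] col[OF k(1)] col[OF k(2)] by auto
  qed
  show "lin_indpt (set (rows A))"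
  proof
    assume "lin_dep (set (rows A))"
    then have "lin_dep (set (cols A\<^sup>T))" "distinct (cols A\<^sup>T)" using dist by simp_all
    then obtain v where v: "v \<in> carrier_vec k" "v \<noteq> 0\<^sub>v k" "A\<^sup>T *\<^sub>v v = 0\<^sub>v n"
      using lin_depE[OF AT] by blast
    moreover have "A\<^sup>T *\<^sub>v 0\<^sub>v k = 0\<^sub>v n" using A by (intro eq_vecI) auto
    ultimately show False using inj[of v "0\<^sub>v k"] by simp
  qed
qed

lemma row_space_full_rank:
  assumes A: "A \<in> carrier_mat k n" and R: "R \<in> carrier_mat n k" and inv: "A * R = 1\<^sub>m k"
  shows "VectorSpace.subspace class_ring (row_space A) V" "vectorspace.dim class_ring (vs (row_space A)) = k"
proof -
  have rows: "set (rows A) \<subseteq> carrier_vec n" using rows_carrier[of A] A by auto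
  show sub: "VectorSpace.subspace class_ring (row_space A) V"
    unfolding row_space_def using rows by (intro span_is_subspace) simp
  note li = rows_lin_indpt[OF assms]
  have sm: "submodule class_ring (row_space A) V" using sub by (simp add: VectorSpace.subspace_def)
  interpret u: vectorspace class_ring "vs (row_space A)" by (rule subspace_is_vs[OF sub])
  have own: "set (rows A) \<subseteq> row_space A" unfolding row_space_def using rows by (intro in_own_span) simp
  have "u.basis (set (rows A))"
    using own li(2) span_li_not_depend[OF own sm]
    unfolding vectorspace.basis_def[OF subspace_is_vs[OF sub]] by (simp add: row_space_def)
  from u.dim_basis[OF _ this] show "u.dim = k"
    using distinct_card[OF li(1)] A by simp
qed

end

section \<open>The generators vanish on the variety\<close>

lemma minor_mult_mat:
  assumes F: "F \<in> carrier_mat k k" and A: "A \<in> carrier_mat k n"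
    and xs: "length xs = k" "set xs \<subseteq> {..<n}"
  shows "minor (\<lambda>i j. (F * A) $$ (i, j)) xs = det F * minor (\<lambda>i j. A $$ (i, j)) xs"
proof -
  let ?N = "mat k k (\<lambda>(j, i). A $$ (i, xs ! j))"
  have "mat k k (\<lambda>(j, i). (F * A) $$ (i, xs ! j)) = ?N * transpose_mat F"
  proof (rule eq_matI)
    fix j i assume "j < dim_row (?N * transpose_mat F)" "i < dim_col (?N * transpose_mat F)"
    then have ji: "j < k" "i < k" using F by simp_all
    then have "xs ! j \<in> set xs" using xs(1) by simp
    then have "xs ! j < n" using xs(2) by auto
    then show "mat k k (\<lambda>(j, i). (F * A) $$ (i, xs ! j)) $$ (j, i) = (?N * transpose_mat F) $$ (j, i)"
      using ji F A by (auto simp: scalar_prod_def mult.commute intro!: sum.cong)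
  qed (use F in simp_all)
  moreover have "det (?N * transpose_mat F) = det ?N * det F"
    using F det_mult[of ?N k "transpose_mat F"] by (simp add: det_transpose)
  ultimately show ?thesis using xs by (simp add: minor_def mult.commute)
qed

text \<open>A basis of \<open>V\<close> containing \<open>k - r\<close> vectors of \<open>W\<^sup>\<bottom>\<close> brings the pair into the form needed for
  \<open>contraction_vanishes\<close>; the change of basis only multiplies all minors by a determinant.\<close>

lemma PQT_vanishes_on_SH:
  assumes rk: "r \<le> k" and VW: "(V, W) \<in> SH k n r"
    and xV: "x \<circ> Angle \<in> pluecker_line k n V" and xW: "x \<circ> Square \<in> pluecker_line k n W"
    and I: "I \<in> row_indices k n r" "I' \<in> row_indices k n r"
  shows "eval_cpoly x (PQT n r I I') = 0"
proof -
  interpret vec_space "TYPE(complex)" n .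
  obtain A c where A: "A \<in> carrier_mat k n" "row_space A = V"
    and xA: "\<And>I. I \<in> subsets n k \<Longrightarrow> x (Angle I) = c * det (submatrix A UNIV I)"
    using xV by (auto simp: pluecker_line_def)
  obtain B d where B: "B \<in> carrier_mat k n" "row_space B = W"
    and xB: "\<And>I. I \<in> subsets n k \<Longrightarrow> x (Square I) = d * det (submatrix B UNIV I)"
    using xW by (auto simp: pluecker_line_def)
  let ?U = "V \<inter> orthogonal_complement W"
  have V: "VectorSpace.subspace class_ring V (module_vec TYPE(complex) n)"
    and dimU: "k - r \<le> vectorspace.dim class_ring (vs ?U)"
    using VW by (auto simp: SH_def Gr_def)
  have rowsB: "set (rows B) \<subseteq> carrier_vec n" using rows_carrier[of B] B by auto
  then have Wn: "W \<subseteq> carrier_vec n"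
    using B(2) span_is_subset2[of "set (rows B)"] by (auto simp: row_space_def)
  have "?U \<subseteq> row_space A" using A(2) by blast
  from adapted_rows[OF A(1) subspace_Int_orthogonal_complement[OF V Wn] this dimU]
  obtain A' F where A': "A' \<in> carrier_mat k n" and F: "F \<in> carrier_mat k k" and eq: "A = F * A'"
    and rows: "\<And>i. i < k - r \<Longrightarrow> i < k \<Longrightarrow> row A' i \<in> ?U" by metis
  define a where "a = (\<lambda>i j. A' $$ (i, j))"
  define b where "b = (\<lambda>i j. B $$ (i, j))"
  have evA: "eval_cpoly x (bracket Angle xs) = (c * det F) * minor a xs"
    if "length xs = k" "set xs \<subseteq> {..<n}" for xs
  proof -
    have "eval_cpoly x (bracket Angle xs) = c * minor (\<lambda>i j. A $$ (i, j)) xs"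
      using xA det_submatrix_eq_minor[OF A(1)] that by (intro eval_bracket[of n k]) auto
    then show ?thesis using minor_mult_mat[OF F A' that] by (simp add: eq a_def)
  qed
  have evB: "eval_cpoly x (bracket Square xs) = d * minor b xs"
    if "length xs = k" "set xs \<subseteq> {..<n}" for xs
    unfolding b_def using xB det_submatrix_eq_minor[OF B(1)] that by (intro eval_bracket[of n k]) auto
  have orth: "(\<Sum>j<n. a i j * b t j) = 0" if it: "i < k - r" "t < k" for i t
  proof -
    have "row B t \<in> set (rows B)" using it B(1) by (auto simp: rows_def)
    then have "row B t \<in> W" using in_own_span[of "set (rows B)"] rowsB B(2) by (auto simp: row_space_def)
    then have "row A' i \<bullet> row B t = 0"
      using rows[of i] it by (auto simp: orthogonal_complement_def)
    moreover have "row A' i \<bullet> row B t = (\<Sum>j<n. a i j * b t j)"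
      using A' B(1) it by (auto simp: scalar_prod_def a_def b_def lessThan_atLeast0 intro!: sum.cong)
    ultimately show ?thesis by simp
  qed
  define us where "us = sorted_list_of_set I"
  define vs where "vs = sorted_list_of_set I'"
  have fin: "finite I" "finite I'" and sub: "I \<subseteq> {..<n}" "I' \<subseteq> {..<n}"
    and card: "card I + r + 1 = k" "card I' + r + 1 = k"
    using I by (auto simp: row_indices_def intro: finite_subset)
  have "eval_cpoly x (PQT n r I I') = (\<Sum>Y\<in>subsets n (r + 1). (c * det F * d) *
      (minor a (us @ sorted_list_of_set Y) * minor b (vs @ sorted_list_of_set Y)))"
    unfolding PQT_def eval_cpoly_sum
  proof (rule sum.cong[OF refl])
    fix Y assume Y: "Y \<in> subsets n (r + 1)"
    note Y' = subsetsD[OF Y]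
    have "length (us @ sorted_list_of_set Y) = k" "length (vs @ sorted_list_of_set Y) = k"
      "set (us @ sorted_list_of_set Y) \<subseteq> {..<n}" "set (vs @ sorted_list_of_set Y) \<subseteq> {..<n}"
      using Y' fin sub card by (simp_all add: us_def vs_def)
    then show "eval_cpoly x (bracket_matrix Angle I Y * bracket_matrix Square I' Y) = (c * det F * d) *
      (minor a (us @ sorted_list_of_set Y) * minor b (vs @ sorted_list_of_set Y))"
      using evA evB by (simp add: bracket_matrix_def eval_cpoly_mult us_def vs_def)
  qed
  also have "\<dots> = (c * det F * d) * (\<Sum>Y\<in>subsets n (r + 1).
      minor a (us @ sorted_list_of_set Y) * minor b (vs @ sorted_list_of_set Y))"
    by (simp only: sum_distrib_left)
  also have "(\<Sum>Y\<in>subsets n (r + 1).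
      minor a (us @ sorted_list_of_set Y) * minor b (vs @ sorted_list_of_set Y)) = 0"
    by (rule contraction_vanishes[of k r a b n]) (use orth card fin in \<open>auto simp: us_def vs_def\<close>)
  finally show ?thesis by simp
qed

section \<open>Ideals of the bracket ring\<close>

lemma SH_ring_simps: "mult (SH_ring k n) = (*)" "zero (SH_ring k n) = 0" "add (SH_ring k n) = (+)"
  "carrier (SH_ring k n) = monomials_in {m. keys m \<subseteq> bracket_vars k n}"
  by (auto simp: SH_ring_def cpoly_ring_def bracket_vars_def monomials_in_def)

lemma cring_SH_ring: "cring (SH_ring k n)"
  unfolding SH_ring_def by (rule cring_cpoly_ring)

lemma SH_idealI:
  assumes "f \<in> carrier (SH_ring k n)"
    "\<And>x V W. (V, W) \<in> SH k n r \<Longrightarrow> x \<circ> Angle \<in> pluecker_line k n V \<Longrightarrow>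
      x \<circ> Square \<in> pluecker_line k n W \<Longrightarrow> eval_cpoly x f = 0"
  shows "f \<in> SH_ideal k n r"
  unfolding SH_ideal_def using assms by blast

lemma SH_idealD:
  assumes "f \<in> SH_ideal k n r"
  shows "f \<in> carrier (SH_ring k n)"
    "(V, W) \<in> SH k n r \<Longrightarrow> x \<circ> Angle \<in> pluecker_line k n V \<Longrightarrow>
      x \<circ> Square \<in> pluecker_line k n W \<Longrightarrow> eval_cpoly x f = 0"
  using assms unfolding SH_ideal_def by blast+

lemma SH_ideal_is_ideal: "ideal (SH_ideal k n r) (SH_ring k n)"
proof -
  interpret cring "SH_ring k n" by (rule cring_SH_ring)
  show ?thesis
  proof (rule idealI)
    show "ring (SH_ring k n)" by (rule ring_axioms)
    show "subgroup (SH_ideal k n r) (add_monoid (SH_ring k n))"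
    proof (rule add.subgroupI)
      show "SH_ideal k n r \<subseteq> carrier (SH_ring k n)" by (auto simp: SH_ideal_def)
      have "0 \<in> SH_ideal k n r" by (auto simp: SH_ideal_def SH_ring_simps)
      then show "SH_ideal k n r \<noteq> {}" by blast
    next
      fix f assume f: "f \<in> SH_ideal k n r"
      then have fc: "f \<in> carrier (SH_ring k n)" by (simp add: SH_ideal_def)
      have nf: "- f \<in> carrier (SH_ring k n)" using fc by (simp add: SH_ring_simps monomials_in_def)
      have "\<ominus>\<^bsub>SH_ring k n\<^esub> f = - f"
        using fc nf by (intro minus_equality) (simp_all add: SH_ring_simps)
      then show "\<ominus>\<^bsub>SH_ring k n\<^esub> f \<in> SH_ideal k n r"
        using SH_idealD(2)[OF f] nf by (auto simp: eval_cpoly_uminus intro!: SH_idealI)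
    next
      fix f g assume fg: "f \<in> SH_ideal k n r" "g \<in> SH_ideal k n r"
      show "f \<oplus>\<^bsub>SH_ring k n\<^esub> g \<in> SH_ideal k n r"
        using a_closed[of f g] SH_idealD[OF fg(1)] SH_idealD[OF fg(2)]
        by (intro SH_idealI) (simp_all add: SH_ring_simps(3) eval_cpoly_add)
    qed
  next
    fix f g assume fg: "f \<in> SH_ideal k n r" "g \<in> carrier (SH_ring k n)"
    show "g \<otimes>\<^bsub>SH_ring k n\<^esub> f \<in> SH_ideal k n r" "f \<otimes>\<^bsub>SH_ring k n\<^esub> g \<in> SH_ideal k n r"
      using m_closed[of f g] m_closed[of g f] SH_idealD[OF fg(1)] fg(2)
      by (intro SH_idealI; simp add: SH_ring_simps(1) eval_cpoly_mult)+
  qed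
qed

lemma pluecker_ideal_carrier: "b \<in> {Angle, Square} \<Longrightarrow> pluecker_ideal b k n \<subseteq> carrier (SH_ring k n)"
  by (auto simp: pluecker_ideal_def cpoly_ring_def SH_ring_def)

lemma bracket_carrier:
  assumes "b \<in> {Angle, Square}" "length xs = k" "set xs \<subseteq> {..<n}"
  shows "bracket b xs \<in> carrier (SH_ring k n)"
  unfolding SH_ring_simps
  by (rule bracket_monomials)
    (use assms in \<open>auto simp: bracket_vars_def subsets_def distinct_card\<close>)

lemma PQT_carrier:
  assumes I: "I \<in> row_indices k n r" "I' \<in> row_indices k n r"
  shows "PQT n r I I' \<in> carrier (SH_ring k n)"
proof -
  interpret cring "SH_ring k n" by (rule cring_SH_ring)
  have fin: "finite I" "finite I'" and sub: "I \<subseteq> {..<n}" "I' \<subseteq> {..<n}"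
    and card: "card I + r + 1 = k" "card I' + r + 1 = k"
    using I by (auto simp: row_indices_def intro: finite_subset)
  have "bracket_matrix Angle I Y * bracket_matrix Square I' Y \<in> carrier (SH_ring k n)"
    if Y: "Y \<in> subsets n (r + 1)" for Y
  proof -
    note Y' = subsetsD[OF Y]
    have "bracket_matrix Angle I Y \<in> carrier (SH_ring k n)" "bracket_matrix Square I' Y \<in> carrier (SH_ring k n)"
      unfolding bracket_matrix_def by (intro bracket_carrier; use Y' fin sub card in simp)+
    from m_closed[OF this] show ?thesis by (simp only: SH_ring_simps(1))
  qed
  then show ?thesis unfolding PQT_def SH_ring_simps(4) by (rule monomials_in_sum)
qed

definition relations :: "nat \<Rightarrow> nat \<Rightarrow> nat \<Rightarrow> bracket_var cpoly set" where
  "relations k n r = genideal (SH_ring k n) (pluecker_ideal Angle k n)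
     <+>\<^bsub>SH_ring k n\<^esub> genideal (SH_ring k n) (pluecker_ideal Square k n)
     <+>\<^bsub>SH_ring k n\<^esub> genideal (SH_ring k n) (PQT_entries k n r)"

lemma relation_ideal_relations: "relation_ideal k n r (relations k n r)"
proof -
  interpret cring "SH_ring k n" by (rule cring_SH_ring)
  let ?A = "genideal (SH_ring k n) (pluecker_ideal Angle k n)"
  let ?S = "genideal (SH_ring k n) (pluecker_ideal Square k n)"
  let ?E = "genideal (SH_ring k n) (PQT_entries k n r)"
  have car: "pluecker_ideal Angle k n \<subseteq> carrier (SH_ring k n)"
    "pluecker_ideal Square k n \<subseteq> carrier (SH_ring k n)" "PQT_entries k n r \<subseteq> carrier (SH_ring k n)"
    using pluecker_ideal_carrier[of Angle k n] pluecker_ideal_carrier[of Square k n] PQT_carrier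
    by (auto simp: PQT_entries_def)
  note ids = car[THEN genideal_ideal]
  have AS: "ideal (?A <+>\<^bsub>SH_ring k n\<^esub> ?S) (SH_ring k n)" by (rule add_ideals[OF ids(1,2)])
  have zero: "0 \<in> J" if "ideal J (SH_ring k n)" for J
    using additive_subgroup.zero_closed[OF ideal.axioms(1)[OF that]] by (simp add: SH_ring_simps)
  have left: "J \<subseteq> J <+>\<^bsub>SH_ring k n\<^esub> J'" and right: "J' \<subseteq> J <+>\<^bsub>SH_ring k n\<^esub> J'"
    if "ideal J (SH_ring k n)" "ideal J' (SH_ring k n)" for J J'
    using zero[OF that(1)] zero[OF that(2)]
    by (auto simp: set_add_def' SH_ring_simps(3))
  show ?thesis
  proof (rule relation_ideal.intro)
    show "ideal (relations k n r) (SH_ring k n)"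
      unfolding relations_def by (rule add_ideals[OF AS ids(3)])
    show "pluecker_ideal b k n \<subseteq> relations k n r" if "b \<in> {Angle, Square}" for b
      using that left[OF AS ids(3)] left[OF ids(1,2)] right[OF ids(1,2)]
        genideal_self[OF car(1)] genideal_self[OF car(2)]
      unfolding relations_def by auto
    show "PQT_entries k n r \<subseteq> relations k n r"
      using right[OF AS ids(3)] genideal_self[OF car(3)] unfolding relations_def by auto
  qed
qed

lemma relations_subset_SH_ideal:
  assumes "r \<le> k"
  shows "relations k n r \<subseteq> SH_ideal k n r"
proof -
  interpret cring "SH_ring k n" by (rule cring_SH_ring)
  note id = SH_ideal_is_ideal[of k n r]
  have pl: "eval_cpoly x f = 0"
    if "f \<in> pluecker_ideal b k n" "V \<in> Gr k n" "x \<circ> b \<in> pluecker_line k n V" for x b V f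
    using that unfolding pluecker_ideal_def by blast
  have Gr: "V \<in> Gr k n" "W \<in> Gr k n" if "(V, W) \<in> SH k n r" for V W
    using that by (simp_all add: SH_def)
  have "pluecker_ideal Angle k n \<subseteq> SH_ideal k n r"
    using pluecker_ideal_carrier[of Angle k n] by (intro subsetI SH_idealI) (auto intro: pl Gr)
  then have 1: "genideal (SH_ring k n) (pluecker_ideal Angle k n) \<subseteq> SH_ideal k n r"
    by (rule genideal_minimal[OF id])
  have "pluecker_ideal Square k n \<subseteq> SH_ideal k n r"
    using pluecker_ideal_carrier[of Square k n] by (intro subsetI SH_idealI) (auto intro: pl Gr)
  then have 2: "genideal (SH_ring k n) (pluecker_ideal Square k n) \<subseteq> SH_ideal k n r"
    by (rule genideal_minimal[OF id])
  have "PQT_entries k n r \<subseteq> SH_ideal k n r"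
    unfolding PQT_entries_def using PQT_carrier PQT_vanishes_on_SH[OF assms]
    by (auto intro!: SH_idealI)
  then have 3: "genideal (SH_ring k n) (PQT_entries k n r) \<subseteq> SH_ideal k n r"
    by (rule genideal_minimal[OF id])
  have "f + g \<in> SH_ideal k n r" if "f \<in> SH_ideal k n r" "g \<in> SH_ideal k n r" for f g
    using additive_subgroup.a_closed[OF ideal.axioms(1)[OF id] that] by (simp add: SH_ring_simps(3))
  then have sum: "J <+>\<^bsub>SH_ring k n\<^esub> J' \<subseteq> SH_ideal k n r"
    if "J \<subseteq> SH_ideal k n r" "J' \<subseteq> SH_ideal k n r" for J J'
    using that by (auto simp: set_add_def' SH_ring_simps(3))
  show ?thesis unfolding relations_def by (intro sum 1 2 3)
qed

section \<open>Test points on the variety\<close>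

text \<open>Jacobi's theorem on complementary minors, with the chosen rows and columns moved to the front
  by permutations.\<close>

lemma complementary_minors:
  fixes g h :: "nat \<Rightarrow> nat \<Rightarrow> 'a::idom"
  assumes kn: "k \<le> n" and p: "p permutes {..<n}" and q: "q permutes {..<n}"
    and inv: "\<And>i j. i < n \<Longrightarrow> j < n \<Longrightarrow> (\<Sum>l<n. g i l * h l j) = (if i = j then 1 else 0)"
  shows "det (mat k k (\<lambda>(i, j). h (p i) (q j))) * det (mat n n (\<lambda>(i, j). g i j))
    = of_int (sign p * sign q) * det (mat (n - k) (n - k) (\<lambda>(i, j). g (q (k + i)) (p (k + j))))"
proof -
  let ?g = "mat n n (\<lambda>(i, j). g i j)" and ?g' = "mat n n (\<lambda>(i, j). g (q i) (p j))"
  have pn: "p i < n" "q i < n" if "i < n" for i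
    using permutes_in_image[OF p, of i] permutes_in_image[OF q, of i] that by simp_all
  define e where "e = (of_int (sign p * sign q) :: 'a)"
  have ee: "e * e = 1" by (simp add: e_def sign_def)
  have dg: "det ?g' = e * det ?g"
  proof -
    let ?m = "mat n n (\<lambda>(i, j). g i (p j))"
    have 1: "?g' = mat n n (\<lambda>(i, j). ?m $$ (q i, j))" using pn by (intro eq_matI) auto
    have 2: "transpose_mat ?m = mat n n (\<lambda>(i, j). transpose_mat ?g $$ (p i, j))"
      using pn by (intro eq_matI) auto
    have "det ?g' = of_int (sign q) * det ?m"
      unfolding 1 using q by (intro det_permute_rows) (simp_all add: lessThan_atLeast0)
    also have "det ?m = det (transpose_mat ?m)" by (simp add: det_transpose[of _ n])
    also have "\<dots> = of_int (sign p) * det (transpose_mat ?g)"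
      unfolding 2 using p by (intro det_permute_rows) (simp_all add: lessThan_atLeast0)
    also have "det (transpose_mat ?g) = det ?g" by (simp add: det_transpose[of _ n])
    finally show ?thesis by (simp add: e_def mult_ac)
  qed
  define H1 where "H1 = mat k k (\<lambda>(i, j). h (p i) (q j))"
  define H3 where "H3 = mat (n - k) k (\<lambda>(i, j). h (p (k + i)) (q j))"
  define G2 where "G2 = mat k (n - k) (\<lambda>(i, j). g (q i) (p (k + j)))"
  define G4 where "G4 = mat (n - k) (n - k) (\<lambda>(i, j). g (q (k + i)) (p (k + j)))"
  \<comment> \<open>the permuted inverse with its last \<open>n - k\<close> columns replaced by unit vectors\<close>
  define N where "N = four_block_mat H1 (0\<^sub>m k (n - k)) H3 (1\<^sub>m (n - k))"
  have N: "N \<in> carrier_mat n n"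
    using kn four_block_carrier_mat[of H1 k k "1\<^sub>m (n - k)" "n - k" "n - k"] by (simp add: N_def H1_def)
  have Nij: "N $$ (l, j) = (if j < k then h (p l) (q j) else if l = j then 1 else 0)" if "l < n" "j < n" for l j
    using that kn by (auto simp: N_def H1_def H3_def)
  have "?g' * N = four_block_mat (1\<^sub>m k) G2 (0\<^sub>m (n - k) k) G4"
  proof (rule eq_matI)
    fix i j assume "i < dim_row (four_block_mat (1\<^sub>m k) G2 (0\<^sub>m (n - k) k) G4)"
      "j < dim_col (four_block_mat (1\<^sub>m k) G2 (0\<^sub>m (n - k) k) G4)"
    then have ij: "i < n" "j < n" using kn by (simp_all add: G4_def)
    have "(?g' * N) $$ (i, j) = (\<Sum>l<n. g (q i) (p l) * N $$ (l, j))"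
      using ij N by (simp add: scalar_prod_def lessThan_atLeast0)
    also have "\<dots> = (if j < k then if i = j then 1 else 0 else g (q i) (p j))"
    proof (cases "j < k")
      case True
      have "(\<Sum>l<n. g (q i) (p l) * N $$ (l, j)) = (\<Sum>l<n. g (q i) (p l) * h (p l) (q j))"
        using True ij by (intro sum.cong) (simp_all add: Nij)
      also have "\<dots> = (\<Sum>l<n. g (q i) l * h l (q j))"
        using sum.permute[OF p, of "\<lambda>l. g (q i) l * h l (q j)"] by (simp add: o_def)
      also have "\<dots> = (if i = j then 1 else 0)"
        using inv[of "q i" "q j"] pn ij permutes_inj[OF q] by (simp add: inj_eq)
      finally show ?thesis using True by simp
    next
      case False
      have "(\<Sum>l<n. g (q i) (p l) * N $$ (l, j)) = (\<Sum>l<n. if l = j then g (q i) (p l) else 0)"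
        using False ij by (intro sum.cong) (simp_all add: Nij)
      then show ?thesis using False ij by simp
    qed
    also have "\<dots> = four_block_mat (1\<^sub>m k) G2 (0\<^sub>m (n - k) k) G4 $$ (i, j)"
      using ij kn by (auto simp: G2_def G4_def)
    finally show "(?g' * N) $$ (i, j) = four_block_mat (1\<^sub>m k) G2 (0\<^sub>m (n - k) k) G4 $$ (i, j)" .
  qed (use N kn in \<open>simp_all add: G4_def\<close>)
  then have "det ?g' * det N = det (four_block_mat (1\<^sub>m k) G2 (0\<^sub>m (n - k) k) G4)"
    using det_mult[of ?g' n N] N by simp
  also have "\<dots> = det G4"
    by (subst det_four_block_mat_lower_left_zero[of _ k _ "n - k"]) (auto simp: G2_def G4_def)
  also have "det N = det H1"
    unfolding N_def by (subst det_four_block_mat_upper_right_zero[of _ k _ "n - k"]) (auto simp: H1_def H3_def)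
  finally have main: "det ?g' * det H1 = det G4" .
  have "e * det G4 = (e * e) * (det H1 * det ?g)"
    unfolding main[symmetric] dg by (simp only: mult_ac)
  then have "det H1 * det ?g = e * det G4" by (simp only: ee mult_1_left)
  then show ?thesis unfolding H1_def G4_def e_def .
qed

text \<open>The permutation that moves the rows or columns in \<open>I\<close> to the front, for use with
  \<open>complementary_minors\<close>.\<close>

definition front_perm :: "nat \<Rightarrow> nat \<Rightarrow> nat set \<Rightarrow> nat \<Rightarrow> nat" where
  "front_perm n k I i = (if i < k then sorted_list_of_set I ! i
     else if i < n then sorted_list_of_set ({..<n} - I) ! (i - k) else i)"

lemma front_perm_permutes:
  assumes I: "I \<in> subsets n k"
  shows "front_perm n k I permutes {..<n}"
proof (rule inj_imp_permutes)
  note I' = subsetsD[OF I]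
  let ?L = "sorted_list_of_set I" and ?C = "sorted_list_of_set ({..<n} - I)"
  have kn: "k \<le> n" using card_mono[of "{..<n}" I] I' by simp
  have len: "length ?L = k" "length ?C = n - k"
    using I' card_Diff_subset[of I "{..<n}"] by simp_all
  have eq: "front_perm n k I i = (?L @ ?C) ! i" if "i < n" for i
    using that len by (simp add: front_perm_def nth_append)
  have dist: "distinct (?L @ ?C)" using I' by simp
  show "inj_on (front_perm n k I) {..<n}"
    using inj_on_nth[OF dist, of "{..<n}"] len kn eq by (simp add: inj_on_def)
  show "front_perm n k I i \<in> {..<n}" if "i \<in> {..<n}" for i
    using that nth_mem[of i "?L @ ?C"] len kn I' eq[of i] by auto
  show "front_perm n k I i = i" if "i \<notin> {..<n}" for i
    using that kn by (simp add: front_perm_def)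
qed simp

text \<open>The rows \<open>r, \<dots>, r + n - k - 1\<close> of an invertible matrix span \<open>W\<^sup>\<bottom>\<close> if \<open>W\<close> is spanned by
  the remaining columns of its inverse.\<close>

definition outer_rows :: "nat \<Rightarrow> nat \<Rightarrow> nat \<Rightarrow> nat set" where
  "outer_rows n k r = {..<r} \<union> {r + (n - k)..<n}"

definition complement_sign :: "nat \<Rightarrow> nat \<Rightarrow> nat \<Rightarrow> nat set \<Rightarrow> int" where
  "complement_sign n k r K = sign (front_perm n k K) * sign (front_perm n k (outer_rows n k r))"

lemma outer_rows:
  assumes "r \<le> k" "k \<le> n"
  shows "outer_rows n k r \<in> subsets n k" "{..<n} - outer_rows n k r = {r..<r + (n - k)}"
proof -
  have "card (outer_rows n k r) = card {..<r} + card {r + (n - k)..<n}"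
    unfolding outer_rows_def by (rule card_Un_disjoint) auto
  then show "outer_rows n k r \<in> subsets n k" using assms by (auto simp: subsets_def outer_rows_def)
  show "{..<n} - outer_rows n k r = {r..<r + (n - k)}" using assms by (auto simp: outer_rows_def)
qed

lemma nonzero_det_inverse:
  fixes G :: "nat \<Rightarrow> nat \<Rightarrow> 'a::field"
  assumes "det (mat n n (\<lambda>(i, j). G i j)) \<noteq> 0"
  obtains h where "\<And>i j. i < n \<Longrightarrow> j < n \<Longrightarrow> (\<Sum>l<n. G i l * h l j) = (if i = j then 1 else 0)"
proof -
  let ?G = "mat n n (\<lambda>(i, j). G i j)"
  have "?G \<in> Units (ring_mat TYPE('a) n ())" by (rule det_non_zero_imp_unit) (use assms in auto)
  then obtain H where H: "H \<in> carrier_mat n n" "?G * H = 1\<^sub>m n"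
    by (auto simp: Units_def ring_mat_def)
  have "(\<Sum>l<n. G i l * H $$ (l, j)) = (if i = j then 1 else 0)" if "i < n" "j < n" for i j
  proof -
    have "(?G * H) $$ (i, j) = (\<Sum>l<n. G i l * H $$ (l, j))"
      using that H(1) by (simp add: scalar_prod_def lessThan_atLeast0)
    then show ?thesis unfolding H(2) using that by simp
  qed
  then show thesis by (rule that)
qed

text \<open>\<open>V\<close> is spanned by the first \<open>k\<close> rows of \<open>G\<close> and \<open>W\<close> by the columns of the inverse with indices in
  \<open>outer_rows n k r\<close>. The rows \<open>r, \<dots>, k - 1\<close> of \<open>G\<close> lie in \<open>W\<^sup>\<bottom>\<close>, because \<open>2 * k \<le> r + n\<close> keeps them
  apart from the outer rows.\<close>

lemma SH_point:
  fixes G :: "nat \<Rightarrow> nat \<Rightarrow> complex" and x :: "bracket_var \<Rightarrow> complex"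
  assumes rk: "r \<le> k" and kn: "2 * k \<le> r + n" and det: "det (mat n n (\<lambda>(i, j). G i j)) \<noteq> 0"
    and xA: "\<And>I. I \<in> subsets n k \<Longrightarrow> x (Angle I) = c * minor G (sorted_list_of_set I)"
    and xS: "\<And>K. K \<in> subsets n k \<Longrightarrow> x (Square K) = d * of_int (complement_sign n k r K) *
      minor (\<lambda>a. G (r + a)) (sorted_list_of_set ({..<n} - K))"
  shows "\<exists>V W. (V, W) \<in> SH k n r \<and> x \<circ> Angle \<in> pluecker_line k n V \<and> x \<circ> Square \<in> pluecker_line k n W"
proof -
  interpret vec_space "TYPE(complex)" n .
  have kn': "k \<le> n" using rk kn by simp
  obtain h where inv: "\<And>i j. i < n \<Longrightarrow> j < n \<Longrightarrow> (\<Sum>l<n. G i l * h l j) = (if i = j then 1 else 0)"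
    using nonzero_det_inverse[OF det] by blast
  define q where "q = front_perm n k (outer_rows n k r)"
  note outer = outer_rows[OF rk kn']
  have q: "q permutes {..<n}" unfolding q_def by (rule front_perm_permutes[OF outer(1)])
  have qn: "q i < n" if "i < n" for i using permutes_in_image[OF q, of i] that by simp
  have q_front: "q t \<in> outer_rows n k r" if "t < k" for t
    using nth_mem[of t "sorted_list_of_set (outer_rows n k r)"] subsetsD[OF outer(1)] that
    by (simp add: q_def front_perm_def)
  have q_back: "q (k + i) = r + i" if "i < n - k" for i
  proof -
    have "k + i < n" using that by simp
    then show ?thesis using that by (simp add: q_def front_perm_def outer(2))
  qed
  define A where "A = mat k n (\<lambda>(i, j). G i j)"
  define B where "B = mat k n (\<lambda>(i, j). h j (q i))"
  have car: "A \<in> carrier_mat k n" "B \<in> carrier_mat k n" by (simp_all add: A_def B_def)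
  have invA: "A * mat n k (\<lambda>(i, j). h i j) = 1\<^sub>m k"
    using kn' inv by (intro eq_matI) (auto simp: A_def scalar_prod_def lessThan_atLeast0[symmetric])
  have invB: "B * mat n k (\<lambda>(i, j). G (q j) i) = 1\<^sub>m k"
  proof (rule eq_matI)
    fix i j assume "i < dim_row (1\<^sub>m k)" "j < dim_col (1\<^sub>m k)"
    then have ij: "i < k" "j < k" by simp_all
    have "(B * mat n k (\<lambda>(i, j). G (q j) i)) $$ (i, j) = (\<Sum>l<n. G (q j) l * h l (q i))"
      using ij by (simp add: B_def scalar_prod_def lessThan_atLeast0[symmetric] mult.commute)
    also have "\<dots> = (if q j = q i then 1 else 0)" using ij kn' qn by (intro inv) auto
    also have "\<dots> = 1\<^sub>m k $$ (i, j)" using ij permutes_inj[OF q] by (auto simp: inj_eq)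
    finally show "(B * mat n k (\<lambda>(i, j). G (q j) i)) $$ (i, j) = 1\<^sub>m k $$ (i, j)" .
  qed (simp_all add: B_def)
  let ?V = "row_space A" and ?W = "row_space B"
  have Gr: "?V \<in> Gr k n" "?W \<in> Gr k n"
    using row_space_full_rank[OF car(1) _ invA] row_space_full_rank[OF car(2) _ invB] by (simp_all add: Gr_def)
  have rowsA: "set (rows A) \<subseteq> carrier_vec n" and rowsB: "set (rows B) \<subseteq> carrier_vec n"
    using rows_carrier[of A] rows_carrier[of B] car by auto
  define S where "S = (\<lambda>i. row A i) ` {r..<k}"
  note li = rows_lin_indpt[OF car(1) _ invA]
  have Srows: "S \<subseteq> set (rows A)" using car by (auto simp: S_def rows_def)
  have "inj_on (row A) {r..<k}"
    using li(1) car by (auto simp: inj_on_def rows_def distinct_map)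
  then have cardS: "card S = k - r" by (simp add: S_def card_image)
  have liS: "lin_indpt S" using li(2) Srows subset_li_is_li by auto
  have orth: "row A a \<bullet> w = 0" if a: "a \<in> {r..<k}" and w: "w \<in> set (rows B)" for a w
  proof -
    obtain t where t: "t < k" "w = row B t" using w car by (auto simp: rows_def)
    have "row A a \<bullet> w = (\<Sum>l<n. G a l * h l (q t))"
      using a t by (simp add: A_def B_def scalar_prod_def lessThan_atLeast0[symmetric])
    also have "\<dots> = (if a = q t then 1 else 0)" using a t kn' qn by (intro inv) auto
    also have "\<dots> = 0" using q_front[OF t(1)] a kn rk by (auto simp: outer_rows_def)
    finally show ?thesis .
  qed
  have "?W \<subseteq> carrier_vec n" unfolding row_space_def using span_is_subset2 rowsB by simp
  from subspace_Int_orthogonal_complement[OF _ this, of ?V] Gr(1)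
  have sub: "VectorSpace.subspace class_ring (?V \<inter> orthogonal_complement ?W) V" by (simp add: Gr_def)
  have "S \<subseteq> ?V" using Srows in_own_span[of "set (rows A)"] rowsA by (auto simp: row_space_def)
  moreover have "S \<subseteq> orthogonal_complement ?W"
    unfolding row_space_def in_orthogonal_complement_span[OF rowsB]
    using orth car by (auto simp: S_def orthogonal_complement_def)
  ultimately have "k - r \<le> vectorspace.dim class_ring (vs (?V \<inter> orthogonal_complement ?W))"
    using card_le_subspace_dim[OF fin_dim sub _ liS] cardS by simp
  then have "(?V, ?W) \<in> SH k n r" using Gr by (simp add: SH_def)
  moreover have "x \<circ> Angle \<in> pluecker_line k n ?V"
  proof -
    have "det (submatrix A UNIV I) = minor G (sorted_list_of_set I)" if I: "I \<in> subsets n k" for I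
    proof -
      have "minor (\<lambda>i j. A $$ (i, j)) (sorted_list_of_set I) = minor G (sorted_list_of_set I)"
        unfolding minor_def
      proof (rule arg_cong[of _ _ det], rule cong_mat)
        fix i j assume "i < length (sorted_list_of_set I)" "j < length (sorted_list_of_set I)"
        then show "(case (i, j) of (j, i) \<Rightarrow> A $$ (i, sorted_list_of_set I ! j))
            = (case (i, j) of (j, i) \<Rightarrow> G i (sorted_list_of_set I ! j))"
          using nth_mem[of i "sorted_list_of_set I"] subsetsD[OF I] by (auto simp: A_def)
      qed simp_all
      then show ?thesis using det_submatrix_eq_minor[OF car(1) I] by simp
    qed
    then show ?thesis using xA car(1) unfolding pluecker_line_def by auto
  qed
  moreover have "x \<circ> Square \<in> pluecker_line k n ?W"
  proof -
    have "x (Square K) = (d * det (mat n n (\<lambda>(i, j). G i j))) * det (submatrix B UNIV K)"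
      if K: "K \<in> subsets n k" for K
    proof -
      note K' = subsetsD[OF K]
      define p where "p = front_perm n k K"
      let ?C = "sorted_list_of_set ({..<n} - K)"
      have p: "p permutes {..<n}" unfolding p_def by (rule front_perm_permutes[OF K])
      have len: "length ?C = n - k" using K' card_Diff_subset[of K "{..<n}"] by simp
      have "minor (\<lambda>i j. B $$ (i, j)) (sorted_list_of_set K) = det (mat k k (\<lambda>(i, j). h (p i) (q j)))"
        unfolding minor_def
      proof (rule arg_cong[of _ _ det], rule cong_mat)
        fix i j assume "i < length (sorted_list_of_set K)" "j < length (sorted_list_of_set K)"
        then show "(case (i, j) of (j, i) \<Rightarrow> B $$ (i, sorted_list_of_set K ! j))
            = (case (i, j) of (i, j) \<Rightarrow> h (p i) (q j))"
          using nth_mem[of i "sorted_list_of_set K"] K' by (auto simp: B_def p_def front_perm_def)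
      qed (use K' in simp_all)
      moreover have "minor (\<lambda>a. G (r + a)) ?C
          = det (mat (n - k) (n - k) (\<lambda>(i, j). G (q (k + i)) (p (k + j))))"
      proof -
        have "transpose_mat (mat (n - k) (n - k) (\<lambda>(i, j). G (q (k + i)) (p (k + j))))
            = mat (length ?C) (length ?C) (\<lambda>(j, i). G (r + i) (?C ! j))"
          unfolding len by (rule eq_matI) (auto simp: q_back p_def front_perm_def)
        then show ?thesis
          using det_transpose[of "mat (n - k) (n - k) (\<lambda>(i, j). G (q (k + i)) (p (k + j)))" "n - k"]
          by (simp add: minor_def)
      qed
      ultimately have "minor (\<lambda>i j. B $$ (i, j)) (sorted_list_of_set K) * det (mat n n (\<lambda>(i, j). G i j))
          = of_int (complement_sign n k r K) * minor (\<lambda>a. G (r + a)) ?C"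
        using complementary_minors[OF kn' p q inv] by (simp add: complement_sign_def p_def q_def)
      then show ?thesis using xS[OF K] det_submatrix_eq_minor[OF car(2) K] by (simp add: mult_ac)
    qed
    then show ?thesis using car(2) unfolding pluecker_line_def by auto
  qed
  ultimately show ?thesis by blast
qed

section \<open>Leading terms at the test points\<close>

text \<open>The exponents decrease along rows and, faster, from one row to the next.\<close>

definition position :: "nat \<Rightarrow> nat \<Rightarrow> nat \<Rightarrow> nat" where
  "position n a i = (n - 1 - a) * n + (n - 1 - i)"

definition power_matrix :: "nat \<Rightarrow> nat \<Rightarrow> real \<Rightarrow> nat \<Rightarrow> nat \<Rightarrow> complex" where
  "power_matrix n B t a i = of_real t ^ (B ^ position n a i)"

lemma position_less_row:
  assumes "a < a'" "a' < n" "i' < n"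
  shows "position n a' i' < position n a i"
proof -
  define d where "d = a' - a - 1"
  have "n - 1 - a = Suc (n - 1 - a' + d)" using assms by (simp add: d_def)
  then have "position n a i = (n - 1 - a') * n + n + d * n + (n - 1 - i)"
    by (simp add: position_def add_mult_distrib)
  then show ?thesis using assms by (simp add: position_def)
qed

lemma position_less_col: "i < i' \<Longrightarrow> i' < n \<Longrightarrow> position n a i' < position n a i"
  by (simp add: position_def)

lemma position_less: "a < n \<Longrightarrow> i < n \<Longrightarrow> position n a i < n * n"
proof -
  assume a: "a < n" "i < n"
  have "position n a i < (n - 1 - a) * n + n" using a by (simp add: position_def)
  also have "\<dots> = Suc (n - 1 - a) * n" by simp
  also have "\<dots> \<le> n * n" using a by (intro mult_le_mono1) simp
  finally show ?thesis .
qed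

lemma position_inj:
  assumes "position n a i = position n a' i'" "a < n" "a' < n" "i < n" "i' < n"
  shows "a = a' \<and> i = i'"
proof -
  have "a = a'"
    using position_less_row[of a a' n i' i] position_less_row[of a' a n i i'] assms by (metis nat_neq_iff)
  moreover from this have "i = i'"
    using position_less_col[of i i' n a] position_less_col[of i' i n a] assms by (metis nat_neq_iff)
  ultimately show ?thesis ..
qed

text \<open>At the first index moved by \<open>p\<close>, the exponent of the diagonal product dominates all later
  exponents together.\<close>

lemma diagonal_exponent_greatest:
  assumes J: "sorted_wrt (<) J" "set J \<subseteq> {..<n}" "length J = s" and s: "a0 + s \<le> n" and B: "n < B"
    and p: "p permutes {..<s}" "p \<noteq> id"
  shows "(\<Sum>j<s. B ^ position n (a0 + p j) (J ! j)) < (\<Sum>j<s. B ^ position n (a0 + j) (J ! j))"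
proof -
  obtain j0 where "p j0 \<noteq> j0" using p(2) by (auto simp: fun_eq_iff)
  define j where "j = (LEAST j. p j \<noteq> j)"
  have pj: "p j \<noteq> j" unfolding j_def by (rule LeastI) fact
  have fix_below: "p i = i" if "i < j" for i using not_less_Least[of i "\<lambda>j. p j \<noteq> j"] that by (auto simp: j_def)
  have js: "j < s"
    using p(1) pj by (auto simp: permutes_def not_less[symmetric])
  have inj: "p a = p b \<longleftrightarrow> a = b" for a b using permutes_inj[OF p(1)] by (simp add: inj_eq)
  have ge: "j \<le> p i" if "j \<le> i" for i
  proof (rule ccontr)
    assume "\<not> j \<le> p i"
    then have "p (p i) = p i" using fix_below by simp
    then show False using that \<open>\<not> j \<le> p i\<close> by (simp add: inj)
  qed
  have Jn: "J ! i < n" if "i < s" for i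
  proof -
    have "J ! i \<in> set J" using that J(3) by simp
    then show ?thesis using J(2) by auto
  qed
  let ?E = "position n (a0 + j) (J ! j)"
  have small: "B ^ position n (a0 + p i) (J ! i) * B \<le> B ^ ?E" if i: "j \<le> i" "i < s" for i
  proof -
    have ps: "p i < s" using permutes_in_image[OF p(1), of i] i by simp
    have "position n (a0 + p i) (J ! i) < ?E"
    proof (cases "p i = j")
      case True
      then have "j < i" using i pj by (cases "i = j") auto
      then have "J ! j < J ! i" using sorted_wrt_nth_less[OF J(1)] i J(3) by simp
      then show ?thesis using True Jn[OF i(2)] by (simp add: position_less_col)
    next
      case False
      then have "j < p i" using ge[OF i(1)] by simp
      then show ?thesis using ps s Jn[OF i(2)] by (intro position_less_row) auto
    qed
    then have "Suc (position n (a0 + p i) (J ! i)) \<le> ?E" by simp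
    then have "B ^ Suc (position n (a0 + p i) (J ! i)) \<le> B ^ ?E" using B by (intro power_increasing) auto
    then show ?thesis by (simp add: mult.commute)
  qed
  have "(\<Sum>i\<in>{j..<s}. B ^ position n (a0 + p i) (J ! i)) * B \<le> (\<Sum>i\<in>{j..<s}. B ^ ?E)"
    unfolding sum_distrib_right using small by (intro sum_mono) auto
  also have "\<dots> = (s - j) * B ^ ?E" by simp
  also have "\<dots> \<le> n * B ^ ?E" using s by (intro mult_le_mono1) simp
  also have "\<dots> < B ^ ?E * B" using B by simp
  finally have "(\<Sum>i\<in>{j..<s}. B ^ position n (a0 + p i) (J ! i)) < B ^ ?E" by simp
  also have "\<dots> \<le> (\<Sum>i\<in>{j..<s}. B ^ position n (a0 + i) (J ! i))"
    using js by (intro member_le_sum[of j "{j..<s}" "\<lambda>i. B ^ position n (a0 + i) (J ! i)"]) auto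
  finally have late: "(\<Sum>i\<in>{j..<s}. B ^ position n (a0 + p i) (J ! i))
      < (\<Sum>i\<in>{j..<s}. B ^ position n (a0 + i) (J ! i))" .
  have split: "(\<Sum>i<s. f i) = (\<Sum>i<j. f i) + (\<Sum>i\<in>{j..<s}. f i)" for f :: "nat \<Rightarrow> nat"
    using sum.atLeastLessThan_concat[of 0 j s f] js by (simp add: lessThan_atLeast0)
  have "(\<Sum>i<j. B ^ position n (a0 + p i) (J ! i)) = (\<Sum>i<j. B ^ position n (a0 + i) (J ! i))"
    using fix_below by simp
  then show ?thesis unfolding split using late by simp
qed

lemma power_ratio_tendsto_0:
  assumes "e < E"
  shows "((\<lambda>t. (of_real t ^ e / of_real t ^ E :: complex)) \<longlongrightarrow> 0) at_top"
proof -
  have "((\<lambda>t::real. inverse t ^ (E - e)) \<longlongrightarrow> 0 ^ (E - e)) at_top"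
    by (intro tendsto_power tendsto_inverse_0_at_top filterlim_ident)
  moreover have "0 ^ (E - e) = (0 :: real)" using assms by simp
  ultimately have "((\<lambda>t::real. inverse t ^ (E - e)) \<longlongrightarrow> 0) at_top" by (simp only:)
  then have "((\<lambda>t. complex_of_real (inverse t ^ (E - e))) \<longlongrightarrow> of_real 0) at_top"
    by (rule tendsto_of_real)
  then have "((\<lambda>t. complex_of_real (inverse t ^ (E - e))) \<longlongrightarrow> 0) at_top"
    by (simp only: of_real_0)
  moreover have "\<forall>\<^sub>F t::real in at_top. complex_of_real (inverse t ^ (E - e)) = of_real t ^ e / of_real t ^ E"
  proof (rule eventually_mono[OF eventually_gt_at_top[of 0]])
    fix t :: real assume t: "0 < t"
    have "of_real t ^ E = (of_real t ^ e * of_real t ^ (E - e) :: complex)"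
      using assms by (simp flip: power_add)
    then show "complex_of_real (inverse t ^ (E - e)) = of_real t ^ e / of_real t ^ E"
      using t by (simp add: field_simps)
  qed
  ultimately show ?thesis by (rule Lim_transform_eventually)
qed

lemma minor_leading_term:
  assumes J: "sorted_wrt (<) J" "set J \<subseteq> {..<n}" and s: "a0 + length J \<le> n" and B: "n < B"
  shows "((\<lambda>t. minor (\<lambda>a. power_matrix n B t (a0 + a)) J /
      of_real t ^ (\<Sum>j<length J. B ^ position n (a0 + j) (J ! j))) \<longlongrightarrow> 1) at_top"
proof -
  let ?s = "length J"
  define e where "e = (\<lambda>p. \<Sum>j<?s. B ^ position n (a0 + p j) (J ! j))"
  let ?P = "{p. p permutes {..<?s}}"
  have fin: "finite ?P" by (simp add: finite_permutations)
  have "((\<lambda>t. of_int (sign p) * (of_real t ^ e p / of_real t ^ e id)) \<longlongrightarrow> (if p = id then 1 else 0 :: complex)) at_top"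
    if p: "p \<in> ?P" for p
  proof (cases "p = id")
    case True
    have "\<forall>\<^sub>F t::real in at_top. (1::complex) = of_int (sign p) * (of_real t ^ e p / of_real t ^ e id)"
      by (rule eventually_mono[OF eventually_gt_at_top[of 0]]) (simp add: True)
    from tendsto_cong[THEN iffD1, OF this tendsto_const] show ?thesis using True by simp
  next
    case False
    have "e p < e id"
      unfolding e_def using diagonal_exponent_greatest[OF J refl s B, of p] p False by simp
    then have "((\<lambda>t. of_int (sign p) * (of_real t ^ e p / of_real t ^ e id)) \<longlongrightarrow> of_int (sign p) * (0::complex)) at_top"
      by (intro tendsto_mult tendsto_const power_ratio_tendsto_0)
    then show ?thesis using False by simp
  qed
  then have "((\<lambda>t. \<Sum>p\<in>?P. of_int (sign p) * (of_real t ^ e p / of_real t ^ e id))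
      \<longlongrightarrow> (\<Sum>p\<in>?P. if p = id then 1 else 0 :: complex)) at_top"
    by (rule tendsto_sum)
  also have "(\<Sum>p\<in>?P. if p = id then 1 else 0 :: complex) = 1"
    using fin by (simp add: permutes_id sum.delta')
  also have "(\<lambda>t. \<Sum>p\<in>?P. of_int (sign p) * (of_real t ^ e p / of_real t ^ e id) :: complex)
      = (\<lambda>t. minor (\<lambda>a. power_matrix n B t (a0 + a)) J / of_real t ^ e id)"
    by (simp add: minor_expand power_matrix_def e_def power_sum sum_divide_distrib)
  finally show ?thesis by (simp add: e_def)
qed

section \<open>Independence of standard monomials\<close>

text \<open>The base-\<open>B\<close> digits of the exponent of the diagonal product of a bracket. The two top digits record
  the kind of the bracket; they come from scaling the two cones separately. Without them \<open>\<langle>I\<rangle>\<close> and the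
  bracket \<open>[K]\<close> with \<open>K = {..<n} - I\<close> would have the same exponent for \<open>r = 0\<close> and \<open>n = 2 * k\<close>.\<close>

fun positions :: "nat \<Rightarrow> nat \<Rightarrow> nat \<Rightarrow> bracket_var \<Rightarrow> nat set" where
  "positions n k r (Angle I) =
     insert (n * n) ((\<lambda>a. position n a (sorted_list_of_set I ! a)) ` {..<k})"
| "positions n k r (Square K) =
     insert (n * n + 1) ((\<lambda>a. position n (r + a) (sorted_list_of_set ({..<n} - K) ! a)) ` {..<n - k})"

definition lead_exponent :: "nat \<Rightarrow> nat \<Rightarrow> nat \<Rightarrow> nat \<Rightarrow> bracket_var \<Rightarrow> nat" where
  "lead_exponent n k r B v = (\<Sum>p\<in>positions n k r v. B ^ p)"

fun lead_sign :: "nat \<Rightarrow> nat \<Rightarrow> nat \<Rightarrow> bracket_var \<Rightarrow> complex" where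
  "lead_sign n k r (Angle I) = 1"
| "lead_sign n k r (Square K) = of_int (complement_sign n k r K)"

fun test_point :: "nat \<Rightarrow> nat \<Rightarrow> nat \<Rightarrow> nat \<Rightarrow> real \<Rightarrow> bracket_var \<Rightarrow> complex" where
  "test_point n k r B t (Angle I) =
     of_real t ^ (B ^ (n * n)) * minor (power_matrix n B t) (sorted_list_of_set I)"
| "test_point n k r B t (Square K) =
     of_real t ^ (B ^ (n * n + 1)) * of_int (complement_sign n k r K) *
     minor (\<lambda>a. power_matrix n B t (r + a)) (sorted_list_of_set ({..<n} - K))"

lemma test_point_leading_term:
  assumes rk: "r \<le> k" "k \<le> n" and B: "n < B" and v: "v \<in> bracket_vars k n"
  shows "((\<lambda>t. test_point n k r B t v / of_real t ^ lead_exponent n k r B v) \<longlongrightarrow> lead_sign n k r v) at_top"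
proof -
  have lead: "((\<lambda>t. of_real t ^ (B ^ q) * c * minor (\<lambda>a. power_matrix n B t (a0 + a)) J /
        of_real t ^ (\<Sum>p\<in>insert q ((\<lambda>a. position n (a0 + a) (J ! a)) ` {..<s}). B ^ p)) \<longlongrightarrow> c) at_top"
    if J: "sorted_wrt (<) J" "set J \<subseteq> {..<n}" "length J = s" "a0 + s \<le> n" and q: "n * n \<le> q" for q c a0 J s
  proof -
    have Jn: "J ! i < n" if "i < s" for i
    proof -
      have "J ! i \<in> set J" using that J(3) by simp
      then show ?thesis using J(2) by auto
    qed
    have inj: "inj_on (\<lambda>a. position n (a0 + a) (J ! a)) {..<s}"
    proof (rule inj_onI)
      fix a b assume ab: "a \<in> {..<s}" "b \<in> {..<s}"
        and eq: "position n (a0 + a) (J ! a) = position n (a0 + b) (J ! b)"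
      from position_inj[OF eq] ab J(4) Jn show "a = b" by auto
    qed
    have "q \<notin> (\<lambda>a. position n (a0 + a) (J ! a)) ` {..<s}"
    proof
      assume "q \<in> (\<lambda>a. position n (a0 + a) (J ! a)) ` {..<s}"
      then obtain a where "a < s" "q = position n (a0 + a) (J ! a)" by auto
      then show False using position_less[of "a0 + a" n "J ! a"] J(4) Jn[of a] q by simp
    qed
    then have e: "(\<Sum>p\<in>insert q ((\<lambda>a. position n (a0 + a) (J ! a)) ` {..<s}). B ^ p)
        = B ^ q + (\<Sum>j<s. B ^ position n (a0 + j) (J ! j))"
      by (simp add: sum.reindex[OF inj])
    have "((\<lambda>t. c * (minor (\<lambda>a. power_matrix n B t (a0 + a)) J /
        of_real t ^ (\<Sum>j<length J. B ^ position n (a0 + j) (J ! j)))) \<longlongrightarrow> c) at_top"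
      using tendsto_mult[OF tendsto_const minor_leading_term[of J n a0 B], of c] J B by simp
    moreover have "\<forall>\<^sub>F t::real in at_top. c * (minor (\<lambda>a. power_matrix n B t (a0 + a)) J /
        of_real t ^ (\<Sum>j<length J. B ^ position n (a0 + j) (J ! j)))
      = of_real t ^ (B ^ q) * c * minor (\<lambda>a. power_matrix n B t (a0 + a)) J /
        of_real t ^ (B ^ q + (\<Sum>j<s. B ^ position n (a0 + j) (J ! j)))"
      by (rule eventually_mono[OF eventually_gt_at_top[of 0]]) (simp add: J(3) power_add)
    ultimately show ?thesis unfolding e by (rule Lim_transform_eventually)
  qed
  show ?thesis
  proof (cases v)
    case (Angle I)
    then have I: "I \<in> subsets n k" using v by (auto simp: bracket_vars_def)
    show ?thesis
      using lead[of "sorted_list_of_set I" k 0 "n * n" 1] subsetsD[OF I] rk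
      by (simp add: Angle lead_exponent_def)
  next
    case (Square K)
    then have K: "K \<in> subsets n k" using v by (auto simp: bracket_vars_def)
    have "card ({..<n} - K) = n - k" using subsetsD[OF K] card_Diff_subset[of K "{..<n}"] by simp
    then show ?thesis
      using lead[of "sorted_list_of_set ({..<n} - K)" "n - k" r "n * n + 1" "of_int (complement_sign n k r K)"] rk
      by (simp add: Square lead_exponent_def del: sum.insert)
  qed
qed

text \<open>The determinant of the power matrix is itself a minor with a leading term, so it is eventually
  nonzero.\<close>

lemma eventually_test_point_on_SH:
  assumes rk: "r \<le> k" and kn: "2 * k \<le> r + n" and B: "n < B"
  shows "\<forall>\<^sub>F t in at_top. \<exists>V W. (V, W) \<in> SH k n r \<and>
    test_point n k r B t \<circ> Angle \<in> pluecker_line k n V \<and> test_point n k r B t \<circ> Square \<in> pluecker_line k n W"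
proof -
  let ?E = "\<Sum>j<n. B ^ position n j j"
  have "((\<lambda>t. minor (power_matrix n B t) [0..<n] / of_real t ^ ?E) \<longlongrightarrow> 1) at_top"
    using minor_leading_term[of "[0..<n]" n 0 B] B by (simp add: lessThan_atLeast0)
  then have "\<forall>\<^sub>F t in at_top. minor (power_matrix n B t) [0..<n] / of_real t ^ ?E \<noteq> 0"
    by (rule tendsto_imp_eventually_ne) simp
  then show ?thesis
  proof (rule eventually_mono)
    fix t assume "minor (power_matrix n B t) [0..<n] / of_real t ^ ?E \<noteq> 0"
    then have ne: "minor (power_matrix n B t) [0..<n] \<noteq> 0" by auto
    have "minor (power_matrix n B t) [0..<n] = det (transpose_mat (mat n n (\<lambda>(i, j). power_matrix n B t i j)))"
      unfolding minor_def by (rule arg_cong[of _ _ det]) (auto intro!: eq_matI)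
    then have "det (mat n n (\<lambda>(i, j). power_matrix n B t i j)) \<noteq> 0"
      using ne by (simp add: det_transpose[of _ n])
    then show "\<exists>V W. (V, W) \<in> SH k n r \<and>
      test_point n k r B t \<circ> Angle \<in> pluecker_line k n V \<and> test_point n k r B t \<circ> Square \<in> pluecker_line k n W"
      using rk kn by (intro SH_point[of r k n "power_matrix n B t" _ "of_real t ^ (B ^ (n * n))"
            "of_real t ^ (B ^ (n * n + 1))"]) simp_all
  qed
qed

text \<open>After division by the largest power of \<open>t\<close> only the monomial with the largest exponent survives in
  the limit.\<close>

lemma distinct_leading_terms_independent:
  fixes x :: "real \<Rightarrow> 'v \<Rightarrow> complex"
  assumes lead: "\<And>m v. m \<in> keys f \<Longrightarrow> v \<in> keys m \<Longrightarrow>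
      ((\<lambda>t. x t v / of_real t ^ w v) \<longlongrightarrow> c v) at_top \<and> c v \<noteq> 0"
    and inj: "inj_on (weight w) (keys f)"
    and zero: "\<forall>\<^sub>F t in at_top. eval_cpoly (x t) f = 0"
  shows "f = 0"
proof (rule ccontr)
  assume "f \<noteq> 0"
  let ?K = "keys f"
  have ne: "?K \<noteq> {}" using \<open>f \<noteq> 0\<close> by simp
  define M where "M = Max (weight w ` ?K)"
  have "M \<in> weight w ` ?K" unfolding M_def using ne by (intro Max_in) auto
  then obtain m0 where m0: "m0 \<in> ?K" "weight w m0 = M" by blast
  have M: "weight w m \<le> M" if "m \<in> ?K" for m unfolding M_def using that by (intro Max_ge) auto
  have mono: "((\<lambda>t. monomial_value (x t) m / of_real t ^ weight w m) \<longlongrightarrow> monomial_value c m) at_top"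
    if m: "m \<in> ?K" for m
  proof -
    have "((\<lambda>t. \<Prod>v\<in>keys m. (x t v / of_real t ^ w v) ^ lookup m v)
        \<longlongrightarrow> (\<Prod>v\<in>keys m. c v ^ lookup m v)) at_top"
      using lead[OF m] by (intro tendsto_prod tendsto_power) auto
    moreover have "(\<Prod>v\<in>keys m. (x t v / of_real t ^ w v) ^ lookup m v)
        = monomial_value (x t) m / of_real t ^ weight w m" for t
      by (simp add: monomial_value_def weight_def power_sum power_divide prod_dividef
          mult.commute flip: power_mult)
    ultimately show ?thesis by (simp add: monomial_value_def)
  qed
  have c0: "monomial_value c m0 \<noteq> 0" unfolding monomial_value_def using lead[OF m0(1)] by auto
  have "((\<lambda>t. \<Sum>m\<in>?K. lookup f m * (monomial_value (x t) m / of_real t ^ M))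
      \<longlongrightarrow> (\<Sum>m\<in>?K. if m = m0 then lookup f m0 * monomial_value c m0 else 0)) at_top"
  proof (rule tendsto_sum)
    fix m assume m: "m \<in> ?K"
    show "((\<lambda>t. lookup f m * (monomial_value (x t) m / of_real t ^ M))
      \<longlongrightarrow> (if m = m0 then lookup f m0 * monomial_value c m0 else 0)) at_top"
    proof (cases "m = m0")
      case True
      then show ?thesis using tendsto_mult[OF tendsto_const mono[OF m0(1)]] m0(2) by simp
    next
      case False
      then have less: "weight w m < M"
        using M[OF m] inj m m0 by (metis inj_onD le_neq_implies_less)
      have "((\<lambda>t. lookup f m * ((monomial_value (x t) m / of_real t ^ weight w m) *
          (of_real t ^ weight w m / of_real t ^ M))) \<longlongrightarrow> lookup f m * (monomial_value c m * 0)) at_top"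
        by (intro tendsto_mult tendsto_const mono[OF m] power_ratio_tendsto_0[OF less])
      moreover have "\<forall>\<^sub>F t::real in at_top. lookup f m * ((monomial_value (x t) m / of_real t ^ weight w m) *
          (of_real t ^ weight w m / of_real t ^ M)) = lookup f m * (monomial_value (x t) m / of_real t ^ M)"
        by (rule eventually_mono[OF eventually_gt_at_top[of 0]]) simp
      ultimately have "((\<lambda>t. lookup f m * (monomial_value (x t) m / of_real t ^ M))
          \<longlongrightarrow> lookup f m * (monomial_value c m * 0)) at_top"
        by (rule Lim_transform_eventually)
      then show ?thesis using False by simp
    qed
  qed
  moreover have "(\<Sum>m\<in>?K. lookup f m * (monomial_value (x t) m / of_real t ^ M))
      = eval_cpoly (x t) f / of_real t ^ M" for t
    by (simp add: eval_cpoly_def monomial_value_def sum_divide_distrib)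
  ultimately have "((\<lambda>t. eval_cpoly (x t) f / of_real t ^ M) \<longlongrightarrow> lookup f m0 * monomial_value c m0) at_top"
    using m0(1) by simp
  moreover have "((\<lambda>t. eval_cpoly (x t) f / of_real t ^ M) \<longlongrightarrow> 0) at_top"
  proof -
    have "\<forall>\<^sub>F t in at_top. 0 = eval_cpoly (x t) f / of_real t ^ M"
      by (rule eventually_mono[OF zero]) simp
    from tendsto_cong[THEN iffD1, OF this tendsto_const] show ?thesis .
  qed
  ultimately have "lookup f m0 * monomial_value c m0 = 0"
    by (rule tendsto_unique[rotated]) simp
  then show False using c0 m0(1) by (simp add: in_keys_iff)
qed

lemma digits_unique:
  fixes f g :: "nat \<Rightarrow> nat"
  assumes "\<And>p. p < N \<Longrightarrow> f p < B" "\<And>p. p < N \<Longrightarrow> g p < B"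
    and "(\<Sum>p<N. f p * B ^ p) = (\<Sum>p<N. g p * B ^ p)" "p < N"
  shows "f p = g p"
  using assms
proof (induction N arbitrary: f g p)
  case (Suc N)
  have split: "(\<Sum>p<Suc N. h p * B ^ p) = h 0 + B * (\<Sum>p<N. h (Suc p) * B ^ p)" for h
    by (simp add: sum.lessThan_Suc_shift sum_distrib_left mult_ac del: sum.lessThan_Suc)
  have eq: "f 0 + B * (\<Sum>p<N. f (Suc p) * B ^ p) = g 0 + B * (\<Sum>p<N. g (Suc p) * B ^ p)"
    using Suc.prems(3) unfolding split .
  have lt: "f 0 < B" "g 0 < B" using Suc.prems(1,2) by auto
  have "(f 0 + B * (\<Sum>p<N. f (Suc p) * B ^ p)) mod B = f 0"
    "(g 0 + B * (\<Sum>p<N. g (Suc p) * B ^ p)) mod B = g 0" using lt by simp_all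
  then have f0: "f 0 = g 0" using eq by metis
  then have "(\<Sum>p<N. f (Suc p) * B ^ p) = (\<Sum>p<N. g (Suc p) * B ^ p)" using eq lt by simp
  then have "f (Suc p) = g (Suc p)" if "p < N" for p
    using Suc.IH[of "\<lambda>p. f (Suc p)" "\<lambda>p. g (Suc p)" p] Suc.prems(1,2) that by simp
  then show ?case using f0 Suc.prems(4) by (cases p) auto
qed simp

text \<open>In a chain of functions the members lying above \<open>c i\<close> at a point form an up-set, and up-sets of a
  chain are nested. So the members lying above \<open>c i\<close> everywhere are those lying above it at the point
  where there are fewest, and they can be counted at that point alone.\<close>

lemma chain_upset_le:
  fixes \<mu> \<nu> :: "'i \<Rightarrow> nat" and c :: "'i \<Rightarrow> nat \<Rightarrow> nat"
  assumes X: "finite X" and T: "finite T" "T \<noteq> {}"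
    and chain: "\<And>i j. i \<in> X \<Longrightarrow> j \<in> X \<Longrightarrow> 0 < \<nu> i \<Longrightarrow> 0 < \<nu> j \<Longrightarrow>
      (\<forall>x\<in>T. c i x \<le> c j x) \<or> (\<forall>x\<in>T. c j x \<le> c i x)"
    and counts: "\<And>x. x \<in> T \<Longrightarrow> (\<Sum>j | j \<in> X \<and> c i x \<le> c j x. \<mu> j) = (\<Sum>j | j \<in> X \<and> c i x \<le> c j x. \<nu> j)"
  shows "(\<Sum>j | j \<in> X \<and> (\<forall>x\<in>T. c i x \<le> c j x). \<mu> j) \<le> (\<Sum>j | j \<in> X \<and> (\<forall>x\<in>T. c i x \<le> c j x). \<nu> j)"
proof -
  define D where "D = (\<lambda>x. {j \<in> X. 0 < \<nu> j \<and> c i x \<le> c j x})"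
  have finD: "finite (D x)" for x using X by (simp add: D_def)
  obtain x1 where x1: "x1 \<in> T" "\<And>x. x \<in> T \<Longrightarrow> card (D x1) \<le> card (D x)"
  proof -
    define M where "M = Min ((\<lambda>x. card (D x)) ` T)"
    have "M \<in> (\<lambda>x. card (D x)) ` T" unfolding M_def using T by (intro Min_in) auto
    moreover have "M \<le> card (D x)" if "x \<in> T" for x unfolding M_def using T that by (intro Min_le) auto
    ultimately show thesis using that by auto
  qed
  have least: "D x1 \<subseteq> D x" if x: "x \<in> T" for x
  proof (rule ccontr)
    assume "\<not> D x1 \<subseteq> D x"
    then obtain j where j: "j \<in> D x1" "j \<notin> D x" by blast
    have "D x \<subseteq> D x1"
    proof
      fix j' assume j': "j' \<in> D x"
      have "c j x < c j' x" using j j' by (auto simp: D_def)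
      then have "\<forall>x\<in>T. c j x \<le> c j' x" using chain[of j j'] j j' x by (auto simp: D_def)
      then show "j' \<in> D x1" using j j' x1(1) by (auto simp: D_def intro: order_trans)
    qed
    then have "D x \<subset> D x1" using j by blast
    then have "card (D x) < card (D x1)" by (rule psubset_card_mono[OF finD])
    then show False using x1(2)[OF x] by simp
  qed
  have "(\<Sum>j | j \<in> X \<and> (\<forall>x\<in>T. c i x \<le> c j x). \<mu> j) \<le> (\<Sum>j | j \<in> X \<and> c i x1 \<le> c j x1. \<mu> j)"
    using X x1(1) by (intro sum_mono2) auto
  also have "\<dots> = (\<Sum>j | j \<in> X \<and> c i x1 \<le> c j x1. \<nu> j)" by (rule counts[OF x1(1)])
  also have "\<dots> = (\<Sum>j\<in>D x1. \<nu> j)"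
    using X by (intro sum.mono_neutral_right) (auto simp: D_def)
  also have "\<dots> \<le> (\<Sum>j | j \<in> X \<and> (\<forall>x\<in>T. c i x \<le> c j x). \<nu> j)"
    using X least by (intro sum_mono2) (auto simp: D_def)
  finally show ?thesis .
qed

text \<open>Among the members with different multiplicities take one that is maximal for the pointwise order. All
  members strictly above it have equal multiplicities, and so have the up-sets it generates.\<close>

lemma chain_determined_by_counts:
  fixes \<mu> \<nu> :: "'i \<Rightarrow> nat" and c :: "'i \<Rightarrow> nat \<Rightarrow> nat"
  assumes X: "finite X" and T: "finite T" "T \<noteq> {}"
    and chain\<mu>: "\<And>i j. i \<in> X \<Longrightarrow> j \<in> X \<Longrightarrow> 0 < \<mu> i \<Longrightarrow> 0 < \<mu> j \<Longrightarrow>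
      (\<forall>x\<in>T. c i x \<le> c j x) \<or> (\<forall>x\<in>T. c j x \<le> c i x)"
    and chain\<nu>: "\<And>i j. i \<in> X \<Longrightarrow> j \<in> X \<Longrightarrow> 0 < \<nu> i \<Longrightarrow> 0 < \<nu> j \<Longrightarrow>
      (\<forall>x\<in>T. c i x \<le> c j x) \<or> (\<forall>x\<in>T. c j x \<le> c i x)"
    and inj: "\<And>i j. i \<in> X \<Longrightarrow> j \<in> X \<Longrightarrow> (\<And>x. x \<in> T \<Longrightarrow> c i x = c j x) \<Longrightarrow> i = j"
    and counts: "\<And>x s. x \<in> T \<Longrightarrow> (\<Sum>j | j \<in> X \<and> s \<le> c j x. \<mu> j) = (\<Sum>j | j \<in> X \<and> s \<le> c j x. \<nu> j)"
    and i: "i \<in> X"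
  shows "\<mu> i = \<nu> i"
proof (rule ccontr)
  assume neq: "\<mu> i \<noteq> \<nu> i"
  define E where "E = {i \<in> X. \<mu> i \<noteq> \<nu> i}"
  define h where "h = (\<lambda>i. \<Sum>x\<in>T. c i x)"
  have "finite (h ` E)" "h ` E \<noteq> {}" using X i neq by (auto simp: E_def)
  then have "Max (h ` E) \<in> h ` E" "\<And>j. j \<in> E \<Longrightarrow> h j \<le> Max (h ` E)" by (auto intro: Max_in)
  then obtain m where m: "m \<in> E" "\<And>j. j \<in> E \<Longrightarrow> h j \<le> h m" by auto
  define U where "U = {j \<in> X. \<forall>x\<in>T. c m x \<le> c j x}"
  have U: "finite U" "m \<in> U" using X m by (auto simp: U_def E_def)
  have "(\<Sum>j\<in>U. \<mu> j) = (\<Sum>j\<in>U. \<nu> j)"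
    unfolding U_def using counts
    by (intro antisym chain_upset_le[OF X T chain\<nu>] chain_upset_le[OF X T chain\<mu>]) auto
  moreover have "(\<Sum>j\<in>U - {m}. \<mu> j) = (\<Sum>j\<in>U - {m}. \<nu> j)"
  proof (rule sum.cong[OF refl])
    fix j assume j: "j \<in> U - {m}"
    then have jX: "j \<in> X" and le: "\<And>x. x \<in> T \<Longrightarrow> c m x \<le> c j x" by (auto simp: U_def)
    have "\<exists>x\<in>T. c m x \<noteq> c j x" using inj[of m j] j jX m by (auto simp: E_def)
    then obtain x where "x \<in> T" "c m x < c j x" using le by (auto simp: order.strict_iff_order)
    then have "h m < h j" unfolding h_def using T(1) le by (intro sum_strict_mono_ex1) auto
    then show "\<mu> j = \<nu> j" using m(2)[of j] jX by (auto simp: E_def)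
  qed
  ultimately have "\<mu> m = \<nu> m" using U by (simp add: sum.remove)
  then show False using m(1) by (simp add: E_def)
qed

lemma weight_bracket_vars:
  assumes "keys m \<subseteq> bracket_vars k n"
  shows "weight w m = (\<Sum>I\<in>subsets n k. lookup m (Angle I) * w (Angle I)) +
    (\<Sum>K\<in>subsets n k. lookup m (Square K) * w (Square K))"
proof -
  have fin: "finite (subsets n k)" by (simp add: subsets_def)
  have "weight w m = (\<Sum>v\<in>bracket_vars k n. lookup m v * w v)"
    using fin assms by (intro weight_superset) (simp_all add: bracket_vars_def)
  also have "\<dots> = (\<Sum>v\<in>Angle ` subsets n k. lookup m v * w v) +
      (\<Sum>v\<in>Square ` subsets n k. lookup m v * w v)"
    unfolding bracket_vars_def using fin by (intro sum.union_disjoint) auto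
  finally show ?thesis by (simp add: sum.reindex inj_on_def)
qed

lemma count_below_Suc:
  "count_below I (Suc x) = count_below I x + of_bool (x \<in> I)"
proof -
  have "I \<inter> {..<Suc x} = (if x \<in> I then insert x (I \<inter> {..<x}) else I \<inter> {..<x})"
    by (auto simp: less_Suc_eq)
  then show ?thesis by (auto simp: count_below_def)
qed

lemma count_below_inj:
  assumes "I \<subseteq> {..<n}" "J \<subseteq> {..<n}" "\<And>x. x \<le> n \<Longrightarrow> count_below I x = count_below J x"
  shows "I = J"
proof -
  have "x \<in> I \<longleftrightarrow> x \<in> J" if "x < n" for x
    using count_below_Suc[of I x] count_below_Suc[of J x] assms(3)[of x] assms(3)[of "Suc x"] that
    by (auto simp: of_bool_def split: if_splits)
  then show ?thesis using assms(1,2) by blast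
qed

lemma count_below_complement:
  assumes "x \<le> n"
  shows "count_below ({..<n} - K) x = x - count_below K x" "count_below K x \<le> x"
proof -
  have "({..<n} - K) \<inter> {..<x} = {..<x} - K \<inter> {..<x}" using assms by auto
  then show "count_below ({..<n} - K) x = x - count_below K x"
    by (simp add: count_below_def card_Diff_subset)
  show "count_below K x \<le> x" using card_mono[of "{..<x}" "K \<inter> {..<x}"] by (simp add: count_below_def)
qed

lemma count_below_le_card: "finite I \<Longrightarrow> count_below I x \<le> card I"
  unfolding count_below_def by (intro card_mono) auto

definition digit :: "nat \<Rightarrow> nat \<Rightarrow> nat \<Rightarrow> (bracket_var \<Rightarrow>\<^sub>0 nat) \<Rightarrow> nat \<Rightarrow> nat" where
  "digit n k r m p = weight (\<lambda>v. of_bool (p \<in> positions n k r v)) m"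

lemma positions_less:
  assumes "r \<le> k" "k \<le> n" "v \<in> bracket_vars k n"
  shows "positions n k r v \<subseteq> {..<n * n + 2}"
proof -
  have *: "position n (a0 + a) (sorted_list_of_set I ! a) < n * n + 2"
    if "I \<subseteq> {..<n}" "a < card I" "a0 + a < n" for I a a0
  proof -
    have "sorted_list_of_set I ! a \<in> I"
      using that nth_mem[of a "sorted_list_of_set I"] finite_subset[of I "{..<n}"] by simp
    then show ?thesis using that position_less[of "a0 + a" n "sorted_list_of_set I ! a"] by auto
  qed
  show ?thesis
  proof (cases v)
    case (Angle I)
    then have "I \<in> subsets n k" using assms by (auto simp: bracket_vars_def)
    then show ?thesis using Angle assms *[of I _ 0] subsetsD[of I n k] by auto
  next
    case (Square K)
    then have K: "K \<in> subsets n k" using assms by (auto simp: bracket_vars_def)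
    have "card ({..<n} - K) = n - k" using subsetsD[OF K] by (simp add: card_Diff_subset)
    then show ?thesis using Square assms *[of "{..<n} - K" _ r] by auto
  qed
qed

lemma weight_lead_exponent:
  assumes "r \<le> k" "k \<le> n" "keys m \<subseteq> bracket_vars k n"
  shows "weight (lead_exponent n k r B) m = (\<Sum>p<n * n + 2. digit n k r m p * B ^ p)"
proof -
  define N where "N = n * n + 2"
  have lead: "lead_exponent n k r B v = (\<Sum>p<N. of_bool (p \<in> positions n k r v) * B ^ p)"
    if v: "v \<in> keys m" for v
  proof -
    have "positions n k r v \<subseteq> {..<N}" unfolding N_def using positions_less assms v by blast
    then have "lead_exponent n k r B v = (\<Sum>p\<in>{..<N} \<inter> positions n k r v. B ^ p)"
      by (simp add: lead_exponent_def Int_absorb1)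
    also have "\<dots> = (\<Sum>p<N. of_bool (p \<in> positions n k r v) * B ^ p)"
      by (subst sum.inter_restrict, simp, rule sum.cong[OF refl], simp)
    finally show ?thesis .
  qed
  have "weight (lead_exponent n k r B) m = (\<Sum>v\<in>keys m. \<Sum>p<N.
      lookup m v * (of_bool (p \<in> positions n k r v) * B ^ p))"
    unfolding weight_def by (rule sum.cong[OF refl]) (simp only: lead sum_distrib_left)
  also have "\<dots> = (\<Sum>p<N. \<Sum>v\<in>keys m.
      lookup m v * (of_bool (p \<in> positions n k r v) * B ^ p))"
    by (rule sum.swap)
  finally have "weight (lead_exponent n k r B) m = (\<Sum>p<N. digit n k r m p * B ^ p)"
    by (simp only: digit_def weight_def sum_distrib_right mult.assoc)
  then show ?thesis by (simp only: N_def)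
qed

lemma digit_le_degree: "digit n k r m p \<le> weight (\<lambda>_. 1) m"
  unfolding digit_def weight_def by (intro sum_mono) auto

text \<open>The number of entries below \<open>x\<close> in row \<open>a\<close> of the tableau, in the columns of each kind. The column
  of a square bracket starts in row \<open>r\<close>.\<close>

definition angle_count :: "nat \<Rightarrow> nat \<Rightarrow> nat \<Rightarrow> nat \<Rightarrow> (bracket_var \<Rightarrow>\<^sub>0 nat) \<Rightarrow> nat" where
  "angle_count n k a x m = (\<Sum>I | I \<in> subsets n k \<and> a < count_below I x. lookup m (Angle I))"

definition square_count :: "nat \<Rightarrow> nat \<Rightarrow> nat \<Rightarrow> nat \<Rightarrow> nat \<Rightarrow> (bracket_var \<Rightarrow>\<^sub>0 nat) \<Rightarrow> nat" where
  "square_count n k r a x m = (\<Sum>K | K \<in> subsets n k \<and> r \<le> a \<and> a - r < count_below ({..<n} - K) x.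
     lookup m (Square K))"

text \<open>For a column \<open>I\<close> starting in row \<open>a0\<close>, the digits of row \<open>a\<close> up to column index \<open>x\<close> tell whether
  the entry in row \<open>a\<close> exists and lies below \<open>x\<close>.\<close>

lemma sum_of_bool_positions:
  assumes I: "I \<subseteq> {..<n}" "card I = s" and a: "a0 + s \<le> n" "a < n" and x: "x \<le> n" and q: "n * n \<le> q"
  shows "(\<Sum>i<x. of_bool (position n a i \<in> insert q ((\<lambda>b. position n (a0 + b) (sorted_list_of_set I ! b)) ` {..<s})))
    = (of_bool (a0 \<le> a \<and> a - a0 < count_below I x) :: nat)"
proof -
  have fin: "finite I" using I finite_subset by blast
  have In: "sorted_list_of_set I ! b < n" if "b < s" for b
    using that I fin nth_mem[of b "sorted_list_of_set I"] by auto
  have iff: "position n a i \<in> insert q ((\<lambda>b. position n (a0 + b) (sorted_list_of_set I ! b)) ` {..<s})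
      \<longleftrightarrow> a0 \<le> a \<and> a - a0 < s \<and> i = sorted_list_of_set I ! (a - a0)" if i: "i < n" for i
  proof
    assume "position n a i \<in> insert q ((\<lambda>b. position n (a0 + b) (sorted_list_of_set I ! b)) ` {..<s})"
    then obtain b where b: "b < s" "position n a i = position n (a0 + b) (sorted_list_of_set I ! b)"
      using position_less[OF a(2) i] q by auto
    from position_inj[OF b(2)] a b(1) In[OF b(1)] i
    have "a = a0 + b \<and> i = sorted_list_of_set I ! b" by simp
    then show "a0 \<le> a \<and> a - a0 < s \<and> i = sorted_list_of_set I ! (a - a0)" using b(1) by simp
  next
    assume "a0 \<le> a \<and> a - a0 < s \<and> i = sorted_list_of_set I ! (a - a0)"
    then show "position n a i \<in> insert q ((\<lambda>b. position n (a0 + b) (sorted_list_of_set I ! b)) ` {..<s})"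
      by (intro insertI2 image_eqI[of _ _ "a - a0"]) auto
  qed
  have "(\<Sum>i<x. of_bool (position n a i \<in> insert q ((\<lambda>b. position n (a0 + b) (sorted_list_of_set I ! b)) ` {..<s})))
    = (\<Sum>i<x. if i = sorted_list_of_set I ! (a - a0) then of_bool (a0 \<le> a \<and> a - a0 < s) else (0::nat))"
    using x by (intro sum.cong refl) (subst iff, auto)
  also have "\<dots> = of_bool (a0 \<le> a \<and> a - a0 < s \<and> sorted_list_of_set I ! (a - a0) < x)"
    by (subst sum.delta) auto
  also have "\<dots> = of_bool (a0 \<le> a \<and> a - a0 < count_below I x)"
    using nth_sorted_less_iff[OF fin, of "a - a0" x] I(2) count_below_le_card[OF fin, of x]
    by (auto simp: count_below_def)
  finally show ?thesis .
qed

lemma sum_digits_row: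
  assumes rk: "r \<le> k" "k \<le> n" and m: "keys m \<subseteq> bracket_vars k n" and a: "a < n" and x: "x \<le> n"
  shows "(\<Sum>i<x. digit n k r m (position n a i)) = angle_count n k a x m + square_count n k r a x m"
proof -
  have fin: "finite (subsets n k)" by (simp add: subsets_def)
  have A: "(\<Sum>i<x. of_bool (position n a i \<in> positions n k r (Angle I))) = (of_bool (a < count_below I x) :: nat)"
    if "I \<in> subsets n k" for I
    using sum_of_bool_positions[of I n k 0 a x "n * n"] subsetsD[OF that] rk a x by simp
  have S: "(\<Sum>i<x. of_bool (position n a i \<in> positions n k r (Square K)))
      = (of_bool (r \<le> a \<and> a - r < count_below ({..<n} - K) x) :: nat)"
    if K: "K \<in> subsets n k" for K
    using sum_of_bool_positions[of "{..<n} - K" n "n - k" r a x "n * n + 1"] subsetsD[OF K] rk a x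
    by (simp add: card_Diff_subset)
  have "(\<Sum>i<x. digit n k r m (position n a i))
      = (\<Sum>v\<in>keys m. \<Sum>i<x. lookup m v * of_bool (position n a i \<in> positions n k r v))"
    unfolding digit_def weight_def by (rule sum.swap)
  also have "\<dots> = weight (\<lambda>v. \<Sum>i<x. of_bool (position n a i \<in> positions n k r v)) m"
    by (simp only: weight_def sum_distrib_left)
  also have "\<dots> = (\<Sum>I\<in>subsets n k. lookup m (Angle I) * of_bool (a < count_below I x)) +
      (\<Sum>K\<in>subsets n k. lookup m (Square K) * of_bool (r \<le> a \<and> a - r < count_below ({..<n} - K) x))"
    unfolding weight_bracket_vars[OF m] using A S by (intro arg_cong2[of _ _ _ _ "(+)"] sum.cong refl) (simp_all only:)
  also have "\<dots> = angle_count n k a x m + square_count n k r a x m"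
    unfolding angle_count_def square_count_def using fin
    by (intro arg_cong2[of _ _ _ _ "(+)"] sum.mono_neutral_cong_right) auto
  finally show ?thesis .
qed

lemma top_digits:
  assumes rk: "r \<le> k" "k \<le> n" and m: "keys m \<subseteq> bracket_vars k n"
  shows "digit n k r m (n * n) = (\<Sum>I\<in>subsets n k. lookup m (Angle I))"
    "digit n k r m (n * n + 1) = (\<Sum>K\<in>subsets n k. lookup m (Square K))"
proof -
  have "position n (a0 + a) (sorted_list_of_set I ! a) < n * n"
    if "I \<subseteq> {..<n}" "a < card I" "a0 + a < n" for I a a0
  proof -
    have "sorted_list_of_set I ! a \<in> I"
      using that nth_mem[of a "sorted_list_of_set I"] finite_subset[of I "{..<n}"] by simp
    then show ?thesis using that position_less[of "a0 + a" n "sorted_list_of_set I ! a"] by auto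
  qed
  note pos = this
  have A: "n * n \<in> positions n k r (Angle I)" "n * n + 1 \<notin> positions n k r (Angle I)"
    if I: "I \<in> subsets n k" for I
    using pos[of I _ 0] subsetsD[OF I] rk by auto (metis lessThan_iff not_less_eq less_trans lessI add_0)+
  have S: "n * n + 1 \<in> positions n k r (Square K)" "n * n \<notin> positions n k r (Square K)"
    if K: "K \<in> subsets n k" for K
  proof -
    have "card ({..<n} - K) = n - k" using subsetsD[OF K] by (simp add: card_Diff_subset)
    then show "n * n + 1 \<in> positions n k r (Square K)" "n * n \<notin> positions n k r (Square K)"
      using pos[of "{..<n} - K" _ r] rk by fastforce+
  qed
  show "digit n k r m (n * n) = (\<Sum>I\<in>subsets n k. lookup m (Angle I))"
    "digit n k r m (n * n + 1) = (\<Sum>K\<in>subsets n k. lookup m (Square K))"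
    unfolding digit_def weight_bracket_vars[OF m] using A S by simp_all
qed

lemma standard_compatible:
  assumes "m \<in> standard k n r" "lookup m v \<noteq> 0" "lookup m w \<noteq> 0"
  shows "compatible n r v w"
proof -
  have "v \<in> keys m" "w \<in> keys m" using assms by (simp_all add: in_keys_iff)
  then show ?thesis using assms(1) unfolding standard_def by blast
qed

text \<open>In a row shared by both kinds of columns, the entries of the square columns come first: as
  soon as an angle column contributes an entry below \<open>x\<close>, all square columns do. So the merged
  row determines how it splits.\<close>

lemma square_count_eq:
  assumes rk: "r \<le> k" "k \<le> n" and m: "m \<in> standard k n r" and a: "a < n" and x: "x \<le> n"
  shows "square_count n k r a x m = (if a < r then 0
    else if a < k then min (angle_count n k a x m + square_count n k r a x m) (\<Sum>K\<in>subsets n k. lookup m (Square K))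
    else angle_count n k a x m + square_count n k r a x m)"
proof -
  have fin: "finite (subsets n k)" by (simp add: subsets_def)
  have le: "square_count n k r a x m \<le> (\<Sum>K\<in>subsets n k. lookup m (Square K))"
    unfolding square_count_def using fin by (intro sum_mono2) auto
  consider "a < r" | "k \<le> a" | "r \<le> a" "a < k" by linarith
  then show ?thesis
  proof cases
    case 1
    then show ?thesis by (simp add: square_count_def)
  next
    case 2
    have "\<not> a < count_below I x" if "I \<in> subsets n k" for I
      using count_below_le_card[of I x] subsetsD[OF that] 2 by simp
    then have "{I \<in> subsets n k. a < count_below I x} = {}" by blast
    then have "angle_count n k a x m = 0" by (simp only: angle_count_def sum.empty)
    then show ?thesis using 2 rk by simp
  next
    case 3
    have "square_count n k r a x m = (\<Sum>K\<in>subsets n k. lookup m (Square K))"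
      if pos: "angle_count n k a x m \<noteq> 0"
    proof -
      obtain I where I: "I \<in> subsets n k" "a < count_below I x" "lookup m (Angle I) \<noteq> 0"
        using pos unfolding angle_count_def
        by (metis (mono_tags, lifting) mem_Collect_eq sum.not_neutral_contains_not_neutral)
      have "a - r < count_below ({..<n} - K) x" if K: "lookup m (Square K) \<noteq> 0" for K
      proof -
        have "compatible n r (Angle I) (Square K)"
          using m I(3) K by (rule standard_compatible)
        then have "count_below I x + count_below K x \<le> x + r" using x by simp
        then show ?thesis using I(2) 3 count_below_complement[OF x, of K] by simp
      qed
      then show ?thesis
        unfolding square_count_def using fin 3 by (intro sum.mono_neutral_left) auto
    qed
    then show ?thesis using 3 le by (cases "angle_count n k a x m = 0") (auto simp: min_def)
  qed
qed

lemma standard_monomial_determined: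
  assumes rk: "r \<le> k" "k \<le> n" and m: "m \<in> standard k n r" and m': "m' \<in> standard k n r"
    and dig: "\<And>p. p < n * n + 2 \<Longrightarrow> digit n k r m p = digit n k r m' p"
  shows "m = m'"
proof -
  have keys: "keys m \<subseteq> bracket_vars k n" "keys m' \<subseteq> bracket_vars k n"
    using m m' by (simp_all add: standard_def)
  have fin: "finite (subsets n k)" by (simp add: subsets_def)
  have total: "(\<Sum>I\<in>subsets n k. lookup m (Angle I)) = (\<Sum>I\<in>subsets n k. lookup m' (Angle I))"
    "(\<Sum>K\<in>subsets n k. lookup m (Square K)) = (\<Sum>K\<in>subsets n k. lookup m' (Square K))"
    using top_digits[OF rk keys(1)] top_digits[OF rk keys(2)] dig[of "n * n"] dig[of "n * n + 1"] by simp_all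
  have row: "angle_count n k a x m + square_count n k r a x m = angle_count n k a x m' + square_count n k r a x m'"
    if "a < n" "x \<le> n" for a x
    unfolding sum_digits_row[OF rk keys(1) that, symmetric] sum_digits_row[OF rk keys(2) that, symmetric]
  proof (rule sum.cong[OF refl])
    fix i assume "i \<in> {..<x}"
    then have "position n a i < n * n" using that by (intro position_less) auto
    then show "digit n k r m (position n a i) = digit n k r m' (position n a i)" by (intro dig) simp
  qed
  have square: "square_count n k r a x m = square_count n k r a x m'" if "a < n" "x \<le> n" for a x
    by (rule trans[OF square_count_eq[OF rk m that]], subst square_count_eq[OF rk m' that])
      (simp only: row[OF that] total(2))
  have angle: "angle_count n k a x m = angle_count n k a x m'" if "a < n" "x \<le> n" for a x
    using row[OF that] square[OF that] by simp
  have "lookup m (Angle I) = lookup m' (Angle I)" if I: "I \<in> subsets n k" for I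
  proof (rule chain_determined_by_counts[of "subsets n k" "{..n}" _ count_below])
    fix I J assume IJ: "I \<in> subsets n k" "J \<in> subsets n k"
    {
      assume "0 < lookup m (Angle I)" "0 < lookup m (Angle J)"
      then have "compatible n r (Angle I) (Angle J)" by (intro standard_compatible[OF m]) simp_all
      then show "(\<forall>x\<in>{..n}. count_below I x \<le> count_below J x) \<or> (\<forall>x\<in>{..n}. count_below J x \<le> count_below I x)"
        by (auto simp: seq_le_def)
    }
    {
      assume "0 < lookup m' (Angle I)" "0 < lookup m' (Angle J)"
      then have "compatible n r (Angle I) (Angle J)" by (intro standard_compatible[OF m']) simp_all
      then show "(\<forall>x\<in>{..n}. count_below I x \<le> count_below J x) \<or> (\<forall>x\<in>{..n}. count_below J x \<le> count_below I x)"
        by (auto simp: seq_le_def)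
    }
    assume "\<And>x. x \<in> {..n} \<Longrightarrow> count_below I x = count_below J x"
    then show "I = J" using IJ by (intro count_below_inj[of I n J]) (auto simp: subsets_def)
  next
    fix x s assume x: "x \<in> {..n}"
    show "(\<Sum>J | J \<in> subsets n k \<and> s \<le> count_below J x. lookup m (Angle J))
        = (\<Sum>J | J \<in> subsets n k \<and> s \<le> count_below J x. lookup m' (Angle J))"
    proof (cases s)
      case 0
      then show ?thesis using total(1) by simp
    next
      case (Suc a)
      show ?thesis
      proof (cases "a < n")
        case True
        then show ?thesis using angle[of a x] x Suc by (simp add: angle_count_def Suc_le_eq)
      next
        case False
        have "\<not> s \<le> count_below J x" if "J \<in> subsets n k" for J
          using count_below_le_card[of J x] subsetsD[OF that] False Suc rk by simp
        then show ?thesis by (metis (no_types, lifting) mem_Collect_eq sum.cong)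
      qed
    qed
  qed (use fin I in auto)
  moreover have "lookup m (Square K) = lookup m' (Square K)" if K: "K \<in> subsets n k" for K
  proof (rule chain_determined_by_counts[of "subsets n k" "{..n}" _ "\<lambda>K. count_below ({..<n} - K)"])
    fix I J assume IJ: "I \<in> subsets n k" "J \<in> subsets n k"
    have compl: "(\<forall>x\<in>{..n}. count_below ({..<n} - I) x \<le> count_below ({..<n} - J) x) \<or>
        (\<forall>x\<in>{..n}. count_below ({..<n} - J) x \<le> count_below ({..<n} - I) x)"
      if "compatible n r (Square I) (Square J)"
      using that by (auto simp: seq_le_def count_below_complement)
    {
      assume "0 < lookup m (Square I)" "0 < lookup m (Square J)"
      then have "compatible n r (Square I) (Square J)" by (intro standard_compatible[OF m]) simp_all
      then show "(\<forall>x\<in>{..n}. count_below ({..<n} - I) x \<le> count_below ({..<n} - J) x) \<or>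
        (\<forall>x\<in>{..n}. count_below ({..<n} - J) x \<le> count_below ({..<n} - I) x)" by (rule compl)
    }
    {
      assume "0 < lookup m' (Square I)" "0 < lookup m' (Square J)"
      then have "compatible n r (Square I) (Square J)" by (intro standard_compatible[OF m']) simp_all
      then show "(\<forall>x\<in>{..n}. count_below ({..<n} - I) x \<le> count_below ({..<n} - J) x) \<or>
        (\<forall>x\<in>{..n}. count_below ({..<n} - J) x \<le> count_below ({..<n} - I) x)" by (rule compl)
    }
    assume "\<And>x. x \<in> {..n} \<Longrightarrow> count_below ({..<n} - I) x = count_below ({..<n} - J) x"
    then have "{..<n} - I = {..<n} - J" by (intro count_below_inj[of _ n]) auto
    then show "I = J" using IJ by (auto simp: subsets_def)
  next
    fix x s assume x: "x \<in> {..n}"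
    show "(\<Sum>J | J \<in> subsets n k \<and> s \<le> count_below ({..<n} - J) x. lookup m (Square J))
        = (\<Sum>J | J \<in> subsets n k \<and> s \<le> count_below ({..<n} - J) x. lookup m' (Square J))"
    proof (cases s)
      case 0
      then show ?thesis using total(2) by simp
    next
      case (Suc a)
      show ?thesis
      proof (cases "r + a < n")
        case True
        then show ?thesis using square[of "r + a" x] x Suc by (simp add: square_count_def Suc_le_eq)
      next
        case False
        have "\<not> s \<le> count_below ({..<n} - J) x" if "J \<in> subsets n k" for J
          using count_below_le_card[of "{..<n} - J" x] subsetsD[OF that] False Suc rk
          by (simp add: card_Diff_subset)
        then show ?thesis by (metis (no_types, lifting) mem_Collect_eq sum.cong)
      qed
    qed
  qed (use fin K in auto)
  ultimately have "lookup m v = lookup m' v" if "v \<in> bracket_vars k n" for v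
    using that by (auto simp: bracket_vars_def)
  moreover have "lookup m v = lookup m' v" if "v \<notin> bracket_vars k n" for v
    using that keys by (metis in_keys_iff subsetD)
  ultimately show ?thesis by (intro poly_mapping_eqI) blast
qed

lemma standard_polynomial_vanishing_on_SH:
  assumes rk: "r \<le> k" and kn: "2 * k \<le> r + n"
    and f: "f \<in> SH_ideal k n r" and std: "f \<in> monomials_in (standard k n r)"
  shows "f = 0"
proof -
  have kn': "k \<le> n" using rk kn by simp
  have keys: "keys f \<subseteq> standard k n r" using std by (simp add: monomials_in_def)
  have vars: "keys m \<subseteq> bracket_vars k n" if "m \<in> keys f" for m
    using that keys by (auto simp: standard_def)
  \<comment> \<open>the base exceeds \<open>n\<close>, so that diagonal products dominate, and all degrees, so that digits do not
    carry\<close>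
  define B where "B = Suc (n + (\<Sum>m\<in>keys f. weight (\<lambda>_. 1) m))"
  have nB: "n < B" by (simp add: B_def)
  have deg: "weight (\<lambda>_. 1) m < B" if "m \<in> keys f" for m
    using member_le_sum[of m "keys f" "weight (\<lambda>_. 1)"] that by (simp add: B_def)
  show ?thesis
  proof (rule distinct_leading_terms_independent)
    fix m v assume "m \<in> keys f" "v \<in> keys m"
    then have v: "v \<in> bracket_vars k n" using vars by blast
    have "lead_sign n k r v \<noteq> 0" by (cases v) (simp_all add: complement_sign_def sign_def)
    then show "((\<lambda>t. test_point n k r B t v / of_real t ^ lead_exponent n k r B v) \<longlongrightarrow> lead_sign n k r v) at_top
        \<and> lead_sign n k r v \<noteq> 0"
      using test_point_leading_term[OF rk kn' nB v] by simp
  next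
    show "inj_on (weight (lead_exponent n k r B)) (keys f)"
    proof (rule inj_onI)
      fix m m' assume m: "m \<in> keys f" "m' \<in> keys f"
        and eq: "weight (lead_exponent n k r B) m = weight (lead_exponent n k r B) m'"
      have "digit n k r m p = digit n k r m' p" if "p < n * n + 2" for p
      proof (rule digits_unique[of "n * n + 2" "digit n k r m" B "digit n k r m'"])
        show "digit n k r m q < B" "digit n k r m' q < B" for q
          using digit_le_degree[of n k r m q] digit_le_degree[of n k r m' q] deg[OF m(1)] deg[OF m(2)] by simp_all
        show "(\<Sum>p<n * n + 2. digit n k r m p * B ^ p) = (\<Sum>p<n * n + 2. digit n k r m' p * B ^ p)"
          using eq weight_lead_exponent[OF rk kn' vars[OF m(1)]] weight_lead_exponent[OF rk kn' vars[OF m(2)]] by simp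
      qed fact
      then show "m = m'" using keys m by (intro standard_monomial_determined[OF rk kn']) auto
    qed
  next
    show "\<forall>\<^sub>F t in at_top. eval_cpoly (test_point n k r B t) f = 0"
      by (rule eventually_mono[OF eventually_test_point_on_SH[OF rk kn nB]]) (use SH_idealD(2)[OF f] in blast)
  qed
qed

theorem theorem3p4:
  fixes k n r :: nat
  assumes "k \<ge> 1" and "r \<le> k" and "2 * k \<le> r + n"
  shows "SH_ideal k n r =
     genideal (SH_ring k n) (pluecker_ideal Angle k n)
       <+>\<^bsub>SH_ring k n\<^esub> genideal (SH_ring k n) (pluecker_ideal Square k n)
       <+>\<^bsub>SH_ring k n\<^esub> genideal (SH_ring k n) (PQT_entries k n r)"
proof -
  interpret relation_ideal k n r "relations k n r" by (rule relation_ideal_relations)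
  have "f \<in> relations k n r" if f: "f \<in> SH_ideal k n r" for f
  proof -
    obtain g where g: "g \<in> monomials_in (standard k n r)" "f - g \<in> relations k n r"
      using reducible_carrier[OF SH_idealD(1)[OF f]] by (auto simp: reducible_def)
    have fg: "f - g \<in> SH_ideal k n r" using g(2) relations_subset_SH_ideal[OF assms(2)] by blast
    have "g \<in> SH_ideal k n r"
    proof (rule SH_idealI)
      show "g \<in> carrier (SH_ring k n)"
        using g(1) unfolding SH_ring_simps by (rule monomials_in_mono) (auto simp: standard_def)
      fix x V W assume x: "(V, W) \<in> SH k n r" "x \<circ> Angle \<in> pluecker_line k n V" "x \<circ> Square \<in> pluecker_line k n W"
      show "eval_cpoly x g = 0"
        using SH_idealD(2)[OF f x] SH_idealD(2)[OF fg x] eval_cpoly_add[of x "f - g" g] by simp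
    qed
    then have "g = 0" using assms g(1) by (intro standard_polynomial_vanishing_on_SH)
    then show ?thesis using g(2) by simp
  qed
  then show ?thesis
    using relations_subset_SH_ideal[OF assms(2)] unfolding relations_def by blast
qed

end
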